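(* Let $X$ be a bounded lattice on which a group $G$ acts by lattice automorphisms, let $A$ be a commutative ring with identity, and let $B$ be an $A$-module, on which $G$ is taken to act trivially. Let $\mathcal{X}=\operatorname{Spec}(A[X]/I_A)$, $\mathcal{S}=\operatorname{Spec}(A)$, let $f:\mathcal{X}\to\mathcal{S}$ be the canonical map, let $\widehat{B}$ be the sheaf of $\mathcal{O}_{\mathcal{S}}$-modules associated to $B$, and let \[ \mathcal{F}_B:=\mathcal{H}om_{\mathcal{O}_{\mathcal{S}}}(f_*\mathcal{O}_{\mathcal{X}},\widehat{B}) \] be the sheaf of (scheme-theoretic) measures with values in $B$. Then \[ \Gamma(\mathcal{S},\mathcal{F}_B)\cong\operatorname{Hom}_A(\Gamma(\mathcal{X},\mathcal{O}_{\mathcal{X}}),B)=\operatorname{Hom}_A(A[X]/I_A,B), \] and \[ \mathcal{M}(X,B)\cong\operatorname{Hom}_A(\Gamma(\mathcal{X},\mathcal{O}_{\mathcal{X}}),B),\qquad \mathcal{M}(X,B;G)\cong\operatorname{Hom}_A(\Gamma(\mathcal{X},\mathcal{O}_{\mathcal{X}}),B)^G . \] In particular, measures on $X$ with values in $B$ are in bijection with global sections of $\mathcal{F}_B$.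
   Context: A bounded lattice $X$ has a least element $0_X$ and a greatest element $1_X$. A ($B$-valued) measure on $X$ is a function $\nu:X\to B$ with $\nu(0_X)=0$ and, for all $k\ge 2$ and all $x_1,\dots,x_k\in X$, \[ \nu(x_1\vee\dots\vee x_k)=\sum_{s=1}^k(-1)^{s+1}\sum_{1\leq i_1<\dots<i_s\leq k}\nu(x_{i_1}\wedge\dots\wedge x_{i_s}). \] $\mathcal{M}(X,B)$ is the $A$-module of all $B$-valued measures on $X$, and $\mathcal{M}(X,B;G)$ is the submodule of $G$-invariant measures ($\nu(gx)=\nu(x)$). $\mathbb{Z}[X]$ is the polynomial ring with one variable for each element of $X$, and $I\subseteq\mathbb{Z}[X]$ is the ideal generated by $0_X$, $1_X-1$, and $x\wedge y-xy$, $x\vee y-x-y+xy$ for all $x,y\in X$. $I_A$ is the ideal of $A[X]$ generated by the image of $I$. The action of $G$ on $X$ induces an action on $A[X]/I_A=\Gamma(\mathcal{X},\mathcal{O}_{\mathcal{X}})$, and $G$ acts on $\operatorname{Hom}_A(A[X]/I_A,B)$ by $(g\varphi)(m)=\varphi(g^{-1}m)$; $(-)^G$ denotes the fixed elements. The isomorphisms are of $A$-modules. *)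

theory Defs
  imports "HOL-Algebra.Algebra" "HOL-Analysis.Abstract_Topology"
begin

section \<open>Modules\<close>

text \<open>The library's module record extends the ring record; for a module that is not an algebra
  the fields \<open>mult\<close> and \<open>one\<close> carry no meaning and are left unspecified.\<close>

definition plain_module :: "'m set \<Rightarrow> 'm \<Rightarrow> ('m \<Rightarrow> 'm \<Rightarrow> 'm) \<Rightarrow> ('r \<Rightarrow> 'm \<Rightarrow> 'm) \<Rightarrow> ('r, 'm) module"
  where "plain_module C z p s =
    \<lparr>carrier = C, monoid.mult = undefined, one = undefined, ring.zero = z, ring.add = p, smult = s\<rparr>"

definition ring_along :: "('r \<Rightarrow> 't) \<Rightarrow> ('t, 'c) ring_scheme \<Rightarrow> ('r, 't) module"
  where "ring_along h T =
    \<lparr>carrier = carrier T, monoid.mult = monoid.mult T, one = one T,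
     ring.zero = ring.zero T, ring.add = ring.add T, smult = (\<lambda>a t. h a \<otimes>\<^bsub>T\<^esub> t)\<rparr>"

definition restrict_scalars :: "('r \<Rightarrow> 's) \<Rightarrow> ('s, 'm, 'c) module_scheme \<Rightarrow> ('r, 'm) module"
  where "restrict_scalars h M =
    plain_module (carrier M) (ring.zero M) (ring.add M) (\<lambda>a m. h a \<odot>\<^bsub>M\<^esub> m)"

definition linear_maps ::
  "('r, 'c) ring_scheme \<Rightarrow> ('r, 'm, 'd) module_scheme \<Rightarrow> ('r, 'n, 'e) module_scheme \<Rightarrow> ('m \<Rightarrow> 'n) set"
  where "linear_maps R M N = {\<phi> \<in> carrier M \<rightarrow>\<^sub>E carrier N.
    (\<forall>x\<in>carrier M. \<forall>y\<in>carrier M. \<phi> (x \<oplus>\<^bsub>M\<^esub> y) = \<phi> x \<oplus>\<^bsub>N\<^esub> \<phi> y) \<and>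
    (\<forall>a\<in>carrier R. \<forall>x\<in>carrier M. \<phi> (a \<odot>\<^bsub>M\<^esub> x) = a \<odot>\<^bsub>N\<^esub> \<phi> x)}"

definition Hom_module ::
  "('r, 'c) ring_scheme \<Rightarrow> ('r, 'm, 'd) module_scheme \<Rightarrow> ('r, 'n, 'e) module_scheme \<Rightarrow> ('r, 'm \<Rightarrow> 'n) module"
  where "Hom_module R M N = plain_module (linear_maps R M N)
    (\<lambda>x\<in>carrier M. \<zero>\<^bsub>N\<^esub>)
    (\<lambda>\<phi> \<psi>. \<lambda>x\<in>carrier M. \<phi> x \<oplus>\<^bsub>N\<^esub> \<psi> x)
    (\<lambda>a \<phi>. \<lambda>x\<in>carrier M. a \<odot>\<^bsub>N\<^esub> \<phi> x)"

definition module_iso ::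
  "('r, 'c) ring_scheme \<Rightarrow> ('r, 'm, 'd) module_scheme \<Rightarrow> ('r, 'n, 'e) module_scheme \<Rightarrow> ('m \<Rightarrow> 'n) set"
  where "module_iso R M N = {\<phi> \<in> linear_maps R M N. bij_betw \<phi> (carrier M) (carrier N)}"

definition module_isomorphic ::
  "('r, 'c) ring_scheme \<Rightarrow> ('r, 'm, 'd) module_scheme \<Rightarrow> ('r, 'n, 'e) module_scheme \<Rightarrow> bool"
  where "module_isomorphic R M N \<longleftrightarrow> module_iso R M N \<noteq> {}"

text \<open>For an action \<open>\<rho>\<close> of \<open>G\<close> on \<open>M\<close> and the trivial action on the target,
  \<open>G\<close> acts on linear maps by \<open>(g \<phi>)(m) = \<phi> (g\<^sup>-\<^sup>1 m)\<close>.\<close>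

definition hom_action ::
  "('g, 'h) monoid_scheme \<Rightarrow> ('g \<Rightarrow> 'm \<Rightarrow> 'm) \<Rightarrow> ('r, 'm, 'd) module_scheme \<Rightarrow> 'g \<Rightarrow> ('m \<Rightarrow> 'n) \<Rightarrow> ('m \<Rightarrow> 'n)"
  where "hom_action G \<rho> M g \<phi> = (\<lambda>m\<in>carrier M. \<phi> (\<rho> (inv\<^bsub>G\<^esub> g) m))"

definition Hom_invariants ::
  "('g, 'h) monoid_scheme \<Rightarrow> ('g \<Rightarrow> 'm \<Rightarrow> 'm) \<Rightarrow> ('r, 'c) ring_scheme \<Rightarrow>
   ('r, 'm, 'd) module_scheme \<Rightarrow> ('r, 'n, 'e) module_scheme \<Rightarrow> ('r, 'm \<Rightarrow> 'n) module"
  where "Hom_invariants G \<rho> R M N = (Hom_module R M N)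
    \<lparr>carrier := {\<phi> \<in> linear_maps R M N. \<forall>g\<in>carrier G. hom_action G \<rho> M g \<phi> = \<phi>}\<rparr>"

section \<open>Affine schemes\<close>

definition Spec :: "('a, 'c) ring_scheme \<Rightarrow> 'a set set"
  where "Spec R = {P. primeideal P R}"

definition vanishing_set :: "('a, 'c) ring_scheme \<Rightarrow> 'a set \<Rightarrow> 'a set set"
  where "vanishing_set R S = {P \<in> Spec R. S \<subseteq> P}"

definition zariski :: "('a, 'c) ring_scheme \<Rightarrow> 'a set topology"
  where "zariski R = topology (\<lambda>U. \<exists>S\<subseteq>carrier R. U = Spec R - vanishing_set R S)"

lemma istopology_zariski:
  "istopology (\<lambda>U. \<exists>S\<subseteq>carrier R. U = Spec R - vanishing_set R S)"
  unfolding istopology_def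
proof (intro conjI allI impI)
  fix U V
  assume "\<exists>S\<subseteq>carrier R. U = Spec R - vanishing_set R S"
    and "\<exists>S\<subseteq>carrier R. V = Spec R - vanishing_set R S"
  then obtain S T where S: "S \<subseteq> carrier R" "U = Spec R - vanishing_set R S"
    and T: "T \<subseteq> carrier R" "V = Spec R - vanishing_set R T" by blast
  define W where "W = (\<lambda>(s, t). s \<otimes>\<^bsub>R\<^esub> t) ` (S \<times> T) \<inter> carrier R"
  have iff: "P \<in> U \<inter> V \<longleftrightarrow> P \<in> Spec R - vanishing_set R W" for P
  proof (cases "primeideal P R")
    case True
    have I: "ideal P R" and C: "cring R"
      using True by (rule primeideal.axioms)+
    have M: "monoid R" using C by (intro ring.is_monoid cring.axioms(1))
    have mem: "s \<otimes>\<^bsub>R\<^esub> t \<in> P \<longleftrightarrow> s \<in> P \<or> t \<in> P" if "s \<in> S" "t \<in> T" for s t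
    proof -
      have st: "s \<in> carrier R" "t \<in> carrier R" using that S(1) T(1) by auto
      show ?thesis
        using primeideal.I_prime[OF True st] ideal.I_r_closed[OF I _ st(2), of s]
          ideal.I_l_closed[OF I _ st(1), of t] by metis
    qed
    have "(\<lambda>(s, t). s \<otimes>\<^bsub>R\<^esub> t) ` (S \<times> T) \<subseteq> carrier R"
      using monoid.m_closed[OF M subsetD[OF S(1)] subsetD[OF T(1)]] by (simp add: image_subset_iff)
    then have W: "W = (\<lambda>(s, t). s \<otimes>\<^bsub>R\<^esub> t) ` (S \<times> T)"
      unfolding W_def by (rule Int_absorb2)
    have "W \<subseteq> P \<longleftrightarrow> (\<forall>s\<in>S. \<forall>t\<in>T. s \<otimes>\<^bsub>R\<^esub> t \<in> P)"
      unfolding W by (simp add: image_subset_iff)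
    also have "\<dots> \<longleftrightarrow> S \<subseteq> P \<or> T \<subseteq> P"
      unfolding subset_iff Ball_def using mem by meson
    finally show ?thesis
      using True unfolding S(2) T(2) vanishing_set_def Spec_def by simp
  next
    case False
    then show ?thesis unfolding S(2) Spec_def by simp
  qed
  have "W \<subseteq> carrier R" unfolding W_def by simp
  moreover have "U \<inter> V = Spec R - vanishing_set R W" using iff by (rule Set.set_eqI)
  ultimately show "\<exists>S\<subseteq>carrier R. U \<inter> V = Spec R - vanishing_set R S" by metis
next
  fix \<U> :: "'a set set set"
  assume "\<forall>U\<in>\<U>. \<exists>S\<subseteq>carrier R. U = Spec R - vanishing_set R S"
  then obtain S where S: "\<And>U. U \<in> \<U> \<Longrightarrow> S U \<subseteq> carrier R"
    "\<And>U. U \<in> \<U> \<Longrightarrow> U = Spec R - vanishing_set R (S U)" by metis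
  have "\<Union>\<U> = (\<Union>U\<in>\<U>. Spec R - vanishing_set R (S U))" using S(2) by auto
  also have "\<dots> = Spec R - vanishing_set R (\<Union>U\<in>\<U>. S U)"
    unfolding vanishing_set_def by auto
  finally have "\<Union>\<U> = Spec R - vanishing_set R (\<Union>U\<in>\<U>. S U)" .
  moreover have "(\<Union>U\<in>\<U>. S U) \<subseteq> carrier R" using S(1) by auto
  ultimately show "\<exists>S\<subseteq>carrier R. \<Union>\<U> = Spec R - vanishing_set R S" by metis
qed

lemma openin_zariski:
  "openin (zariski R) U \<longleftrightarrow> (\<exists>S\<subseteq>carrier R. U = Spec R - vanishing_set R S)"
  unfolding zariski_def by (simp add: istopology_zariski)

text \<open>The fraction \<open>m / s\<close> in the localization of \<open>M\<close> at the prime \<open>P\<close>, as an equivalence class of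
  pairs. The stalk operations below are the usual ones on representatives.\<close>

definition loc_frac ::
  "('a, 'c) ring_scheme \<Rightarrow> ('a, 'b, 'd) module_scheme \<Rightarrow> 'a set \<Rightarrow> 'b \<Rightarrow> 'a \<Rightarrow> ('b \<times> 'a) set"
  where "loc_frac R M P m s = {(m', s'). m' \<in> carrier M \<and> s' \<in> carrier R - P \<and>
    (\<exists>u\<in>carrier R - P. u \<odot>\<^bsub>M\<^esub> (s' \<odot>\<^bsub>M\<^esub> m) = u \<odot>\<^bsub>M\<^esub> (s \<odot>\<^bsub>M\<^esub> m'))}"

definition self_module :: "('a, 'c) ring_scheme \<Rightarrow> ('a, 'a) module"
  where "self_module R = ring_along (\<lambda>a. a) R"

definition loc_ring :: "('a, 'c) ring_scheme \<Rightarrow> 'a set \<Rightarrow> ('a \<times> 'a) set ring"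
  where "loc_ring R P =
    \<lparr>carrier = {loc_frac R (self_module R) P a s | a s. a \<in> carrier R \<and> s \<in> carrier R - P},
     monoid.mult = (\<lambda>x y. \<Union>(a, s)\<in>x. \<Union>(b, t)\<in>y.
       loc_frac R (self_module R) P (a \<otimes>\<^bsub>R\<^esub> b) (s \<otimes>\<^bsub>R\<^esub> t)),
     one = loc_frac R (self_module R) P \<one>\<^bsub>R\<^esub> \<one>\<^bsub>R\<^esub>,
     ring.zero = loc_frac R (self_module R) P \<zero>\<^bsub>R\<^esub> \<one>\<^bsub>R\<^esub>,
     ring.add = (\<lambda>x y. \<Union>(a, s)\<in>x. \<Union>(b, t)\<in>y.
       loc_frac R (self_module R) P ((t \<otimes>\<^bsub>R\<^esub> a) \<oplus>\<^bsub>R\<^esub> (s \<otimes>\<^bsub>R\<^esub> b)) (s \<otimes>\<^bsub>R\<^esub> t))\<rparr>"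

definition loc_module ::
  "('a, 'c) ring_scheme \<Rightarrow> ('a, 'b, 'd) module_scheme \<Rightarrow> 'a set \<Rightarrow> (('a \<times> 'a) set, ('b \<times> 'a) set) module"
  where "loc_module R M P = plain_module
    {loc_frac R M P m s | m s. m \<in> carrier M \<and> s \<in> carrier R - P}
    (loc_frac R M P \<zero>\<^bsub>M\<^esub> \<one>\<^bsub>R\<^esub>)
    (\<lambda>x y. \<Union>(m, s)\<in>x. \<Union>(n, t)\<in>y.
       loc_frac R M P ((t \<odot>\<^bsub>M\<^esub> m) \<oplus>\<^bsub>M\<^esub> (s \<odot>\<^bsub>M\<^esub> n)) (s \<otimes>\<^bsub>R\<^esub> t))
    (\<lambda>x y. \<Union>(a, s)\<in>x. \<Union>(n, t)\<in>y. loc_frac R M P (a \<odot>\<^bsub>M\<^esub> n) (s \<otimes>\<^bsub>R\<^esub> t))"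

text \<open>A section over \<open>U\<close> assigns to each \<open>P \<in> U\<close> an element of the localization at \<open>P\<close>,
  locally given by a single fraction.\<close>

definition assoc_sections ::
  "('a, 'c) ring_scheme \<Rightarrow> ('a, 'b, 'd) module_scheme \<Rightarrow> 'a set set \<Rightarrow> ('a set \<Rightarrow> ('b \<times> 'a) set) set"
  where "assoc_sections R M U = {\<sigma> \<in> (\<Pi>\<^sub>E P\<in>U. carrier (loc_module R M P)).
    \<forall>P\<in>U. \<exists>V m f. openin (zariski R) V \<and> P \<in> V \<and> V \<subseteq> U \<and> m \<in> carrier M \<and> f \<in> carrier R \<and>
      (\<forall>Q\<in>V. f \<notin> Q \<and> \<sigma> Q = loc_frac R M Q m f)}"

text \<open>\<open>'p\<close> is the type of points, \<open>'o\<close> the type of the objects of sections (ring or module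
  records) and \<open>'s\<close> the type of their elements.\<close>

record ('p, 'o, 's) presheaf =
  sections :: "'p set \<Rightarrow> 'o"
  restr :: "'p set \<Rightarrow> 'p set \<Rightarrow> 's \<Rightarrow> 's"

definition structure_sheaf ::
  "('a, 'c) ring_scheme \<Rightarrow>
   ('a set, ('a set \<Rightarrow> ('a \<times> 'a) set) ring, 'a set \<Rightarrow> ('a \<times> 'a) set) presheaf"
  where "structure_sheaf R =
    \<lparr>sections = (\<lambda>U.
       \<lparr>carrier = assoc_sections R (self_module R) U,
        monoid.mult = (\<lambda>\<sigma> \<tau>. \<lambda>P\<in>U. \<sigma> P \<otimes>\<^bsub>loc_ring R P\<^esub> \<tau> P),
        one = (\<lambda>P\<in>U. \<one>\<^bsub>loc_ring R P\<^esub>),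
        ring.zero = (\<lambda>P\<in>U. \<zero>\<^bsub>loc_ring R P\<^esub>),
        ring.add = (\<lambda>\<sigma> \<tau>. \<lambda>P\<in>U. \<sigma> P \<oplus>\<^bsub>loc_ring R P\<^esub> \<tau> P)\<rparr>),
     restr = (\<lambda>U V \<sigma>. restrict \<sigma> V)\<rparr>"

definition assoc_sheaf ::
  "('a, 'c) ring_scheme \<Rightarrow> ('a, 'b, 'd) module_scheme \<Rightarrow>
   ('a set, ('a set \<Rightarrow> ('a \<times> 'a) set, 'a set \<Rightarrow> ('b \<times> 'a) set) module, 'a set \<Rightarrow> ('b \<times> 'a) set) presheaf"
  where "assoc_sheaf R M =
    \<lparr>sections = (\<lambda>U. plain_module (assoc_sections R M U)
       (\<lambda>P\<in>U. \<zero>\<^bsub>loc_module R M P\<^esub>)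
       (\<lambda>\<sigma> \<tau>. \<lambda>P\<in>U. \<sigma> P \<oplus>\<^bsub>loc_module R M P\<^esub> \<tau> P)
       (\<lambda>a \<sigma>. \<lambda>P\<in>U. a P \<odot>\<^bsub>loc_module R M P\<^esub> \<sigma> P)),
     restr = (\<lambda>U V \<sigma>. restrict \<sigma> V)\<rparr>"

definition global_frac :: "('a, 'c) ring_scheme \<Rightarrow> 'a \<Rightarrow> 'a set \<Rightarrow> ('a \<times> 'a) set"
  where "global_frac R a = (\<lambda>P\<in>Spec R. loc_frac R (self_module R) P a \<one>\<^bsub>R\<^esub>)"

text \<open>The morphism \<open>Spec T \<rightarrow> Spec R\<close> induced by a ring homomorphism \<open>h : R \<rightarrow> T\<close>: the map on
  points, preimages of sets of points, and the comorphism
  \<open>\<O>\<^sub>R(U) \<rightarrow> \<O>\<^sub>T(f\<^sup>-\<^sup>1 U)\<close>, \<open>a / s \<mapsto> h a / h s\<close>.\<close>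

definition Spec_map :: "('a, 'c) ring_scheme \<Rightarrow> ('a \<Rightarrow> 't) \<Rightarrow> 't set \<Rightarrow> 'a set"
  where "Spec_map R h Q = {a \<in> carrier R. h a \<in> Q}"

definition Spec_preimage ::
  "('a, 'c) ring_scheme \<Rightarrow> ('t, 'd) ring_scheme \<Rightarrow> ('a \<Rightarrow> 't) \<Rightarrow> 'a set set \<Rightarrow> 't set set"
  where "Spec_preimage R T h U = {Q \<in> Spec T. Spec_map R h Q \<in> U}"

definition Spec_comorphism ::
  "('a, 'c) ring_scheme \<Rightarrow> ('t, 'd) ring_scheme \<Rightarrow> ('a \<Rightarrow> 't) \<Rightarrow> 'a set set \<Rightarrow>
   ('a set \<Rightarrow> ('a \<times> 'a) set) \<Rightarrow> ('t set \<Rightarrow> ('t \<times> 't) set)"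
  where "Spec_comorphism R T h U \<sigma> = (\<lambda>Q\<in>Spec_preimage R T h U.
    \<Union>(a, s)\<in>\<sigma> (Spec_map R h Q). loc_frac T (self_module T) Q (h a) (h s))"

text \<open>\<open>f\<^sub>*\<O>\<^sub>T\<close> as a sheaf of \<open>\<O>\<^sub>R\<close>-modules.\<close>

definition direct_image ::
  "('a, 'c) ring_scheme \<Rightarrow> ('t, 'd) ring_scheme \<Rightarrow> ('a \<Rightarrow> 't) \<Rightarrow>
   ('a set, ('a set \<Rightarrow> ('a \<times> 'a) set, 't set \<Rightarrow> ('t \<times> 't) set) module, 't set \<Rightarrow> ('t \<times> 't) set) presheaf"
  where "direct_image R T h =
    \<lparr>sections = (\<lambda>U. ring_along (Spec_comorphism R T h U)
       (sections (structure_sheaf T) (Spec_preimage R T h U))),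
     restr = (\<lambda>U V. restr (structure_sheaf T) (Spec_preimage R T h U) (Spec_preimage R T h V))\<rparr>"

text \<open>The sheaf \<open>Hom\<close> of \<open>\<O>\<close>-modules on a space: sections over \<open>U\<close> are the morphisms
  \<open>F|U \<rightarrow> H|U\<close> of sheaves of \<open>\<O>|U\<close>-modules.\<close>

definition sheaf_morphisms ::
  "'p topology \<Rightarrow> ('p, 'r ring, 'r) presheaf \<Rightarrow> ('p, ('r, 'm) module, 'm) presheaf \<Rightarrow>
   ('p, ('r, 'n) module, 'n) presheaf \<Rightarrow> 'p set \<Rightarrow> ('p set \<Rightarrow> 'm \<Rightarrow> 'n) set"
  where "sheaf_morphisms S Ox F H U =
    {\<phi> \<in> (\<Pi>\<^sub>E V\<in>{V. openin S V \<and> V \<subseteq> U}. linear_maps (sections Ox V) (sections F V) (sections H V)).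
      \<forall>V W. openin S V \<and> openin S W \<and> W \<subseteq> V \<and> V \<subseteq> U \<longrightarrow>
        (\<forall>\<sigma>\<in>carrier (sections F V). \<phi> W (restr F V W \<sigma>) = restr H V W (\<phi> V \<sigma>))}"

definition sheaf_Hom ::
  "'p topology \<Rightarrow> ('p, 'r ring, 'r) presheaf \<Rightarrow> ('p, ('r, 'm) module, 'm) presheaf \<Rightarrow>
   ('p, ('r, 'n) module, 'n) presheaf \<Rightarrow>
   ('p, ('r, 'p set \<Rightarrow> 'm \<Rightarrow> 'n) module, 'p set \<Rightarrow> 'm \<Rightarrow> 'n) presheaf"
  where "sheaf_Hom S Ox F H =
    \<lparr>sections = (\<lambda>U. plain_module (sheaf_morphisms S Ox F H U)
       (\<lambda>V\<in>{V. openin S V \<and> V \<subseteq> U}.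
          \<zero>\<^bsub>Hom_module (sections Ox V) (sections F V) (sections H V)\<^esub>)
       (\<lambda>\<phi> \<psi>. \<lambda>V\<in>{V. openin S V \<and> V \<subseteq> U}.
          \<phi> V \<oplus>\<^bsub>Hom_module (sections Ox V) (sections F V) (sections H V)\<^esub> \<psi> V)
       (\<lambda>a \<phi>. \<lambda>V\<in>{V. openin S V \<and> V \<subseteq> U}.
          restr Ox U V a \<odot>\<^bsub>Hom_module (sections Ox V) (sections F V) (sections H V)\<^esub> \<phi> V)),
     restr = (\<lambda>U W \<phi>. restrict \<phi> {V. openin S V \<and> V \<subseteq> W})\<rparr>"

section \<open>The ring attached to a bounded lattice\<close>

text \<open>The polynomial ring over \<open>R\<close> with one variable for each element of \<open>I\<close>; a polynomial
  maps a monomial (a multiset of variables) to its coefficient.\<close>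

definition poly_ring_on :: "('a, 'c) ring_scheme \<Rightarrow> 'x set \<Rightarrow> ('x multiset \<Rightarrow> 'a) ring"
  where "poly_ring_on R I =
    \<lparr>carrier = ring.indexed_pset R I (carrier R),
     monoid.mult = (\<lambda>p q m. \<Oplus>\<^bsub>R\<^esub>u\<in>{u. u \<subseteq># m}. p u \<otimes>\<^bsub>R\<^esub> q (m - u)),
     one = ring.indexed_const R \<one>\<^bsub>R\<^esub>,
     ring.zero = ring.indexed_const R \<zero>\<^bsub>R\<^esub>,
     ring.add = ring.indexed_padd R\<rparr>"

definition lattice_ideal_int :: "('x, 'e) gorder_scheme \<Rightarrow> ('x multiset \<Rightarrow> int) set"
  where "lattice_ideal_int L =
    (let P = poly_ring_on \<Z> (carrier L); v = ring.indexed_var \<Z> in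
     Idl\<^bsub>P\<^esub> ({v \<bottom>\<^bsub>L\<^esub>, v \<top>\<^bsub>L\<^esub> \<ominus>\<^bsub>P\<^esub> \<one>\<^bsub>P\<^esub>} \<union>
       {v (x \<sqinter>\<^bsub>L\<^esub> y) \<ominus>\<^bsub>P\<^esub> (v x \<otimes>\<^bsub>P\<^esub> v y) | x y. x \<in> carrier L \<and> y \<in> carrier L} \<union>
       {((v (x \<squnion>\<^bsub>L\<^esub> y) \<ominus>\<^bsub>P\<^esub> v x) \<ominus>\<^bsub>P\<^esub> v y) \<oplus>\<^bsub>P\<^esub> (v x \<otimes>\<^bsub>P\<^esub> v y) | x y.
          x \<in> carrier L \<and> y \<in> carrier L}))"

definition int_poly_image :: "('a, 'c) ring_scheme \<Rightarrow> ('x multiset \<Rightarrow> int) \<Rightarrow> ('x multiset \<Rightarrow> 'a)"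
  where "int_poly_image A p = (\<lambda>m. [p m] \<cdot>\<^bsub>A\<^esub> \<one>\<^bsub>A\<^esub>)"

definition lattice_ideal ::
  "('a, 'c) ring_scheme \<Rightarrow> ('x, 'e) gorder_scheme \<Rightarrow> ('x multiset \<Rightarrow> 'a) set"
  where "lattice_ideal A L =
    Idl\<^bsub>poly_ring_on A (carrier L)\<^esub> (int_poly_image A ` lattice_ideal_int L)"

definition lattice_ring ::
  "('a, 'c) ring_scheme \<Rightarrow> ('x, 'e) gorder_scheme \<Rightarrow> ('x multiset \<Rightarrow> 'a) set ring"
  where "lattice_ring A L = poly_ring_on A (carrier L) Quot lattice_ideal A L"

definition lattice_ring_map ::
  "('a, 'c) ring_scheme \<Rightarrow> ('x, 'e) gorder_scheme \<Rightarrow> 'a \<Rightarrow> ('x multiset \<Rightarrow> 'a) set"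
  where "lattice_ring_map A L a =
    lattice_ideal A L +>\<^bsub>poly_ring_on A (carrier L)\<^esub> ring.indexed_const A a"

definition lattice_ring_module ::
  "('a, 'c) ring_scheme \<Rightarrow> ('x, 'e) gorder_scheme \<Rightarrow> ('a, ('x multiset \<Rightarrow> 'a) set) module"
  where "lattice_ring_module A L = ring_along (lattice_ring_map A L) (lattice_ring A L)"

text \<open>The global sections of the structure sheaf of the spectrum of the lattice ring. Scalars in \<open>A\<close> act
  through \<open>A \<rightarrow> \<Gamma>(\<S>, \<O>\<^sub>\<S>) \<rightarrow> \<Gamma>(\<X>, \<O>\<^sub>\<X>)\<close>, where \<open>\<X>\<close> is this spectrum and \<open>\<S>\<close> that of \<open>A\<close>.\<close>

definition global_functions ::
  "('a, 'c) ring_scheme \<Rightarrow> ('x, 'e) gorder_scheme \<Rightarrow>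
   ('a, ('x multiset \<Rightarrow> 'a) set set \<Rightarrow> (('x multiset \<Rightarrow> 'a) set \<times> ('x multiset \<Rightarrow> 'a) set) set) module"
  where "global_functions A L =
    ring_along
      (\<lambda>a. Spec_comorphism A (lattice_ring A L) (lattice_ring_map A L) (Spec A) (global_frac A a))
      (sections (structure_sheaf (lattice_ring A L)) (Spec (lattice_ring A L)))"

definition measure_sheaf where
  "measure_sheaf A L B =
    sheaf_Hom (zariski A) (structure_sheaf A)
      (direct_image A (lattice_ring A L) (lattice_ring_map A L)) (assoc_sheaf A B)"

definition measure_sheaf_global where
  "measure_sheaf_global A L B =
    restrict_scalars (global_frac A) (sections (measure_sheaf A L B) (Spec A))"

text \<open>\<open>G\<close> permutes the variables: the coefficient of \<open>g p\<close> at a monomial \<open>m\<close> is that of \<open>p\<close> at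
  \<open>g\<^sup>-\<^sup>1 m\<close>. On a coset the induced action is the image. The action on global functions is
  the comorphism of the automorphism of the spectrum induced by \<open>g\<close>.\<close>

definition poly_action ::
  "('g, 'h) monoid_scheme \<Rightarrow> ('g \<Rightarrow> 'x \<Rightarrow> 'x) \<Rightarrow> ('a, 'c) ring_scheme \<Rightarrow> ('x, 'e) gorder_scheme \<Rightarrow>
   'g \<Rightarrow> ('x multiset \<Rightarrow> 'a) \<Rightarrow> ('x multiset \<Rightarrow> 'a)"
  where "poly_action G act A L g p = (\<lambda>m.
    if set_mset m \<subseteq> carrier L then p (image_mset (act (inv\<^bsub>G\<^esub> g)) m) else \<zero>\<^bsub>A\<^esub>)"

definition lattice_ring_action ::
  "('g, 'h) monoid_scheme \<Rightarrow> ('g \<Rightarrow> 'x \<Rightarrow> 'x) \<Rightarrow> ('a, 'c) ring_scheme \<Rightarrow> ('x, 'e) gorder_scheme \<Rightarrow>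
   'g \<Rightarrow> ('x multiset \<Rightarrow> 'a) set \<Rightarrow> ('x multiset \<Rightarrow> 'a) set"
  where "lattice_ring_action G act A L g C = poly_action G act A L g ` C"

definition global_functions_action where
  "global_functions_action G act A L g =
    Spec_comorphism (lattice_ring A L) (lattice_ring A L) (lattice_ring_action G act A L g)
      (Spec (lattice_ring A L))"

section \<open>Measures on a bounded lattice\<close>

definition lattice_measures ::
  "('x, 'e) gorder_scheme \<Rightarrow> ('a, 'b, 'd) module_scheme \<Rightarrow> ('x \<Rightarrow> 'b) set"
  where "lattice_measures L B = {\<nu> \<in> carrier L \<rightarrow>\<^sub>E carrier B.
    \<nu> \<bottom>\<^bsub>L\<^esub> = \<zero>\<^bsub>B\<^esub> \<and>
    (\<forall>(k::nat)\<ge>2. \<forall>x\<in>{1..k} \<rightarrow> carrier L.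
      \<nu> (\<Squnion>\<^bsub>L\<^esub>(x ` {1..k})) =
        (\<Oplus>\<^bsub>B\<^esub>s\<in>{1..k}. [((-1) ^ (s + 1) :: int)] \<cdot>\<^bsub>B\<^esub>
          (\<Oplus>\<^bsub>B\<^esub>J\<in>{J. J \<subseteq> {1..k} \<and> card J = s}. \<nu> (\<Sqinter>\<^bsub>L\<^esub>(x ` J)))))}"

definition measure_module ::
  "('x, 'e) gorder_scheme \<Rightarrow> ('a, 'b, 'd) module_scheme \<Rightarrow> ('a, 'x \<Rightarrow> 'b) module"
  where "measure_module L B = plain_module (lattice_measures L B)
    (\<lambda>x\<in>carrier L. \<zero>\<^bsub>B\<^esub>)
    (\<lambda>\<nu> \<mu>. \<lambda>x\<in>carrier L. \<nu> x \<oplus>\<^bsub>B\<^esub> \<mu> x)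
    (\<lambda>a \<nu>. \<lambda>x\<in>carrier L. a \<odot>\<^bsub>B\<^esub> \<nu> x)"

definition invariant_measure_module ::
  "('g, 'h) monoid_scheme \<Rightarrow> ('g \<Rightarrow> 'x \<Rightarrow> 'x) \<Rightarrow> ('x, 'e) gorder_scheme \<Rightarrow>
   ('a, 'b, 'd) module_scheme \<Rightarrow> ('a, 'x \<Rightarrow> 'b) module"
  where "invariant_measure_module G act L B = (measure_module L B)
    \<lparr>carrier := {\<nu> \<in> lattice_measures L B. \<forall>g\<in>carrier G. \<forall>x\<in>carrier L. \<nu> (act g x) = \<nu> x}\<rparr>"

end

theory Submission
  imports Defs
begin

text \<open>A measure \<open>\<nu>\<close> satisfies \<open>\<nu> (z \<and> (x \<or> y)) = \<nu> (z \<and> x) + \<nu> (z \<and> y) - \<nu> (z \<and> x \<and> y)\<close>, even when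
  the lattice is not distributive: compare inclusion-exclusion for \<open>x, y, z\<close> with inclusion-exclusion
  for \<open>x \<or> y, z\<close>. This is exactly what makes the functional \<open>x\<^sub>1 \<cdots> x\<^sub>n \<mapsto> \<nu> (x\<^sub>1 \<and> \<cdots> \<and> x\<^sub>n)\<close> on the
  polynomial ring vanish on the ideal generated by the lattice relations. Conversely, the lattice ring
  is spanned over \<open>A\<close> by the classes of lattice elements, and these satisfy inclusion-exclusion.

  On the geometric side, a section of the sheaf associated to \<open>M\<close> over a basic open set \<open>D f\<close> is a
  single fraction \<open>m / f\<^sup>n\<close>. Hence \<open>\<Gamma>(\<X>, \<O>\<^sub>\<X>)\<close> is the lattice ring, and a morphism of sheaves of
  modules from \<open>f\<^sub>*\<O>\<^sub>\<X>\<close> to the sheaf associated to \<open>B\<close> is determined by its effect \<open>\<theta>\<close> on global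
  sections: it must send \<open>t / s\<close> to \<open>\<theta> t / s\<close>, and this rule is well defined.\<close>

section \<open>Linear maps\<close>

text \<open>Every isomorphism is first written in the direction that leaves a Hom module, where an
  explicit formula exists: restriction to the classes of lattice elements, the induced morphism of
  sheaves, and precomposition with \<open>global_frac\<close>. The directions required at the end
  come from composing and inverting linear bijections. For this only the source has to be closed
  under its operations, so neither the measures nor the sheaf morphisms are shown beforehand to form
  a module.

  The Hom sheaf is computed on global sections only. In general the lattice ring is not finitely
  presented over \<open>A\<close>, so localization need not commute with Hom, and the sheaf need not
  be the one associated to the Hom module.

  Stalks consist of classes of pairs and their operations are unions over all representatives. Hence
  each formula for fractions rests on a family that is shown to be constant on a class.\<close>

lemma linear_mapsI:
  assumes "\<phi> \<in> extensional (carrier M)" "\<And>x. x \<in> carrier M \<Longrightarrow> \<phi> x \<in> carrier N"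
    and "\<And>x y. \<lbrakk>x \<in> carrier M; y \<in> carrier M\<rbrakk> \<Longrightarrow> \<phi> (x \<oplus>\<^bsub>M\<^esub> y) = \<phi> x \<oplus>\<^bsub>N\<^esub> \<phi> y"
    and "\<And>a x. \<lbrakk>a \<in> carrier R; x \<in> carrier M\<rbrakk> \<Longrightarrow> \<phi> (a \<odot>\<^bsub>M\<^esub> x) = a \<odot>\<^bsub>N\<^esub> \<phi> x"
  shows "\<phi> \<in> linear_maps R M N"
  using assms unfolding linear_maps_def by (auto simp: PiE_def)

lemma linear_mapsD:
  assumes "\<phi> \<in> linear_maps R M N"
  shows "\<phi> \<in> extensional (carrier M)" "\<And>x. x \<in> carrier M \<Longrightarrow> \<phi> x \<in> carrier N"
    "\<And>x y. \<lbrakk>x \<in> carrier M; y \<in> carrier M\<rbrakk> \<Longrightarrow> \<phi> (x \<oplus>\<^bsub>M\<^esub> y) = \<phi> x \<oplus>\<^bsub>N\<^esub> \<phi> y"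
    "\<And>a x. \<lbrakk>a \<in> carrier R; x \<in> carrier M\<rbrakk> \<Longrightarrow> \<phi> (a \<odot>\<^bsub>M\<^esub> x) = a \<odot>\<^bsub>N\<^esub> \<phi> x"
  using assms unfolding linear_maps_def by (auto simp: PiE_def)

lemma Hom_module_simps [simp]:
  "carrier (Hom_module R M N) = linear_maps R M N"
  "\<phi> \<oplus>\<^bsub>Hom_module R M N\<^esub> \<psi> = (\<lambda>x\<in>carrier M. \<phi> x \<oplus>\<^bsub>N\<^esub> \<psi> x)"
  "a \<odot>\<^bsub>Hom_module R M N\<^esub> \<phi> = (\<lambda>x\<in>carrier M. a \<odot>\<^bsub>N\<^esub> \<phi> x)"
  by (simp_all add: Hom_module_def plain_module_def)

text \<open>This is the part of the module axioms that inverting and composing linear bijections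
  requires: a sum or multiple that left the carrier would be sent to \<open>undefined\<close> by an
  extensional map.\<close>

definition closed_operations :: "('r, 'c) ring_scheme \<Rightarrow> ('r, 'm, 'd) module_scheme \<Rightarrow> bool"
  where "closed_operations R M \<longleftrightarrow>
    (\<forall>x\<in>carrier M. \<forall>y\<in>carrier M. x \<oplus>\<^bsub>M\<^esub> y \<in> carrier M) \<and>
    (\<forall>a\<in>carrier R. \<forall>x\<in>carrier M. a \<odot>\<^bsub>M\<^esub> x \<in> carrier M)"

text \<open>Commutativity of the scalars makes a pointwise multiple of a linear map linear
  again.\<close>

lemma closed_operations_Hom_module:
  assumes M: "closed_operations R M" and N: "module R N"
  shows "closed_operations R (Hom_module R M N)"
proof -
  interpret N: module R N by fact
  have M1: "\<And>x y. \<lbrakk>x \<in> carrier M; y \<in> carrier M\<rbrakk> \<Longrightarrow> x \<oplus>\<^bsub>M\<^esub> y \<in> carrier M"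
    and M2: "\<And>a x. \<lbrakk>a \<in> carrier R; x \<in> carrier M\<rbrakk> \<Longrightarrow> a \<odot>\<^bsub>M\<^esub> x \<in> carrier M"
    using M unfolding closed_operations_def by auto
  have "(\<lambda>x\<in>carrier M. \<phi> x \<oplus>\<^bsub>N\<^esub> \<psi> x) \<in> linear_maps R M N"
    if "\<phi> \<in> linear_maps R M N" "\<psi> \<in> linear_maps R M N" for \<phi> \<psi>
    using linear_mapsD[OF that(1)] linear_mapsD[OF that(2)] M1 M2
    by (intro linear_mapsI) (auto simp: N.M.a_ac N.smult_r_distr)
  moreover have "(\<lambda>x\<in>carrier M. a \<odot>\<^bsub>N\<^esub> \<phi> x) \<in> linear_maps R M N"
    if "\<phi> \<in> linear_maps R M N" "a \<in> carrier R" for \<phi> a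
    using linear_mapsD[OF that(1)] that(2) M1 M2
    by (intro linear_mapsI) (auto simp: N.smult_r_distr N.smult_assoc1[symmetric] N.m_comm)
  ultimately show ?thesis unfolding closed_operations_def by simp
qed

text \<open>The sum of two preimages is a preimage of the sum. Closure of \<open>M\<close> puts it
  into the carrier, where injectivity identifies it with the chosen preimage.\<close>

lemma module_iso_inverse:
  assumes \<phi>: "\<phi> \<in> module_iso R M N" and M: "closed_operations R M"
  shows "(\<lambda>y\<in>carrier N. inv_into (carrier M) \<phi> y) \<in> module_iso R N M"
proof -
  let ?\<psi> = "\<lambda>y\<in>carrier N. inv_into (carrier M) \<phi> y"
  have lin: "\<phi> \<in> linear_maps R M N" and bij: "bij_betw \<phi> (carrier M) (carrier N)"
    using \<phi> unfolding module_iso_def by auto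
  note D = linear_mapsD[OF lin]
  have inv: "inv_into (carrier M) \<phi> y \<in> carrier M" "\<phi> (inv_into (carrier M) \<phi> y) = y" if "y \<in> carrier N" for y
    using that bij by (auto simp: bij_betw_def inv_into_into f_inv_into_f)
  have inv2: "inv_into (carrier M) \<phi> (\<phi> x) = x" if "x \<in> carrier M" for x
    using that bij by (simp add: bij_betw_def)
  have M1: "\<And>x y. \<lbrakk>x \<in> carrier M; y \<in> carrier M\<rbrakk> \<Longrightarrow> x \<oplus>\<^bsub>M\<^esub> y \<in> carrier M"
    and M2: "\<And>a x. \<lbrakk>a \<in> carrier R; x \<in> carrier M\<rbrakk> \<Longrightarrow> a \<odot>\<^bsub>M\<^esub> x \<in> carrier M"
    using M unfolding closed_operations_def by auto
  have "?\<psi> \<in> linear_maps R N M"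
  proof (rule linear_mapsI)
    fix y z assume yz: "y \<in> carrier N" "z \<in> carrier N"
    let ?y = "inv_into (carrier M) \<phi> y" and ?z = "inv_into (carrier M) \<phi> z"
    have "\<phi> (?y \<oplus>\<^bsub>M\<^esub> ?z) = y \<oplus>\<^bsub>N\<^esub> z" using D(3) inv yz by simp
    then show "?\<psi> (y \<oplus>\<^bsub>N\<^esub> z) = ?\<psi> y \<oplus>\<^bsub>M\<^esub> ?\<psi> z"
      using inv2[of "?y \<oplus>\<^bsub>M\<^esub> ?z"] M1 inv yz D(2)[of "?y \<oplus>\<^bsub>M\<^esub> ?z"] by auto
  next
    fix a y assume ay: "a \<in> carrier R" "y \<in> carrier N"
    let ?y = "inv_into (carrier M) \<phi> y"
    have "\<phi> (a \<odot>\<^bsub>M\<^esub> ?y) = a \<odot>\<^bsub>N\<^esub> y" using D(4) inv ay by simp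
    then show "?\<psi> (a \<odot>\<^bsub>N\<^esub> y) = a \<odot>\<^bsub>M\<^esub> ?\<psi> y"
      using inv2[of "a \<odot>\<^bsub>M\<^esub> ?y"] M2 inv ay D(2)[of "a \<odot>\<^bsub>M\<^esub> ?y"] by auto
  qed (use inv in auto)
  moreover have "bij_betw ?\<psi> (carrier N) (carrier M)"
    using bij_betw_inv_into[OF bij] by (simp add: bij_betw_def inj_on_def)
  ultimately show ?thesis unfolding module_iso_def by simp
qed

lemma module_iso_compose:
  assumes \<phi>: "\<phi> \<in> module_iso R M N" and \<psi>: "\<psi> \<in> module_iso R N K" and M: "closed_operations R M"
  shows "compose (carrier M) \<psi> \<phi> \<in> module_iso R M K"
proof -
  have lin: "\<phi> \<in> linear_maps R M N" "\<psi> \<in> linear_maps R N K"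
    and bij: "bij_betw \<phi> (carrier M) (carrier N)" "bij_betw \<psi> (carrier N) (carrier K)"
    using \<phi> \<psi> unfolding module_iso_def by auto
  note D = linear_mapsD[OF lin(1)] and E = linear_mapsD[OF lin(2)]
  have "compose (carrier M) \<psi> \<phi> \<in> linear_maps R M K"
    using D E M by (intro linear_mapsI) (auto simp: compose_def closed_operations_def)
  moreover have "bij_betw (compose (carrier M) \<psi> \<phi>) (carrier M) (carrier K)"
    using bij_betw_compose[OF bij] .
  ultimately show ?thesis unfolding module_iso_def by simp
qed

text \<open>Invariant submodules are the full records with a smaller carrier, so an isomorphism of
  the full modules that matches the invariant elements restricts in this form.\<close>

lemma module_iso_restrict_carrier:
  assumes \<phi>: "\<phi> \<in> module_iso R M N" and C: "C \<subseteq> carrier M" and img: "\<phi> ` C = D"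
    and cl: "closed_operations R (M\<lparr>carrier := C\<rparr>)"
  shows "restrict \<phi> C \<in> module_iso R (M\<lparr>carrier := C\<rparr>) (N\<lparr>carrier := D\<rparr>)"
proof -
  have lin: "\<phi> \<in> linear_maps R M N" and bij: "bij_betw \<phi> (carrier M) (carrier N)"
    using \<phi> unfolding module_iso_def by auto
  note L = linear_mapsD[OF lin]
  have "restrict \<phi> C \<in> linear_maps R (M\<lparr>carrier := C\<rparr>) (N\<lparr>carrier := D\<rparr>)"
    using L C img cl by (intro linear_mapsI) (auto simp: closed_operations_def subset_iff)
  moreover have "bij_betw (restrict \<phi> C) C D"
    using bij_betw_subset[OF bij C img] by (simp add: bij_betw_def inj_on_def)
  ultimately show ?thesis unfolding module_iso_def by simp
qed

section \<open>Localization and sections over basic open sets\<close>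

definition basic_open :: "('a, 'c) ring_scheme \<Rightarrow> 'a \<Rightarrow> 'a set set"
  where "basic_open R f = {P \<in> Spec R. f \<notin> P}"

lemma basic_open_subset_Spec: "basic_open R f \<subseteq> Spec R"
  unfolding basic_open_def by auto

lemma openin_basic_open:
  assumes "f \<in> carrier R"
  shows "openin (zariski R) (basic_open R f)"
  unfolding openin_zariski
  by (rule exI[of _ "{f}"]) (use assms in \<open>auto simp: basic_open_def vanishing_set_def\<close>)

lemma openin_Spec: "openin (zariski R) (Spec R)" if "cring R"
proof -
  interpret cring R by fact
  have "Spec R = basic_open R \<one>\<^bsub>R\<^esub>"
    unfolding basic_open_def Spec_def
    using ideal.one_imp_carrier primeideal.I_notcarr primeideal_def by blast
  then show ?thesis using openin_basic_open[of "\<one>\<^bsub>R\<^esub>" R] by simp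
qed

lemma openin_zariski_subset: "openin (zariski R) U \<Longrightarrow> U \<subseteq> Spec R"
  unfolding openin_zariski by auto

lemma openin_zariski_basic_openE:
  assumes "openin (zariski R) U" "P \<in> U"
  obtains f where "f \<in> carrier R" "P \<in> basic_open R f" "basic_open R f \<subseteq> U"
proof -
  obtain S where S: "S \<subseteq> carrier R" "U = Spec R - vanishing_set R S"
    using assms(1) unfolding openin_zariski by blast
  then obtain f where "f \<in> S" "f \<notin> P"
    using assms(2) unfolding vanishing_set_def by blast
  with S assms(2) show thesis
    by (intro that[of f]) (auto simp: basic_open_def vanishing_set_def)
qed

lemma in_basic_open_imp_prime: "P \<in> basic_open R f \<Longrightarrow> primeideal P R \<and> f \<notin> P"
  unfolding basic_open_def Spec_def by simp

lemma primeideal_one_notin: "primeideal P R \<Longrightarrow> \<one>\<^bsub>R\<^esub> \<notin> P"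
  by (metis ideal.one_imp_carrier primeideal.I_notcarr primeideal_def)

lemma primeideal_mult_notin:
  assumes "primeideal P R" "s \<in> carrier R - P" "t \<in> carrier R - P"
  shows "s \<otimes>\<^bsub>R\<^esub> t \<in> carrier R - P"
proof -
  interpret primeideal P R by fact
  show ?thesis using assms(2,3) I_prime by blast
qed

section \<open>Ideals and primes that avoid the powers of an element\<close>

context cring
begin

lemma basic_open_one: "basic_open R \<one> = Spec R"
  unfolding basic_open_def Spec_def using primeideal_one_notin by auto

lemma basic_open_mult:
  assumes "s \<in> carrier R" "t \<in> carrier R"
  shows "basic_open R (s \<otimes> t) = basic_open R s \<inter> basic_open R t"
proof -
  have "s \<otimes> t \<in> P \<longleftrightarrow> s \<in> P \<or> t \<in> P" if "primeideal P R" for P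
  proof -
    interpret primeideal P R by fact
    show ?thesis using assms I_prime I_l_closed I_r_closed by blast
  qed
  then show ?thesis unfolding basic_open_def Spec_def by auto
qed

lemma basic_open_pow:
  assumes "f \<in> carrier R" "n > 0"
  shows "basic_open R (f [^] (n::nat)) = basic_open R f"
  using assms(2)
proof (induction n rule: nat_induct_non_zero)
  case (Suc n)
  then show ?case using assms(1) by (simp add: basic_open_mult)
qed (use assms in simp)

lemma primeideal_pow_notin:
  assumes "primeideal P R" "f \<in> carrier R - P"
  shows "f [^] (n::nat) \<in> carrier R - P"
proof (induction n)
  case 0
  then show ?case using primeideal_one_notin[OF assms(1)] by simp
next
  case (Suc n)
  then show ?case using primeideal_mult_notin[OF assms(1) Suc assms(2)] by simp
qed

text \<open>Negation is multiplication by -1, and the condition for multiplication from the right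
  follows from commutativity.\<close>

lemma idealI_cring:
  assumes "I \<subseteq> carrier R" "\<zero> \<in> I"
    and "\<And>a b. a \<in> I \<Longrightarrow> b \<in> I \<Longrightarrow> a \<oplus> b \<in> I"
    and "\<And>a r. a \<in> I \<Longrightarrow> r \<in> carrier R \<Longrightarrow> r \<otimes> a \<in> I"
  shows "ideal I R"
proof (rule idealI)
  show "subgroup I (add_monoid R)"
  proof (rule add.subgroupI)
    show "\<ominus> a \<in> I" if "a \<in> I" for a
    proof -
      have "\<ominus> \<one> \<otimes> a \<in> I" using assms(4) that by simp
      moreover have "\<ominus> \<one> \<otimes> a = \<ominus> a" using that assms(1) by (simp add: l_minus subset_iff)
      ultimately show ?thesis by simp
    qed
  qed (use assms in auto)
  show "a \<otimes> r \<in> I" if "a \<in> I" "r \<in> carrier R" for a r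
    using assms(1,4) that m_comm by (metis subset_iff)
qed (use assms ring_axioms in auto)

text \<open>An ideal maximal among those avoiding the powers of \<open>f\<close> is prime.\<close>

lemma prime_avoiding_powers:
  assumes I: "ideal I R" and f: "f \<in> carrier R" and avoid: "\<And>n::nat. f [^] n \<notin> I"
  obtains P where "P \<in> basic_open R f" "I \<subseteq> P"
proof -
  define F where "F = {J. ideal J R \<and> I \<subseteq> J \<and> (\<forall>n::nat. f [^] n \<notin> J)}"
  have "\<exists>M\<in>F. \<forall>J\<in>F. M \<subseteq> J \<longrightarrow> J = M"
  proof (rule subset_Zorn)
    fix C assume C: "subset.chain F C"
    show "\<exists>U\<in>F. \<forall>J\<in>C. J \<subseteq> U"
    proof (cases "C = {}")
      case True
      have "I \<in> F" using I avoid unfolding F_def by simp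
      then show ?thesis using True by auto
    next
      case False
      have CF: "C \<subseteq> F" using C unfolding pred_on.chain_def by auto
      have "subset.chain {I. ideal I R} C"
        using C unfolding pred_on.chain_def F_def by auto
      then have "ideal (\<Union>C) R" using chain_Union_is_ideal[of C] False by simp
      moreover have "I \<subseteq> \<Union>C" using False CF unfolding F_def by blast
      moreover have "\<forall>n::nat. f [^] n \<notin> \<Union>C" using CF unfolding F_def by blast
      ultimately have "\<Union>C \<in> F" unfolding F_def by simp
      then show ?thesis by blast
    qed
  qed
  then obtain M where M: "ideal M R" "I \<subseteq> M" "\<And>n::nat. f [^] n \<notin> M"
    and max: "\<And>J. J \<in> F \<Longrightarrow> M \<subseteq> J \<Longrightarrow> J = M"
    unfolding F_def by auto
  interpret M: ideal M R by fact
  \<comment> \<open>If \<open>a\<close> lies outside \<open>M\<close>, the ideal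
    \<open>M + (a)\<close> is strictly larger than \<open>M\<close>, so by maximality it contains a
    power of \<open>f\<close>.\<close>
  have ext: "\<exists>n::nat. \<exists>m\<in>M. \<exists>r\<in>carrier R. f [^] n = m \<oplus> r \<otimes> a" if a: "a \<in> carrier R" "a \<notin> M" for a
  proof (rule ccontr)
    assume neg: "\<not> ?thesis"
    define J where "J = {m \<oplus> r \<otimes> a | m r. m \<in> M \<and> r \<in> carrier R}"
    have "ideal J R"
    proof (rule idealI_cring)
      show "J \<subseteq> carrier R" unfolding J_def using M.Icarr a by auto
      show "\<zero> \<in> J" unfolding J_def
        by (rule CollectI, rule exI[of _ \<zero>], rule exI[of _ \<zero>]) (use a M.zero_closed in simp)
      show "x \<oplus> y \<in> J" if xy: "x \<in> J" "y \<in> J" for x y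
      proof -
        obtain m r m' r' where *: "x = m \<oplus> r \<otimes> a" "y = m' \<oplus> r' \<otimes> a" "m \<in> M" "m' \<in> M"
          "r \<in> carrier R" "r' \<in> carrier R" using xy unfolding J_def by blast
        then have "x \<oplus> y = (m \<oplus> m') \<oplus> (r \<oplus> r') \<otimes> a"
          using a M.Icarr by algebra
        then show ?thesis unfolding J_def using * M.a_closed by blast
      qed
      show "s \<otimes> x \<in> J" if xs: "x \<in> J" "s \<in> carrier R" for x s
      proof -
        obtain m r where *: "x = m \<oplus> r \<otimes> a" "m \<in> M" "r \<in> carrier R"
          using xs unfolding J_def by blast
        then have "s \<otimes> x = s \<otimes> m \<oplus> (s \<otimes> r) \<otimes> a"
          using a M.Icarr xs by algebra
        then show ?thesis unfolding J_def using * xs M.I_l_closed by blast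
      qed
    qed
    moreover have MJ: "M \<subseteq> J"
    proof
      fix m assume "m \<in> M"
      then show "m \<in> J" unfolding J_def
        by (intro CollectI exI[of _ m] exI[of _ \<zero>]) (use a M.Icarr in simp)
    qed
    moreover have "\<forall>n::nat. f [^] n \<notin> J" using neg unfolding J_def by blast
    ultimately have "J = M" using max[of J] M(2) unfolding F_def by blast
    moreover have "a \<in> J" unfolding J_def
      by (intro CollectI exI[of _ \<zero>] exI[of _ \<one>]) (use a M.zero_closed in simp)
    ultimately show False using a by simp
  qed
  have "primeideal M R"
  proof (rule primeidealI[OF M(1) is_cring])
    \<comment> \<open>The zeroth power of \<open>f\<close> is \<open>\<one>\<close>, so avoiding all
      powers makes \<open>M\<close> proper.\<close>
    show "carrier R \<noteq> M" using M(3)[of 0] by auto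
    fix a b assume ab: "a \<in> carrier R" "b \<in> carrier R" "a \<otimes> b \<in> M"
    show "a \<in> M \<or> b \<in> M"
    proof (rule ccontr)
      assume "\<not> ?thesis"
      then obtain n k :: nat and m m' r r' where *: "f [^] n = m \<oplus> r \<otimes> a" "f [^] k = m' \<oplus> r' \<otimes> b"
        "m \<in> M" "m' \<in> M" "r \<in> carrier R" "r' \<in> carrier R"
        using ext[OF ab(1)] ext[OF ab(2)] by blast
      \<comment> \<open>After expansion each summand is a multiple of \<open>m\<close>, of
        \<open>m'\<close> or of \<open>a \<otimes> b\<close>, so a power of \<open>f\<close> would
        lie in \<open>M\<close>.\<close>
      have "f [^] (n + k) = (m \<oplus> r \<otimes> a) \<otimes> (m' \<oplus> r' \<otimes> b)"
        using f * by (simp flip: nat_pow_mult)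
      also have "\<dots> = (m' \<oplus> r' \<otimes> b) \<otimes> m \<oplus> (r \<otimes> a) \<otimes> m' \<oplus> (r \<otimes> r') \<otimes> (a \<otimes> b)"
        using * ab M.Icarr by algebra
      also have "\<dots> \<in> M"
        using * ab M.Icarr by (intro M.a_closed M.I_l_closed ab(3)) auto
      finally show False using M(3) by blast
    qed
  qed
  moreover have "f \<notin> M" using M(3)[of 1] f by simp
  ultimately show thesis using that M(2) unfolding basic_open_def Spec_def by blast
qed

text \<open>The algebraic form of quasi-compactness of D(f). To obtain a statement globally up to a
  power of f, collect the ring elements for which it holds into an ideal and check that no prime of
  D(f) contains that ideal.\<close>

lemma power_in_ideal:
  assumes "ideal I R" "f \<in> carrier R" "\<And>P. P \<in> basic_open R f \<Longrightarrow> \<not> I \<subseteq> P"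
  shows "\<exists>n::nat. f [^] n \<in> I"
proof (rule ccontr)
  assume "\<not> ?thesis"
  then obtain P where "P \<in> basic_open R f" "I \<subseteq> P"
    using prime_avoiding_powers[OF assms(1,2)] by blast
  then show False using assms(3) by blast
qed

end

section \<open>Equality and arithmetic of fractions in a stalk\<close>

context module
begin

text \<open>Transitivity of the relation behind fractions: two cross-multiplied equations that share
  the pair \<open>(m, s)\<close> combine with the product of both witnesses and \<open>s\<close>,
  which again avoids the prime.\<close>

lemma loc_frac_eqI:
  assumes P: "primeideal P R" and m: "m \<in> carrier M" "m' \<in> carrier M"
    and s: "s \<in> carrier R - P" "s' \<in> carrier R - P"
    and u: "u \<in> carrier R - P" "u \<odot>\<^bsub>M\<^esub> (s' \<odot>\<^bsub>M\<^esub> m) = u \<odot>\<^bsub>M\<^esub> (s \<odot>\<^bsub>M\<^esub> m')"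
  shows "loc_frac R M P m s = loc_frac R M P m' s'"
proof -
  have sub: "loc_frac R M P m s \<subseteq> loc_frac R M P m' s'"
    if m: "m \<in> carrier M" "m' \<in> carrier M" and s: "s \<in> carrier R - P" "s' \<in> carrier R - P"
    and u: "u \<in> carrier R - P" "u \<odot>\<^bsub>M\<^esub> (s' \<odot>\<^bsub>M\<^esub> m) = u \<odot>\<^bsub>M\<^esub> (s \<odot>\<^bsub>M\<^esub> m')" for m m' s s' u
  proof
    fix x assume "x \<in> loc_frac R M P m s"
    then obtain n t v where x: "x = (n, t)" and n: "n \<in> carrier M" and t: "t \<in> carrier R" "t \<notin> P"
      and v: "v \<in> carrier R - P" and E: "v \<odot>\<^bsub>M\<^esub> (t \<odot>\<^bsub>M\<^esub> m) = v \<odot>\<^bsub>M\<^esub> (s \<odot>\<^bsub>M\<^esub> n)"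
      unfolding loc_frac_def by auto
    have c: "u \<in> carrier R" "v \<in> carrier R" "s \<in> carrier R" "s' \<in> carrier R" using u v s by auto
    have "(u \<otimes> v \<otimes> s) \<odot>\<^bsub>M\<^esub> (t \<odot>\<^bsub>M\<^esub> m') = (v \<otimes> t) \<odot>\<^bsub>M\<^esub> (u \<odot>\<^bsub>M\<^esub> (s \<odot>\<^bsub>M\<^esub> m'))"
      using c t m by (simp add: smult_assoc1[symmetric] m_ac)
    also have "\<dots> = (v \<otimes> t) \<odot>\<^bsub>M\<^esub> (u \<odot>\<^bsub>M\<^esub> (s' \<odot>\<^bsub>M\<^esub> m))" using u by simp
    also have "\<dots> = (u \<otimes> s') \<odot>\<^bsub>M\<^esub> (v \<odot>\<^bsub>M\<^esub> (t \<odot>\<^bsub>M\<^esub> m))"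
      using c t m by (simp add: smult_assoc1[symmetric] m_ac)
    also have "\<dots> = (u \<otimes> s') \<odot>\<^bsub>M\<^esub> (v \<odot>\<^bsub>M\<^esub> (s \<odot>\<^bsub>M\<^esub> n))" using E by simp
    also have "\<dots> = (u \<otimes> v \<otimes> s) \<odot>\<^bsub>M\<^esub> (s' \<odot>\<^bsub>M\<^esub> n)"
      using c n by (simp add: smult_assoc1[symmetric] m_ac)
    finally show "x \<in> loc_frac R M P m' s'"
      using primeideal_mult_notin[OF P primeideal_mult_notin[OF P u(1) v] s(1)] n t x
      unfolding loc_frac_def by blast
  qed
  show ?thesis using sub[OF m s u] sub[OF m(2,1) s(2,1) u(1) u(2)[symmetric]] by blast
qed

lemma loc_frac_self:
  assumes "primeideal P R" "m \<in> carrier M" "s \<in> carrier R - P"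
  shows "(m, s) \<in> loc_frac R M P m s"
  using assms(2,3) unfolding loc_frac_def by auto

lemma loc_frac_eqD:
  assumes "primeideal P R" "m' \<in> carrier M" "s' \<in> carrier R - P"
    and "loc_frac R M P m s = loc_frac R M P m' s'"
  shows "\<exists>u\<in>carrier R - P. u \<odot>\<^bsub>M\<^esub> (s' \<odot>\<^bsub>M\<^esub> m) = u \<odot>\<^bsub>M\<^esub> (s \<odot>\<^bsub>M\<^esub> m')"
proof -
  have "(m', s') \<in> loc_frac R M P m s" using loc_frac_self[OF assms(1-3)] assms(4) by simp
  then show ?thesis unfolding loc_frac_def by simp
qed

lemma loc_frac_memD:
  assumes "primeideal P R" "m \<in> carrier M" "s \<in> carrier R - P" "(m', s') \<in> loc_frac R M P m s"
  shows "m' \<in> carrier M" "s' \<in> carrier R - P" "loc_frac R M P m' s' = loc_frac R M P m s"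
proof -
  show *: "m' \<in> carrier M" "s' \<in> carrier R - P" using assms(4) unfolding loc_frac_def by auto
  show "loc_frac R M P m' s' = loc_frac R M P m s"
  proof -
    obtain u where "u \<in> carrier R - P" "u \<odot>\<^bsub>M\<^esub> (s' \<odot>\<^bsub>M\<^esub> m) = u \<odot>\<^bsub>M\<^esub> (s \<odot>\<^bsub>M\<^esub> m')"
      using assms(4) unfolding loc_frac_def by auto
    then show ?thesis using loc_frac_eqI[OF assms(1,2) *(1) assms(3) *(2)] by metis
  qed
qed

lemma loc_frac_cancel:
  assumes "primeideal P R" "m \<in> carrier M" "s \<in> carrier R - P" "t \<in> carrier R - P"
  shows "loc_frac R M P (t \<odot>\<^bsub>M\<^esub> m) (t \<otimes> s) = loc_frac R M P m s"
  using assms primeideal_mult_notin[OF assms(1,4,3)]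
  by (intro loc_frac_eqI[where u = t]) (auto simp: smult_assoc1[symmetric] m_ac)

text \<open>The tool for evaluating stalk operations. A union over representatives collapses to its
  value at a chosen representative once the value is independent of the choice; the class is
  nonempty because it contains that representative.\<close>

lemma UNION_loc_frac_const:
  assumes P: "primeideal P R" "m \<in> carrier M" "s \<in> carrier R - P"
    and eq: "\<And>m' s'. \<lbrakk>m' \<in> carrier M; s' \<in> carrier R - P; loc_frac R M P m' s' = loc_frac R M P m s\<rbrakk>
      \<Longrightarrow> F m' s' = F m s"
  shows "(\<Union>(m', s')\<in>loc_frac R M P m s. F m' s') = F m s"
proof -
  have "F m' s' = F m s" if "(m', s') \<in> loc_frac R M P m s" for m' s'
    using eq loc_frac_memD[OF P that] by blast
  then have "(\<Union>(m', s')\<in>loc_frac R M P m s. F m' s') = (\<Union>x\<in>loc_frac R M P m s. F m s)"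
    by (intro SUP_cong) auto
  then show ?thesis using loc_frac_self[OF P] by auto
qed

text \<open>Independence of the representative of the first summand. \<open>loc_module_add\<close>
  obtains the second summand from this by commutativity.\<close>

lemma loc_frac_add_cong:
  assumes P: "primeideal P R" and m: "m \<in> carrier M" "m' \<in> carrier M" "n \<in> carrier M"
    and s: "s \<in> carrier R - P" "s' \<in> carrier R - P" "t \<in> carrier R - P"
    and eq: "loc_frac R M P m s = loc_frac R M P m' s'"
  shows "loc_frac R M P (t \<odot>\<^bsub>M\<^esub> m \<oplus>\<^bsub>M\<^esub> s \<odot>\<^bsub>M\<^esub> n) (s \<otimes> t) = loc_frac R M P (t \<odot>\<^bsub>M\<^esub> m' \<oplus>\<^bsub>M\<^esub> s' \<odot>\<^bsub>M\<^esub> n) (s' \<otimes> t)"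
proof -
  obtain u where u: "u \<in> carrier R - P" "u \<odot>\<^bsub>M\<^esub> (s' \<odot>\<^bsub>M\<^esub> m) = u \<odot>\<^bsub>M\<^esub> (s \<odot>\<^bsub>M\<^esub> m')"
    using loc_frac_eqD[OF P m(2) s(2) eq] by blast
  have c: "u \<in> carrier R" "s \<in> carrier R" "s' \<in> carrier R" "t \<in> carrier R" using u s by auto
  have "u \<odot>\<^bsub>M\<^esub> ((s' \<otimes> t) \<odot>\<^bsub>M\<^esub> (t \<odot>\<^bsub>M\<^esub> m \<oplus>\<^bsub>M\<^esub> s \<odot>\<^bsub>M\<^esub> n))
      = (t \<otimes> t) \<odot>\<^bsub>M\<^esub> (u \<odot>\<^bsub>M\<^esub> (s' \<odot>\<^bsub>M\<^esub> m)) \<oplus>\<^bsub>M\<^esub> (u \<otimes> s' \<otimes> t \<otimes> s) \<odot>\<^bsub>M\<^esub> n"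
    using c m by (simp add: smult_assoc1[symmetric] m_ac smult_r_distr)
  also have "\<dots> = (t \<otimes> t) \<odot>\<^bsub>M\<^esub> (u \<odot>\<^bsub>M\<^esub> (s \<odot>\<^bsub>M\<^esub> m')) \<oplus>\<^bsub>M\<^esub> (u \<otimes> s' \<otimes> t \<otimes> s) \<odot>\<^bsub>M\<^esub> n"
    using u by simp
  also have "\<dots> = u \<odot>\<^bsub>M\<^esub> ((s \<otimes> t) \<odot>\<^bsub>M\<^esub> (t \<odot>\<^bsub>M\<^esub> m' \<oplus>\<^bsub>M\<^esub> s' \<odot>\<^bsub>M\<^esub> n))"
    using c m by (simp add: smult_assoc1[symmetric] m_ac smult_r_distr)
  finally show ?thesis
    using c m s u primeideal_mult_notin[OF P] by (intro loc_frac_eqI[OF P, where u = u]) auto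
qed

lemma loc_module_add:
  assumes P: "primeideal P R" and m: "m \<in> carrier M" "n \<in> carrier M"
    and s: "s \<in> carrier R - P" "t \<in> carrier R - P"
  shows "loc_frac R M P m s \<oplus>\<^bsub>loc_module R M P\<^esub> loc_frac R M P n t
    = loc_frac R M P (t \<odot>\<^bsub>M\<^esub> m \<oplus>\<^bsub>M\<^esub> s \<odot>\<^bsub>M\<^esub> n) (s \<otimes> t)"
proof -
  have *: "(\<Union>(n', t')\<in>loc_frac R M P n t. loc_frac R M P (t' \<odot>\<^bsub>M\<^esub> m' \<oplus>\<^bsub>M\<^esub> s' \<odot>\<^bsub>M\<^esub> n') (s' \<otimes> t'))
     = loc_frac R M P (t \<odot>\<^bsub>M\<^esub> m' \<oplus>\<^bsub>M\<^esub> s' \<odot>\<^bsub>M\<^esub> n) (s' \<otimes> t)"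
    if "m' \<in> carrier M" "s' \<in> carrier R - P" for m' s'
  proof (rule UNION_loc_frac_const[OF P m(2) s(2)])
    fix n' t' assume n': "n' \<in> carrier M" "t' \<in> carrier R - P" "loc_frac R M P n' t' = loc_frac R M P n t"
    have "loc_frac R M P (s' \<odot>\<^bsub>M\<^esub> n' \<oplus>\<^bsub>M\<^esub> t' \<odot>\<^bsub>M\<^esub> m') (t' \<otimes> s') = loc_frac R M P (s' \<odot>\<^bsub>M\<^esub> n \<oplus>\<^bsub>M\<^esub> t \<odot>\<^bsub>M\<^esub> m') (t \<otimes> s')"
      using loc_frac_add_cong[OF P n'(1) m(2) that(1) n'(2) s(2) that(2) n'(3)] .
    then show "loc_frac R M P (t' \<odot>\<^bsub>M\<^esub> m' \<oplus>\<^bsub>M\<^esub> s' \<odot>\<^bsub>M\<^esub> n') (s' \<otimes> t') = loc_frac R M P (t \<odot>\<^bsub>M\<^esub> m' \<oplus>\<^bsub>M\<^esub> s' \<odot>\<^bsub>M\<^esub> n) (s' \<otimes> t)"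
      using that n' m s by (simp add: M.a_comm m_comm)
  qed
  have "(\<Union>(m', s')\<in>loc_frac R M P m s. \<Union>(n', t')\<in>loc_frac R M P n t.
      loc_frac R M P (t' \<odot>\<^bsub>M\<^esub> m' \<oplus>\<^bsub>M\<^esub> s' \<odot>\<^bsub>M\<^esub> n') (s' \<otimes> t'))
     = (\<Union>(n', t')\<in>loc_frac R M P n t. loc_frac R M P (t' \<odot>\<^bsub>M\<^esub> m \<oplus>\<^bsub>M\<^esub> s \<odot>\<^bsub>M\<^esub> n') (s \<otimes> t'))"
  proof (rule UNION_loc_frac_const[OF P m(1) s(1)])
    fix m' s' assume m': "m' \<in> carrier M" "s' \<in> carrier R - P" "loc_frac R M P m' s' = loc_frac R M P m s"
    show "(\<Union>(n', t')\<in>loc_frac R M P n t. loc_frac R M P (t' \<odot>\<^bsub>M\<^esub> m' \<oplus>\<^bsub>M\<^esub> s' \<odot>\<^bsub>M\<^esub> n') (s' \<otimes> t'))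
      = (\<Union>(n', t')\<in>loc_frac R M P n t. loc_frac R M P (t' \<odot>\<^bsub>M\<^esub> m \<oplus>\<^bsub>M\<^esub> s \<odot>\<^bsub>M\<^esub> n') (s \<otimes> t'))"
      unfolding *[OF m'(1,2)] *[OF m(1) s(1)]
      using loc_frac_add_cong[OF P m'(1) m m'(2) s m'(3)] .
  qed
  then show ?thesis unfolding *[OF m(1) s(1)] by (simp add: loc_module_def plain_module_def)
qed

end

lemma module_self_module: "module R (self_module R)" if "cring R"
proof -
  interpret cring R by fact
  have ab: "abelian_group (self_module R)"
    by (rule abelian_groupI)
       (auto simp: self_module_def ring_along_def a_ac intro!: bexI[of _ "\<ominus>\<^bsub>R\<^esub> x" for x] l_neg)
  show ?thesis
    by (rule moduleI[OF is_cring ab])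
       (auto simp: self_module_def ring_along_def l_distr r_distr m_assoc)
qed

lemma self_module_simps [simp]:
  "carrier (self_module R) = carrier R"
  "\<zero>\<^bsub>self_module R\<^esub> = \<zero>\<^bsub>R\<^esub>"
  "x \<oplus>\<^bsub>self_module R\<^esub> y = x \<oplus>\<^bsub>R\<^esub> y"
  "a \<odot>\<^bsub>self_module R\<^esub> y = a \<otimes>\<^bsub>R\<^esub> y"
  by (simp_all add: self_module_def ring_along_def)

context module
begin

lemma loc_module_smult:
  assumes P: "primeideal P R" and a: "a \<in> carrier R" "s \<in> carrier R - P"
    and m: "m \<in> carrier M" "t \<in> carrier R - P"
  shows "loc_frac R (self_module R) P a s \<odot>\<^bsub>loc_module R M P\<^esub> loc_frac R M P m t
    = loc_frac R M P (a \<odot>\<^bsub>M\<^esub> m) (s \<otimes> t)"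
proof -
  interpret S: module R "self_module R" by (rule module_self_module[OF is_cring])
  \<comment> \<open>The two factors are varied separately: \<open>cong\<close> changes the
    representative of the module element, \<open>cong2\<close> that of the scalar.\<close>
  have cong: "loc_frac R M P (a' \<odot>\<^bsub>M\<^esub> m') (s' \<otimes> t') = loc_frac R M P (a' \<odot>\<^bsub>M\<^esub> m) (s' \<otimes> t)"
    if a': "a' \<in> carrier R" "s' \<in> carrier R - P" and m': "m' \<in> carrier M" "t' \<in> carrier R - P"
      "loc_frac R M P m' t' = loc_frac R M P m t" for a' s' m' t'
  proof -
    obtain u where u: "u \<in> carrier R - P" "u \<odot>\<^bsub>M\<^esub> (t \<odot>\<^bsub>M\<^esub> m') = u \<odot>\<^bsub>M\<^esub> (t' \<odot>\<^bsub>M\<^esub> m)"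
      using loc_frac_eqD[OF P m m'(3)] by blast
    have c: "u \<in> carrier R" "s' \<in> carrier R" "t \<in> carrier R" "t' \<in> carrier R" using u a' m m' by auto
    have "u \<odot>\<^bsub>M\<^esub> ((s' \<otimes> t) \<odot>\<^bsub>M\<^esub> (a' \<odot>\<^bsub>M\<^esub> m')) = (s' \<otimes> a') \<odot>\<^bsub>M\<^esub> (u \<odot>\<^bsub>M\<^esub> (t \<odot>\<^bsub>M\<^esub> m'))"
      using c a' m m' by (simp add: smult_assoc1[symmetric] m_ac)
    also have "\<dots> = (s' \<otimes> a') \<odot>\<^bsub>M\<^esub> (u \<odot>\<^bsub>M\<^esub> (t' \<odot>\<^bsub>M\<^esub> m))" using u by simp
    also have "\<dots> = u \<odot>\<^bsub>M\<^esub> ((s' \<otimes> t') \<odot>\<^bsub>M\<^esub> (a' \<odot>\<^bsub>M\<^esub> m))"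
      using c a' m m' by (simp add: smult_assoc1[symmetric] m_ac)
    finally show ?thesis using a' m m' u primeideal_mult_notin[OF P]
      by (intro loc_frac_eqI[OF P, where u = u]) auto
  qed
  have cong2: "loc_frac R M P (a' \<odot>\<^bsub>M\<^esub> m) (s' \<otimes> t) = loc_frac R M P (a \<odot>\<^bsub>M\<^esub> m) (s \<otimes> t)"
    if a': "a' \<in> carrier R" "s' \<in> carrier R - P"
      "loc_frac R (self_module R) P a' s' = loc_frac R (self_module R) P a s" for a' s'
  proof -
    obtain u where u: "u \<in> carrier R - P" "u \<otimes> (s \<otimes> a') = u \<otimes> (s' \<otimes> a)"
      using S.loc_frac_eqD[OF P _ a(2) a'(3)] a by auto
    have c: "u \<in> carrier R" "s \<in> carrier R" "s' \<in> carrier R" "t \<in> carrier R" using u a a' m by auto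
    have "u \<odot>\<^bsub>M\<^esub> ((s \<otimes> t) \<odot>\<^bsub>M\<^esub> (a' \<odot>\<^bsub>M\<^esub> m)) = t \<odot>\<^bsub>M\<^esub> ((u \<otimes> (s \<otimes> a')) \<odot>\<^bsub>M\<^esub> m)"
      using c a' m by (simp add: smult_assoc1[symmetric] m_ac)
    also have "\<dots> = t \<odot>\<^bsub>M\<^esub> ((u \<otimes> (s' \<otimes> a)) \<odot>\<^bsub>M\<^esub> m)" using u by simp
    also have "\<dots> = u \<odot>\<^bsub>M\<^esub> ((s' \<otimes> t) \<odot>\<^bsub>M\<^esub> (a \<odot>\<^bsub>M\<^esub> m))"
      using c a m by (simp add: smult_assoc1[symmetric] m_ac)
    finally show ?thesis using a a' m u primeideal_mult_notin[OF P]
      by (intro loc_frac_eqI[OF P, where u = u]) auto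
  qed
  have *: "(\<Union>(m', t')\<in>loc_frac R M P m t. loc_frac R M P (a' \<odot>\<^bsub>M\<^esub> m') (s' \<otimes> t'))
     = loc_frac R M P (a' \<odot>\<^bsub>M\<^esub> m) (s' \<otimes> t)" if "a' \<in> carrier R" "s' \<in> carrier R - P" for a' s'
    by (rule UNION_loc_frac_const[OF P m]) (rule cong[OF that])
  have "(\<Union>(a', s')\<in>loc_frac R (self_module R) P a s. \<Union>(m', t')\<in>loc_frac R M P m t.
      loc_frac R M P (a' \<odot>\<^bsub>M\<^esub> m') (s' \<otimes> t'))
     = (\<Union>(m', t')\<in>loc_frac R M P m t. loc_frac R M P (a \<odot>\<^bsub>M\<^esub> m') (s \<otimes> t'))"
  proof (rule S.UNION_loc_frac_const[OF P])
    fix a' s' assume "a' \<in> carrier (self_module R)" and s': "s' \<in> carrier R - P"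
      and eq: "loc_frac R (self_module R) P a' s' = loc_frac R (self_module R) P a s"
    then have a': "a' \<in> carrier R" by simp
    show "(\<Union>(m', t')\<in>loc_frac R M P m t. loc_frac R M P (a' \<odot>\<^bsub>M\<^esub> m') (s' \<otimes> t'))
      = (\<Union>(m', t')\<in>loc_frac R M P m t. loc_frac R M P (a \<odot>\<^bsub>M\<^esub> m') (s \<otimes> t'))"
      unfolding *[OF a' s'] *[OF a] by (rule cong2[OF a' s' eq])
  qed (use a in auto)
  then show ?thesis unfolding *[OF a] by (simp add: loc_module_def plain_module_def)
qed

end

text \<open>This equation and the next one reduce computations in local rings to the module
  computations above, with the ring regarded as a module over itself.\<close>

lemma loc_ring_add_eq: "x \<oplus>\<^bsub>loc_ring R P\<^esub> y = x \<oplus>\<^bsub>loc_module R (self_module R) P\<^esub> y"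
  by (simp add: loc_ring_def loc_module_def plain_module_def)

lemma loc_ring_mult_eq: "x \<otimes>\<^bsub>loc_ring R P\<^esub> y = x \<odot>\<^bsub>loc_module R (self_module R) P\<^esub> y"
  by (simp add: loc_ring_def loc_module_def plain_module_def)

section \<open>Sections and their local fractions\<close>

context module
begin

lemma loc_module_carrierE:
  assumes "x \<in> carrier (loc_module R M P)"
  obtains m s where "m \<in> carrier M" "s \<in> carrier R - P" "x = loc_frac R M P m s"
  using assms unfolding loc_module_def plain_module_def by auto

lemma loc_frac_in_carrier:
  assumes "m \<in> carrier M" "s \<in> carrier R - P"
  shows "loc_frac R M P m s \<in> carrier (loc_module R M P)"
  using assms unfolding loc_module_def plain_module_def by auto

text \<open>A normal form in which the denominator itself cuts out the set where the fraction is
  valid. The given open set is shrunk to some D(s), and the fraction \<open>n / g\<close> is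
  expanded by \<open>s\<close>; as \<open>g\<close> vanishes nowhere on D(s), the set D(s g) is all
  of D(s).\<close>

lemma assoc_sections_basicE:
  assumes \<xi>: "\<xi> \<in> assoc_sections R M U" and P: "P \<in> U"
  obtains m f where "m \<in> carrier M" "f \<in> carrier R" "P \<in> basic_open R f" "basic_open R f \<subseteq> U"
    "\<forall>Q\<in>basic_open R f. \<xi> Q = loc_frac R M Q m f"
proof -
  have "\<exists>V m f. openin (zariski R) V \<and> P \<in> V \<and> V \<subseteq> U \<and> m \<in> carrier M \<and> f \<in> carrier R \<and>
      (\<forall>Q\<in>V. f \<notin> Q \<and> \<xi> Q = loc_frac R M Q m f)"
    using \<xi> P unfolding assoc_sections_def by simp
  then obtain V n g where V: "openin (zariski R) V" "P \<in> V" "V \<subseteq> U" "n \<in> carrier M" "g \<in> carrier R"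
    "\<And>Q. Q \<in> V \<Longrightarrow> g \<notin> Q" "\<And>Q. Q \<in> V \<Longrightarrow> \<xi> Q = loc_frac R M Q n g"
    by metis
  obtain s where s: "s \<in> carrier R" "P \<in> basic_open R s" "basic_open R s \<subseteq> V"
    using openin_zariski_basic_openE[OF V(1,2)] .
  show thesis
  proof (rule that[of "s \<odot>\<^bsub>M\<^esub> n" "s \<otimes> g"])
    show "P \<in> basic_open R (s \<otimes> g)"
      using s V(2,5,6) openin_zariski_subset[OF V(1)] basic_open_mult[of s g]
      by (auto simp: basic_open_def)
    show "basic_open R (s \<otimes> g) \<subseteq> U" using s V(3,5) basic_open_mult by blast
    show "\<forall>Q\<in>basic_open R (s \<otimes> g). \<xi> Q = loc_frac R M Q (s \<odot>\<^bsub>M\<^esub> n) (s \<otimes> g)"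
    proof
      fix Q assume "Q \<in> basic_open R (s \<otimes> g)"
      then have Q: "Q \<in> basic_open R s" using basic_open_mult s V(5) by blast
      then have QV: "Q \<in> V" using s by blast
      have "loc_frac R M Q (s \<odot>\<^bsub>M\<^esub> n) (s \<otimes> g) = loc_frac R M Q n g"
        using in_basic_open_imp_prime[OF Q] V(4-6) s(1) QV by (intro loc_frac_cancel) auto
      then show "\<xi> Q = loc_frac R M Q (s \<odot>\<^bsub>M\<^esub> n) (s \<otimes> g)" using V(7)[OF QV] by simp
    qed
  qed (use s V in auto)
qed

lemma assoc_sectionsI:
  assumes "\<xi> \<in> extensional U" "\<And>P. P \<in> U \<Longrightarrow> \<exists>m f. m \<in> carrier M \<and> f \<in> carrier R \<and> P \<in> basic_open R f
     \<and> basic_open R f \<subseteq> U \<and> (\<forall>Q\<in>basic_open R f. \<xi> Q = loc_frac R M Q m f)"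
  shows "\<xi> \<in> assoc_sections R M U"
proof -
  have "\<xi> P \<in> carrier (loc_module R M P)" if "P \<in> U" for P
  proof -
    obtain m f where "m \<in> carrier M" "f \<in> carrier R" "P \<in> basic_open R f" "\<xi> P = loc_frac R M P m f"
      using assms(2)[OF \<open>P \<in> U\<close>] by blast
    then show ?thesis using loc_frac_in_carrier in_basic_open_imp_prime by (metis DiffI)
  qed
  moreover have "\<exists>V m f. openin (zariski R) V \<and> P \<in> V \<and> V \<subseteq> U \<and> m \<in> carrier M \<and> f \<in> carrier R \<and>
      (\<forall>Q\<in>V. f \<notin> Q \<and> \<xi> Q = loc_frac R M Q m f)" if "P \<in> U" for P
  proof -
    obtain m f where mf: "m \<in> carrier M" "f \<in> carrier R" "P \<in> basic_open R f" "basic_open R f \<subseteq> U"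
      "\<forall>Q\<in>basic_open R f. \<xi> Q = loc_frac R M Q m f"
      using assms(2)[OF \<open>P \<in> U\<close>] by blast
    show ?thesis
      by (intro exI[of _ "basic_open R f"] exI[of _ m] exI[of _ f] conjI ballI mf openin_basic_open)
         (use mf(5) in \<open>auto simp: basic_open_def\<close>)
  qed
  ultimately show ?thesis using assms(1) unfolding assoc_sections_def by (auto simp: PiE_def)
qed

text \<open>The scalars that equalize the two sides form an ideal, the annihilator of s' m - s m'.
  Equality in the stalk at Q puts an element outside Q into it, so no prime of D(f) contains it and
  \<open>power_in_ideal\<close> applies.\<close>

lemma loc_frac_eq_on_basic_open:
  assumes f: "f \<in> carrier R" and m: "m \<in> carrier M" "m' \<in> carrier M"
    and s: "s \<in> carrier R" "s' \<in> carrier R"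
    and ns: "\<And>Q. Q \<in> basic_open R f \<Longrightarrow> s' \<notin> Q"
    and eq: "\<And>Q. Q \<in> basic_open R f \<Longrightarrow> loc_frac R M Q m s = loc_frac R M Q m' s'"
  shows "\<exists>n::nat. f [^] n \<odot>\<^bsub>M\<^esub> (s' \<odot>\<^bsub>M\<^esub> m) = f [^] n \<odot>\<^bsub>M\<^esub> (s \<odot>\<^bsub>M\<^esub> m')"
proof -
  define I where "I = {r \<in> carrier R. r \<odot>\<^bsub>M\<^esub> (s' \<odot>\<^bsub>M\<^esub> m) = r \<odot>\<^bsub>M\<^esub> (s \<odot>\<^bsub>M\<^esub> m')}"
  have "ideal I R"
    by (rule idealI_cring) (use m s in \<open>auto simp: I_def smult_l_distr smult_assoc1\<close>)
  moreover have "\<not> I \<subseteq> Q" if Q: "Q \<in> basic_open R f" for Q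
  proof -
    have "primeideal Q R" "s' \<in> carrier R - Q"
      using in_basic_open_imp_prime[OF Q] ns[OF Q] s by auto
    then have "\<exists>u\<in>carrier R - Q. u \<odot>\<^bsub>M\<^esub> (s' \<odot>\<^bsub>M\<^esub> m) = u \<odot>\<^bsub>M\<^esub> (s \<odot>\<^bsub>M\<^esub> m')"
      using loc_frac_eqD[OF _ m(2) _ eq[OF Q]] by simp
    then show ?thesis unfolding I_def by blast
  qed
  ultimately show ?thesis using power_in_ideal[OF _ f] unfolding I_def by blast
qed

text \<open>Instead of a finite cover, quasi-compactness is used through two families of ideals that are not
  contained in any prime of \<open>basic_open R f\<close>: the denominators \<open>J\<close> of \<open>\<xi>\<close>, and the increasing ideals
  \<open>K N\<close> of those \<open>r\<close> over whose basic open set \<open>h\<^sup>N\<^sup>+\<^sup>1 \<cdot> \<xi> = h\<^sup>N \<cdot> n / 1\<close> holds.\<close>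

theorem section_on_basic_open:
  assumes f: "f \<in> carrier R" and \<xi>: "\<xi> \<in> assoc_sections R M (basic_open R f)"
  shows "\<exists>m\<in>carrier M. \<exists>n::nat. \<forall>Q\<in>basic_open R f. \<xi> Q = loc_frac R M Q m (f [^] n)"
proof -
  \<comment> \<open>Representatives are chosen at each prime independently. They need not fit
    together and serve only to express equations in the stalks.\<close>
  have "\<forall>Q\<in>basic_open R f. \<exists>a s. a \<in> carrier M \<and> s \<in> carrier R - Q \<and> \<xi> Q = loc_frac R M Q a s"
    using \<xi> loc_module_carrierE unfolding assoc_sections_def by (metis (no_types, lifting) PiE_mem mem_Collect_eq)
  then obtain a s where a: "\<And>Q. Q \<in> basic_open R f \<Longrightarrow> a Q \<in> carrier M"
    and s: "\<And>Q. Q \<in> basic_open R f \<Longrightarrow> s Q \<in> carrier R - Q"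
    and as: "\<And>Q. Q \<in> basic_open R f \<Longrightarrow> \<xi> Q = loc_frac R M Q (a Q) (s Q)"
    by metis
  \<comment> \<open>\<open>E r m Q\<close> says that \<open>r \<cdot> \<xi> Q = m / 1\<close>.\<close>
  define E where "E r m Q \<longleftrightarrow> (\<exists>u\<in>carrier R - Q. u \<odot>\<^bsub>M\<^esub> (r \<odot>\<^bsub>M\<^esub> a Q) = u \<odot>\<^bsub>M\<^esub> (s Q \<odot>\<^bsub>M\<^esub> m))" for r m Q
  have E_add: "E (r \<oplus> r') (m \<oplus>\<^bsub>M\<^esub> m') Q" if Q: "Q \<in> basic_open R f" and rm: "r \<in> carrier R" "r' \<in> carrier R"
    "m \<in> carrier M" "m' \<in> carrier M" and E: "E r m Q" "E r' m' Q" for r r' m m' Q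
  proof -
    obtain u v where u: "u \<in> carrier R - Q" "u \<odot>\<^bsub>M\<^esub> (r \<odot>\<^bsub>M\<^esub> a Q) = u \<odot>\<^bsub>M\<^esub> (s Q \<odot>\<^bsub>M\<^esub> m)"
      and v: "v \<in> carrier R - Q" "v \<odot>\<^bsub>M\<^esub> (r' \<odot>\<^bsub>M\<^esub> a Q) = v \<odot>\<^bsub>M\<^esub> (s Q \<odot>\<^bsub>M\<^esub> m')"
      using E unfolding E_def by blast
    have c: "u \<in> carrier R" "v \<in> carrier R" "s Q \<in> carrier R" "a Q \<in> carrier M" using u v s a Q by auto
    have "(u \<otimes> v) \<odot>\<^bsub>M\<^esub> ((r \<oplus> r') \<odot>\<^bsub>M\<^esub> a Q)
       = v \<odot>\<^bsub>M\<^esub> (u \<odot>\<^bsub>M\<^esub> (r \<odot>\<^bsub>M\<^esub> a Q)) \<oplus>\<^bsub>M\<^esub> u \<odot>\<^bsub>M\<^esub> (v \<odot>\<^bsub>M\<^esub> (r' \<odot>\<^bsub>M\<^esub> a Q))"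
      using c rm by (simp add: smult_assoc1[symmetric] m_ac smult_l_distr smult_r_distr)
    also have "\<dots> = (u \<otimes> v) \<odot>\<^bsub>M\<^esub> (s Q \<odot>\<^bsub>M\<^esub> (m \<oplus>\<^bsub>M\<^esub> m'))"
      unfolding u(2) v(2) using c rm by (simp add: smult_assoc1[symmetric] m_ac smult_r_distr)
    finally show ?thesis unfolding E_def
      using primeideal_mult_notin[OF _ u(1) v(1)] in_basic_open_imp_prime[OF Q] by blast
  qed
  have E_smult: "E (t \<otimes> r) (t \<odot>\<^bsub>M\<^esub> m) Q" if Q: "Q \<in> basic_open R f" and rm: "r \<in> carrier R"
    "m \<in> carrier M" "t \<in> carrier R" and E: "E r m Q" for r m t Q
  proof -
    obtain u where u: "u \<in> carrier R - Q" "u \<odot>\<^bsub>M\<^esub> (r \<odot>\<^bsub>M\<^esub> a Q) = u \<odot>\<^bsub>M\<^esub> (s Q \<odot>\<^bsub>M\<^esub> m)"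
      using E unfolding E_def by blast
    have c: "u \<in> carrier R" "s Q \<in> carrier R" "a Q \<in> carrier M" using u s a Q by auto
    have "u \<odot>\<^bsub>M\<^esub> ((t \<otimes> r) \<odot>\<^bsub>M\<^esub> a Q) = t \<odot>\<^bsub>M\<^esub> (u \<odot>\<^bsub>M\<^esub> (r \<odot>\<^bsub>M\<^esub> a Q))"
      using c rm by (simp add: smult_assoc1[symmetric] m_ac)
    also have "\<dots> = u \<odot>\<^bsub>M\<^esub> (s Q \<odot>\<^bsub>M\<^esub> (t \<odot>\<^bsub>M\<^esub> m))"
      unfolding u(2) using c rm by (simp add: smult_assoc1[symmetric] m_ac)
    finally show ?thesis using u(1) unfolding E_def by blast
  qed
  have E_zero: "E \<zero> \<zero>\<^bsub>M\<^esub> Q" if Q: "Q \<in> basic_open R f" for Q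
    unfolding E_def using a[OF Q] s[OF Q] by (intro bexI[of _ "s Q"]) auto
  define J where "J = {r \<in> carrier R. \<exists>m\<in>carrier M. \<forall>Q\<in>basic_open R f. E r m Q}"
  have "ideal J R"
  proof (rule idealI_cring)
    show "\<zero> \<in> J" unfolding J_def using E_zero by auto
    show "r \<oplus> r' \<in> J" if rr': "r \<in> J" "r' \<in> J" for r r'
    proof -
      obtain m m' where m: "m \<in> carrier M" "m' \<in> carrier M"
        "\<forall>Q\<in>basic_open R f. E r m Q" "\<forall>Q\<in>basic_open R f. E r' m' Q"
        using rr' unfolding J_def by auto
      have "\<forall>Q\<in>basic_open R f. E (r \<oplus> r') (m \<oplus>\<^bsub>M\<^esub> m') Q"
        using E_add m rr' unfolding J_def by simp
      then show ?thesis using m rr' unfolding J_def by (auto intro!: bexI[of _ "m \<oplus>\<^bsub>M\<^esub> m'"])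
    qed
    show "t \<otimes> r \<in> J" if tr: "r \<in> J" "t \<in> carrier R" for r t
    proof -
      obtain m where m: "m \<in> carrier M" "\<forall>Q\<in>basic_open R f. E r m Q"
        using tr unfolding J_def by auto
      have "\<forall>Q\<in>basic_open R f. E (t \<otimes> r) (t \<odot>\<^bsub>M\<^esub> m) Q"
        using E_smult m tr unfolding J_def by simp
      then show ?thesis using m tr unfolding J_def by (auto intro!: bexI[of _ "t \<odot>\<^bsub>M\<^esub> m"])
    qed
  qed (auto simp: J_def)
  moreover have "\<not> J \<subseteq> P" if P: "P \<in> basic_open R f" for P
  proof
    assume JP: "J \<subseteq> P"
    obtain n h where n: "n \<in> carrier M" and h: "h \<in> carrier R" "P \<in> basic_open R h"
      "basic_open R h \<subseteq> basic_open R f"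
      and nh: "\<forall>Q\<in>basic_open R h. \<xi> Q = loc_frac R M Q n h"
      using assoc_sections_basicE[OF \<xi> P] .
    define K where "K N = {r \<in> carrier R. \<forall>Q\<in>basic_open R f. r \<notin> Q \<longrightarrow> E (h [^] Suc N) (h [^] N \<odot>\<^bsub>M\<^esub> n) Q}" for N :: nat
    have step: "E (h [^] Suc (k + N)) (h [^] (k + N) \<odot>\<^bsub>M\<^esub> n) Q"
      if Q: "Q \<in> basic_open R f" and E: "E (h [^] Suc N) (h [^] N \<odot>\<^bsub>M\<^esub> n) Q" for N k :: nat and Q
      using E_smult[OF Q _ _ _ E, of "h [^] k"] h n
      by (simp add: smult_assoc1[symmetric] nat_pow_mult m_assoc[symmetric])
    have mono: "K N \<subseteq> K N'" if NN': "N \<le> N'" for N N'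
    proof -
      obtain k where "N' = k + N" using NN' by (metis le_add_diff_inverse2)
      then show ?thesis unfolding K_def using step by blast
    qed
    have "ideal (\<Union>(range K)) R"
    proof (rule idealI_cring)
      \<comment> \<open>Every prime contains \<open>\<zero>\<close>, so its membership condition is
        vacuous.\<close>
      show "\<zero> \<in> \<Union>(range K)"
      proof -
        have "\<zero> \<in> Q" if "Q \<in> basic_open R f" for Q
          using in_basic_open_imp_prime[OF that] additive_subgroup.zero_closed ideal_def primeideal_def by metis
        then show ?thesis unfolding K_def by auto
      qed
      show "r \<oplus> r' \<in> \<Union>(range K)" if rr': "r \<in> \<Union>(range K)" "r' \<in> \<Union>(range K)" for r r'
      proof -
        obtain N N' where "r \<in> K N" "r' \<in> K N'" using rr' by blast
        \<comment> \<open>Two elements may come with different exponents. The family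
          \<open>K\<close> is increasing, so the larger exponent serves both; a prime missing the
          sum misses one of the summands.\<close>
        then have rr: "r \<in> K (max N N')" "r' \<in> K (max N N')"
          using mono[of N "max N N'"] mono[of N' "max N N'"] by auto
        have "r \<notin> Q \<or> r' \<notin> Q" if "Q \<in> basic_open R f" "r \<oplus> r' \<notin> Q" for Q
          using in_basic_open_imp_prime[OF that(1)] that(2) additive_subgroup.a_closed ideal_def primeideal_def by metis
        then have "r \<oplus> r' \<in> K (max N N')" using rr unfolding K_def by blast
        then show ?thesis by blast
      qed
      show "t \<otimes> r \<in> \<Union>(range K)" if tr: "r \<in> \<Union>(range K)" "t \<in> carrier R" for r t
      proof -
        obtain N where r: "r \<in> K N" using tr by blast
        have "r \<notin> Q" if "Q \<in> basic_open R f" "t \<otimes> r \<notin> Q" for Q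
          using in_basic_open_imp_prime[OF that(1)] that(2) tr(2) ideal.I_l_closed primeideal_def by metis
        then have "t \<otimes> r \<in> K N" using r tr(2) unfolding K_def by blast
        then show ?thesis by blast
      qed
    qed (auto simp: K_def)
    moreover have "\<not> \<Union>(range K) \<subseteq> Q" if Q: "Q \<in> basic_open R f" for Q
    proof -
      obtain n' h' where n': "n' \<in> carrier M" and h': "h' \<in> carrier R" "Q \<in> basic_open R h'"
        "basic_open R h' \<subseteq> basic_open R f"
        and nh': "\<forall>Q\<in>basic_open R h'. \<xi> Q = loc_frac R M Q n' h'"
        using assoc_sections_basicE[OF \<xi> Q] .
      \<comment> \<open>On D(h h') both local fractions describe \<xi>, so they agree after
        multiplication by a power of h h'. The part \<open>h [^] N\<close> of it becomes the
        exponent in \<open>K N\<close>; the part \<open>h' [^] N\<close> goes into the witness at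
        primes that do not contain h'.\<close>
      have "\<exists>N::nat. (h \<otimes> h') [^] N \<odot>\<^bsub>M\<^esub> (h' \<odot>\<^bsub>M\<^esub> n) = (h \<otimes> h') [^] N \<odot>\<^bsub>M\<^esub> (h \<odot>\<^bsub>M\<^esub> n')"
      proof (rule loc_frac_eq_on_basic_open)
        fix Q' assume "Q' \<in> basic_open R (h \<otimes> h')"
        then have Q': "Q' \<in> basic_open R h" "Q' \<in> basic_open R h'" using basic_open_mult h h' by auto
        show "h' \<notin> Q'" using in_basic_open_imp_prime[OF Q'(2)] by simp
        show "loc_frac R M Q' n h = loc_frac R M Q' n' h'" using nh nh' Q' by metis
      qed (use n n' h h' in auto)
      then obtain N :: nat where N:
        "(h \<otimes> h') [^] N \<odot>\<^bsub>M\<^esub> (h' \<odot>\<^bsub>M\<^esub> n) = (h \<otimes> h') [^] N \<odot>\<^bsub>M\<^esub> (h \<odot>\<^bsub>M\<^esub> n')" by blast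
      have "h' \<in> K N"
      proof -
        have "E (h [^] Suc N) (h [^] N \<odot>\<^bsub>M\<^esub> n) Q'" if Qh': "Q' \<in> basic_open R f" "h' \<notin> Q'" for Q'
        proof -
          have Q': "Q' \<in> basic_open R h'" and pr: "primeideal Q' R"
            using Qh' unfolding basic_open_def Spec_def by auto
          have "loc_frac R M Q' (a Q') (s Q') = loc_frac R M Q' n' h'"
            using as[OF Qh'(1)] nh' Q' by metis
          then obtain u where u: "u \<in> carrier R - Q'"
            "u \<odot>\<^bsub>M\<^esub> (h' \<odot>\<^bsub>M\<^esub> a Q') = u \<odot>\<^bsub>M\<^esub> (s Q' \<odot>\<^bsub>M\<^esub> n')"
            using loc_frac_eqD[OF pr n'] h'(1) Qh'(2) by (metis DiffI)
          have c: "u \<in> carrier R" "s Q' \<in> carrier R" "a Q' \<in> carrier M"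
            using u s a Qh' by auto
          define p q where "p = h [^] N" and "q = h' [^] N"
          have pq: "p \<in> carrier R" "q \<in> carrier R" "(h \<otimes> h') [^] N = p \<otimes> q"
            using h h' by (auto simp: p_def q_def nat_pow_distrib)
          have "(u \<otimes> (q \<otimes> h')) \<odot>\<^bsub>M\<^esub> ((p \<otimes> h) \<odot>\<^bsub>M\<^esub> a Q') = (q \<otimes> p \<otimes> h) \<odot>\<^bsub>M\<^esub> (u \<odot>\<^bsub>M\<^esub> (h' \<odot>\<^bsub>M\<^esub> a Q'))"
            using c h h' pq by (simp add: smult_assoc1[symmetric] m_ac)
          also have "\<dots> = (u \<otimes> s Q') \<odot>\<^bsub>M\<^esub> ((h \<otimes> h') [^] N \<odot>\<^bsub>M\<^esub> (h \<odot>\<^bsub>M\<^esub> n'))"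
            unfolding u(2) pq(3) using c h h' pq(1,2) n' by (simp add: smult_assoc1[symmetric] m_ac)
          also have "\<dots> = (u \<otimes> s Q') \<odot>\<^bsub>M\<^esub> ((p \<otimes> q) \<odot>\<^bsub>M\<^esub> (h' \<odot>\<^bsub>M\<^esub> n))"
            using N unfolding pq(3) by simp
          also have "\<dots> = (u \<otimes> (q \<otimes> h')) \<odot>\<^bsub>M\<^esub> (s Q' \<odot>\<^bsub>M\<^esub> (p \<odot>\<^bsub>M\<^esub> n))"
            using c h h' pq(1,2) n by (simp add: smult_assoc1[symmetric] m_ac)
          finally have *: "(u \<otimes> (q \<otimes> h')) \<odot>\<^bsub>M\<^esub> (h [^] Suc N \<odot>\<^bsub>M\<^esub> a Q') = (u \<otimes> (q \<otimes> h')) \<odot>\<^bsub>M\<^esub> (s Q' \<odot>\<^bsub>M\<^esub> (h [^] N \<odot>\<^bsub>M\<^esub> n))"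
            unfolding p_def by simp
          have "u \<otimes> (q \<otimes> h') \<in> carrier R - Q'"
            unfolding q_def using primeideal_mult_notin[OF pr] primeideal_pow_notin[OF pr] u(1) h'(1) Qh'(2) by blast
          with * show ?thesis unfolding E_def by blast
        qed
        then show ?thesis unfolding K_def using h' by simp
      qed
      moreover have "h' \<notin> Q" using in_basic_open_imp_prime[OF h'(2)] by simp
      ultimately show ?thesis by blast
    qed
    ultimately obtain k :: nat where "f [^] k \<in> \<Union>(range K)" using power_in_ideal[OF _ f] by blast
    then obtain N where N: "f [^] k \<in> K N" by blast
    \<comment> \<open>No prime of D(f) contains a power of f, so membership of such a power in
      \<open>K N\<close> gives the equation over all of D(f). Thus a power of \<open>h\<close> is a
      global denominator, although \<open>h\<close> is outside \<open>P\<close>: this contradicts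
      \<open>JP\<close>.\<close>
    have "h [^] Suc N \<in> J"
    proof -
      have "f [^] k \<notin> Q" if "Q \<in> basic_open R f" for Q
        using primeideal_pow_notin[of Q f k] in_basic_open_imp_prime[OF that] f by blast
      then have "\<forall>Q\<in>basic_open R f. E (h [^] Suc N) (h [^] N \<odot>\<^bsub>M\<^esub> n) Q" using N unfolding K_def by blast
      then show ?thesis unfolding J_def using h n by blast
    qed
    then show False
      using JP primeideal_pow_notin[of P h "Suc N"] in_basic_open_imp_prime[OF h(2)] h(1) by blast
  qed
  ultimately obtain k :: nat where "f [^] k \<in> J" using power_in_ideal[OF _ f] by blast
  then obtain m where m: "m \<in> carrier M" "\<And>Q. Q \<in> basic_open R f \<Longrightarrow> E (f [^] k) m Q"
    unfolding J_def by blast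
  have "\<xi> Q = loc_frac R M Q m (f [^] k)" if Q: "Q \<in> basic_open R f" for Q
  proof -
    have pr: "primeideal Q R" and fQ: "f \<in> carrier R - Q" using in_basic_open_imp_prime[OF Q] f by auto
    obtain u where u: "u \<in> carrier R - Q" "u \<odot>\<^bsub>M\<^esub> (f [^] k \<odot>\<^bsub>M\<^esub> a Q) = u \<odot>\<^bsub>M\<^esub> (s Q \<odot>\<^bsub>M\<^esub> m)"
      using m(2)[OF Q] unfolding E_def by blast
    show ?thesis unfolding as[OF Q]
      by (rule loc_frac_eqI[OF pr a[OF Q] m(1) s[OF Q] primeideal_pow_notin[OF pr fQ] u])
  qed
  then show ?thesis using m(1) by blast
qed

end

section \<open>Affine morphisms\<close>

definition assoc_global :: "('a, 'c) ring_scheme \<Rightarrow> ('a, 'b, 'd) module_scheme \<Rightarrow> 'b \<Rightarrow> 'a set \<Rightarrow> ('b \<times> 'a) set"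
  where "assoc_global R M m = (\<lambda>P\<in>Spec R. loc_frac R M P m \<one>\<^bsub>R\<^esub>)"

lemma global_frac_eq_assoc_global: "global_frac R = assoc_global R (self_module R)"
  by (simp add: fun_eq_iff global_frac_def assoc_global_def)

section \<open>Modules as global sections of their associated sheaves\<close>

context module
begin

lemma assoc_global_in_sections:
  assumes "m \<in> carrier M"
  shows "assoc_global R M m \<in> assoc_sections R M (Spec R)"
proof (rule assoc_sectionsI)
  fix P assume P: "P \<in> Spec R"
  show "\<exists>n f. n \<in> carrier M \<and> f \<in> carrier R \<and> P \<in> basic_open R f \<and> basic_open R f \<subseteq> Spec R \<and>
    (\<forall>Q\<in>basic_open R f. assoc_global R M m Q = loc_frac R M Q n f)"
    by (intro exI[of _ m] exI[of _ \<one>]) (use assms P in \<open>auto simp: basic_open_one assoc_global_def\<close>)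
qed (simp add: assoc_global_def)

text \<open>The denominator has to define a basic set inside \<open>W\<close>, so the fraction is
  expanded by some \<open>g\<close> with P in D(g) and D(g) contained in \<open>W\<close>.\<close>

lemma assoc_sections_restrict:
  assumes \<xi>: "\<xi> \<in> assoc_sections R M U" and W: "openin (zariski R) W" "W \<subseteq> U"
  shows "restrict \<xi> W \<in> assoc_sections R M W"
proof (rule assoc_sectionsI)
  fix P assume P: "P \<in> W"
  obtain m f where mf: "m \<in> carrier M" "f \<in> carrier R" "P \<in> basic_open R f" "basic_open R f \<subseteq> U"
    "\<forall>Q\<in>basic_open R f. \<xi> Q = loc_frac R M Q m f"
    using assoc_sections_basicE[OF \<xi>] P W(2) by blast
  obtain g where g: "g \<in> carrier R" "P \<in> basic_open R g" "basic_open R g \<subseteq> W"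
    using openin_zariski_basic_openE[OF W(1) P] .
  have D: "basic_open R (g \<otimes> f) = basic_open R g \<inter> basic_open R f"
    using basic_open_mult g mf by simp
  have "restrict \<xi> W Q = loc_frac R M Q (g \<odot>\<^bsub>M\<^esub> m) (g \<otimes> f)" if Q: "Q \<in> basic_open R (g \<otimes> f)" for Q
  proof -
    have "loc_frac R M Q (g \<odot>\<^bsub>M\<^esub> m) (g \<otimes> f) = loc_frac R M Q m f"
      using Q D g(1) mf(1,2) by (intro loc_frac_cancel) (auto dest: in_basic_open_imp_prime)
    then show ?thesis using mf(5) Q D g(3) by auto
  qed
  then show "\<exists>m f. m \<in> carrier M \<and> f \<in> carrier R \<and> P \<in> basic_open R f \<and> basic_open R f \<subseteq> W \<and>
    (\<forall>Q\<in>basic_open R f. restrict \<xi> W Q = loc_frac R M Q m f)"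
    using mf g D by (intro exI[of _ "g \<odot>\<^bsub>M\<^esub> m"] exI[of _ "g \<otimes> f"]) auto
qed simp

text \<open>The case f = 1 of the two results over D(f). All powers of 1 disappear: elements with
  equal fractions everywhere coincide, and a section over the whole spectrum is a fraction with
  denominator 1.\<close>

lemma bij_betw_assoc_global:
  "bij_betw (assoc_global R M) (carrier M) (assoc_sections R M (Spec R))"
  unfolding bij_betw_def
proof
  show "inj_on (assoc_global R M) (carrier M)"
  proof (rule inj_onI)
    fix m m' assume m: "m \<in> carrier M" "m' \<in> carrier M" and eq: "assoc_global R M m = assoc_global R M m'"
    have "\<exists>n::nat. \<one> [^] n \<odot>\<^bsub>M\<^esub> (\<one> \<odot>\<^bsub>M\<^esub> m) = \<one> [^] n \<odot>\<^bsub>M\<^esub> (\<one> \<odot>\<^bsub>M\<^esub> m')"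
    proof (rule loc_frac_eq_on_basic_open)
      fix Q assume Q: "Q \<in> basic_open R \<one>"
      show "\<one> \<notin> Q" using in_basic_open_imp_prime[OF Q] by simp
      show "loc_frac R M Q m \<one> = loc_frac R M Q m' \<one>"
        using fun_cong[OF eq, of Q] Q unfolding assoc_global_def basic_open_one by simp
    qed (use m in auto)
    then show "m = m'" using m by simp
  qed
  show "assoc_global R M ` carrier M = assoc_sections R M (Spec R)"
  proof
    show "assoc_sections R M (Spec R) \<subseteq> assoc_global R M ` carrier M"
    proof
      fix \<xi> assume \<xi>: "\<xi> \<in> assoc_sections R M (Spec R)"
      then obtain m n where m: "m \<in> carrier M" "\<forall>Q\<in>Spec R. \<xi> Q = loc_frac R M Q m (\<one> [^] (n::nat))"
        using section_on_basic_open[of \<one> \<xi>] unfolding basic_open_one by auto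
      have "\<xi> \<in> extensional (Spec R)" using \<xi> unfolding assoc_sections_def by (auto simp: PiE_def)
      then have "\<xi> = assoc_global R M m"
        using m(2) unfolding assoc_global_def by (auto simp: fun_eq_iff extensional_def)
      then show "\<xi> \<in> assoc_global R M ` carrier M" using m(1) by simp
    qed
  qed (use assoc_global_in_sections in auto)
qed

lemma assoc_global_add:
  assumes "m \<in> carrier M" "n \<in> carrier M"
  shows "(\<lambda>P\<in>Spec R. assoc_global R M m P \<oplus>\<^bsub>loc_module R M P\<^esub> assoc_global R M n P)
    = assoc_global R M (m \<oplus>\<^bsub>M\<^esub> n)"
  unfolding assoc_global_def
proof (intro restrict_ext)
  fix P assume "P \<in> Spec R"
  then have P: "primeideal P R" "\<one> \<in> carrier R - P" using primeideal_one_notin unfolding Spec_def by auto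
  then show "(\<lambda>P\<in>Spec R. loc_frac R M P m \<one>) P \<oplus>\<^bsub>loc_module R M P\<^esub> (\<lambda>P\<in>Spec R. loc_frac R M P n \<one>) P
    = loc_frac R M P (m \<oplus>\<^bsub>M\<^esub> n) \<one>"
    using assms \<open>P \<in> Spec R\<close> by (simp add: loc_module_add)
qed

lemma assoc_global_smult:
  assumes "a \<in> carrier R" "n \<in> carrier M"
  shows "(\<lambda>P\<in>Spec R. global_frac R a P \<odot>\<^bsub>loc_module R M P\<^esub> assoc_global R M n P)
    = assoc_global R M (a \<odot>\<^bsub>M\<^esub> n)"
  unfolding assoc_global_def global_frac_def
proof (intro restrict_ext)
  fix P assume "P \<in> Spec R"
  then have P: "primeideal P R" "\<one> \<in> carrier R - P" using primeideal_one_notin unfolding Spec_def by auto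
  then show "(\<lambda>P\<in>Spec R. loc_frac R (self_module R) P a \<one>) P \<odot>\<^bsub>loc_module R M P\<^esub> (\<lambda>P\<in>Spec R. loc_frac R M P n \<one>) P
    = loc_frac R M P (a \<odot>\<^bsub>M\<^esub> n) \<one>"
    using assms \<open>P \<in> Spec R\<close> by (simp add: loc_module_smult)
qed

end

locale affine_hom = ring_hom_cring A T h
  for A :: "('a, 'c) ring_scheme" and T :: "('t, 'd) ring_scheme" and h :: "'a \<Rightarrow> 't"
begin

lemma A_cring: "cring A" and T_cring: "cring T"
  by unfold_locales

sublocale SA: module A "self_module A" by (rule module_self_module[OF A_cring])
sublocale ST: module T "self_module T" by (rule module_self_module[OF T_cring])

lemma Spec_map_prime:
  assumes "primeideal Q T"
  shows "primeideal (Spec_map A h Q) A"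
proof -
  interpret Q: primeideal Q T by fact
  show ?thesis
  proof (rule primeidealI)
    show "ideal (Spec_map A h Q) A"
      by (rule R.idealI_cring) (auto simp: Spec_map_def intro: Q.a_closed Q.I_l_closed Q.zero_closed)
    show "carrier A \<noteq> Spec_map A h Q"
      using primeideal_one_notin[OF assms] hom_one R.one_closed unfolding Spec_map_def
      by (metis (no_types, lifting) mem_Collect_eq)
    show "a \<in> Spec_map A h Q \<or> b \<in> Spec_map A h Q"
      if "a \<in> carrier A" "b \<in> carrier A" "a \<otimes>\<^bsub>A\<^esub> b \<in> Spec_map A h Q" for a b
      using that Q.I_prime[of "h a" "h b"] unfolding Spec_map_def by auto
  qed (rule A_cring)
qed

lemma Spec_preimage_Spec: "Spec_preimage A T h (Spec A) = Spec T"
  unfolding Spec_preimage_def Spec_def using Spec_map_prime by auto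

lemma Spec_preimage_basic_open:
  assumes "s \<in> carrier A"
  shows "Spec_preimage A T h (basic_open A s) = basic_open T (h s)"
  using assms Spec_map_prime unfolding Spec_preimage_def basic_open_def Spec_def Spec_map_def by auto

lemma Spec_preimage_mono: "V \<subseteq> W \<Longrightarrow> Spec_preimage A T h V \<subseteq> Spec_preimage A T h W"
  unfolding Spec_preimage_def by auto

lemma basic_open_subset_Spec_preimage:
  assumes "s \<in> carrier A" "basic_open A s \<subseteq> V"
  shows "basic_open T (h s) \<subseteq> Spec_preimage A T h V"
  using Spec_preimage_mono[OF assms(2)] Spec_preimage_basic_open[OF assms(1)] by simp

lemma notin_Spec_map:
  "s \<in> carrier A - Spec_map A h Q \<Longrightarrow> h s \<in> carrier T - Q"
  unfolding Spec_map_def by auto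

text \<open>An element outside the contraction of \<open>Q\<close> has its image outside
  \<open>Q\<close>. Hence \<open>h\<close> carries a witness for the equality of two fractions to
  such a witness at \<open>Q\<close>, and the union defining the comorphism is constant.\<close>

lemma Spec_comorphism_frac:
  assumes Q: "Q \<in> Spec_preimage A T h U" and a: "a \<in> carrier A" and s: "s \<in> carrier A - Spec_map A h Q"
    and \<xi>: "\<xi> (Spec_map A h Q) = loc_frac A (self_module A) (Spec_map A h Q) a s"
  shows "Spec_comorphism A T h U \<xi> Q = loc_frac T (self_module T) Q (h a) (h s)"
proof -
  let ?P = "Spec_map A h Q"
  have pQ: "primeideal Q T" using Q unfolding Spec_preimage_def Spec_def by auto
  then have pP: "primeideal ?P A" by (rule Spec_map_prime)
  have "(\<Union>(a', s')\<in>loc_frac A (self_module A) ?P a s. loc_frac T (self_module T) Q (h a') (h s'))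
    = loc_frac T (self_module T) Q (h a) (h s)"
  proof (rule SA.UNION_loc_frac_const[OF pP])
    fix a' s' assume "a' \<in> carrier (self_module A)" and s': "s' \<in> carrier A - ?P"
      and eq: "loc_frac A (self_module A) ?P a' s' = loc_frac A (self_module A) ?P a s"
    then have a': "a' \<in> carrier A" by simp
    obtain u where u: "u \<in> carrier A - ?P" "u \<otimes>\<^bsub>A\<^esub> (s \<otimes>\<^bsub>A\<^esub> a') = u \<otimes>\<^bsub>A\<^esub> (s' \<otimes>\<^bsub>A\<^esub> a)"
      using SA.loc_frac_eqD[OF pP _ s eq] a by auto
    have "h u \<otimes>\<^bsub>T\<^esub> (h s \<otimes>\<^bsub>T\<^esub> h a') = h u \<otimes>\<^bsub>T\<^esub> (h s' \<otimes>\<^bsub>T\<^esub> h a)"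
      using arg_cong[OF u(2), of h] u(1) a a' s s' by simp
    then show "loc_frac T (self_module T) Q (h a') (h s') = loc_frac T (self_module T) Q (h a) (h s)"
      using a a' notin_Spec_map[OF s] notin_Spec_map[OF s'] notin_Spec_map[OF u(1)]
      by (intro ST.loc_frac_eqI[OF pQ, where u = "h u"]) auto
  qed (use a s in auto)
  then show ?thesis using Q \<xi> unfolding Spec_comorphism_def by simp
qed

text \<open>Serves two homomorphisms: for the structure map it identifies the action of
  \<open>A\<close> on global functions, and for the endomorphism of the lattice ring given by a
  group element it computes the group action.\<close>

lemma Spec_comorphism_global_frac:
  assumes "a \<in> carrier A"
  shows "Spec_comorphism A T h (Spec A) (global_frac A a) = global_frac T (h a)"
proof
  fix Q
  show "Spec_comorphism A T h (Spec A) (global_frac A a) Q = global_frac T (h a) Q"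
  proof (cases "Q \<in> Spec T")
    case True
    then have P: "Spec_map A h Q \<in> Spec A" "primeideal (Spec_map A h Q) A"
      using Spec_map_prime unfolding Spec_def by auto
    have "Spec_comorphism A T h (Spec A) (global_frac A a) Q = loc_frac T (self_module T) Q (h a) (h \<one>\<^bsub>A\<^esub>)"
      by (rule Spec_comorphism_frac)
         (use True P assms primeideal_one_notin[OF P(2)] in \<open>auto simp: Spec_preimage_Spec global_frac_def\<close>)
    then show ?thesis using True by (simp add: global_frac_def)
  next
    case False
    then show ?thesis by (simp add: Spec_comorphism_def Spec_preimage_Spec global_frac_def)
  qed
qed

lemma openin_Spec_preimage_basic_open:
  "s \<in> carrier A \<Longrightarrow> openin (zariski T) (basic_open T (h s))"
  by (rule openin_basic_open) simp

text \<open>Local denominators of the direct image can be taken from \<open>A\<close>: the preimage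
  of D(f) is again basic, namely D(h f), and a section over it is one fraction whose denominator is
  a power of \<open>h f\<close>.\<close>

lemma direct_image_section_local:
  assumes V: "openin (zariski A) V" and P: "P \<in> V"
    and \<xi>: "\<xi> \<in> assoc_sections T (self_module T) (Spec_preimage A T h V)"
  obtains s t where "s \<in> carrier A" "t \<in> carrier T" "P \<in> basic_open A s" "basic_open A s \<subseteq> V"
    "\<forall>Q\<in>basic_open T (h s). \<xi> Q = loc_frac T (self_module T) Q t (h s)"
proof -
  obtain f where f: "f \<in> carrier A" "P \<in> basic_open A f" "basic_open A f \<subseteq> V"
    using openin_zariski_basic_openE[OF V P] .
  have "restrict \<xi> (basic_open T (h f)) \<in> assoc_sections T (self_module T) (basic_open T (h f))"
    using ST.assoc_sections_restrict[OF \<xi> _ basic_open_subset_Spec_preimage[OF f(1,3)]]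
      openin_Spec_preimage_basic_open[OF f(1)] by blast
  then obtain t and n :: nat where t: "t \<in> carrier T"
    "\<forall>Q\<in>basic_open T (h f). \<xi> Q = loc_frac T (self_module T) Q t (h f [^]\<^bsub>T\<^esub> n)"
    using ST.section_on_basic_open[of "h f" "restrict \<xi> (basic_open T (h f))"] f(1) by auto
  \<comment> \<open>The exponent is raised by one because \<open>n\<close> may be 0. The denominator
    would then be 1 and would no longer define D(f).\<close>
  define s where "s = f [^]\<^bsub>A\<^esub> Suc n"
  have s: "s \<in> carrier A" "basic_open A s = basic_open A f"
    unfolding s_def using f R.basic_open_pow[of f "Suc n"] by auto
  have hs: "h s = h f \<otimes>\<^bsub>T\<^esub> h f [^]\<^bsub>T\<^esub> n"
    unfolding s_def using f(1) by (simp add: hom_nat_pow S.m_comm)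
  have D: "basic_open T (h s) = basic_open T (h f)"
    using Spec_preimage_basic_open s f(1) by metis
  have "\<xi> Q = loc_frac T (self_module T) Q (h f \<otimes>\<^bsub>T\<^esub> t) (h s)" if Q: "Q \<in> basic_open T (h s)" for Q
  proof -
    have pr: "primeideal Q T" and hf: "h f \<in> carrier T - Q"
      using Q f(1) unfolding D by (auto dest: in_basic_open_imp_prime)
    have "loc_frac T (self_module T) Q (h f \<odot>\<^bsub>self_module T\<^esub> t) (h f \<otimes>\<^bsub>T\<^esub> h f [^]\<^bsub>T\<^esub> n)
      = loc_frac T (self_module T) Q t (h f [^]\<^bsub>T\<^esub> n)"
      using pr hf t(1) S.primeideal_pow_notin[OF pr hf] by (intro ST.loc_frac_cancel) auto
    moreover have "\<xi> Q = loc_frac T (self_module T) Q t (h f [^]\<^bsub>T\<^esub> n)" using t(2) Q unfolding D by blast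
    ultimately show ?thesis unfolding hs by simp
  qed
  then show thesis using that[of s "h f \<otimes>\<^bsub>T\<^esub> t"] s f t(1) by auto
qed

end

section \<open>The morphism of sheaves induced by a linear map\<close>

locale affine_hom_module = affine_hom A T h + B: module A B
  for A :: "('a, 'c) ring_scheme" and T :: "('t, 'd) ring_scheme" and h
    and B :: "('a, 'b, 'e) module_scheme"
begin

definition local_rep where
  "local_rep V \<xi> P s t \<longleftrightarrow> s \<in> carrier A \<and> t \<in> carrier T \<and> P \<in> basic_open A s \<and> basic_open A s \<subseteq> V \<and>
    (\<forall>Q\<in>basic_open T (h s). \<xi> Q = loc_frac T (self_module T) Q t (h s))"

text \<open>The sheaf morphism induced by a linear map \<open>\<theta>\<close> sends a section that is \<open>t / h s\<close> over the
  preimage of a basic open set \<open>D s\<close> to \<open>\<theta> t / s\<close> on \<open>D s\<close>.\<close>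

definition induced_section ::
  "('t \<Rightarrow> 'b) \<Rightarrow> 'a set set \<Rightarrow> ('t set \<Rightarrow> ('t \<times> 't) set) \<Rightarrow> ('a set \<Rightarrow> ('b \<times> 'a) set)"
  where "induced_section \<theta> V \<xi> =
    (\<lambda>P\<in>V. \<Union>{loc_frac A B P (\<theta> t) s | s t. local_rep V \<xi> P s t})"

context
  fixes \<theta> :: "'t \<Rightarrow> 'b"
  assumes \<theta>_closed: "t \<in> carrier T \<Longrightarrow> \<theta> t \<in> carrier B"
    and \<theta>_add: "\<lbrakk>t \<in> carrier T; t' \<in> carrier T\<rbrakk> \<Longrightarrow> \<theta> (t \<oplus>\<^bsub>T\<^esub> t') = \<theta> t \<oplus>\<^bsub>B\<^esub> \<theta> t'"
    and \<theta>_smult: "\<lbrakk>a \<in> carrier A; t \<in> carrier T\<rbrakk> \<Longrightarrow> \<theta> (h a \<otimes>\<^bsub>T\<^esub> t) = a \<odot>\<^bsub>B\<^esub> \<theta> t"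
begin

text \<open>Well-definedness of \<theta> t / s. Two representations agree over D(h (s s')), hence in
  \<open>T\<close> after multiplication by a power of \<open>h (s s')\<close>. Every factor in this
  equation other than t and t' comes from \<open>A\<close>, so \<theta> turns it into an equation in
  \<open>B\<close> with the same power as witness at \<open>P\<close>.\<close>

lemma local_rep_unique:
  assumes "local_rep V \<xi> P s t" "local_rep V \<xi> P s' t'"
  shows "loc_frac A B P (\<theta> t) s = loc_frac A B P (\<theta> t') s'"
proof -
  note st = assms[unfolded local_rep_def]
  have c: "s \<in> carrier A" "s' \<in> carrier A" "t \<in> carrier T" "t' \<in> carrier T" using st by auto
  have P: "P \<in> basic_open A s" "P \<in> basic_open A s'" using st by auto
  have "\<exists>n::nat. h (s \<otimes>\<^bsub>A\<^esub> s') [^]\<^bsub>T\<^esub> n \<odot>\<^bsub>self_module T\<^esub> (h s' \<odot>\<^bsub>self_module T\<^esub> t)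
    = h (s \<otimes>\<^bsub>A\<^esub> s') [^]\<^bsub>T\<^esub> n \<odot>\<^bsub>self_module T\<^esub> (h s \<odot>\<^bsub>self_module T\<^esub> t')"
  proof (rule ST.loc_frac_eq_on_basic_open)
    fix Q assume Q: "Q \<in> basic_open T (h (s \<otimes>\<^bsub>A\<^esub> s'))"
    then have Q': "Q \<in> basic_open T (h s)" "Q \<in> basic_open T (h s')"
      using S.basic_open_mult c by auto
    show "h s' \<notin> Q" using in_basic_open_imp_prime[OF Q'(2)] by simp
    show "loc_frac T (self_module T) Q t (h s) = loc_frac T (self_module T) Q t' (h s')"
      using st Q' by metis
  qed (use c in auto)
  then obtain n :: nat where n: "h ((s \<otimes>\<^bsub>A\<^esub> s') [^]\<^bsub>A\<^esub> n) \<otimes>\<^bsub>T\<^esub> (h s' \<otimes>\<^bsub>T\<^esub> t)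
      = h ((s \<otimes>\<^bsub>A\<^esub> s') [^]\<^bsub>A\<^esub> n) \<otimes>\<^bsub>T\<^esub> (h s \<otimes>\<^bsub>T\<^esub> t')"
    using c by (auto simp: hom_nat_pow)
  have pr: "primeideal P A" and ss': "s \<in> carrier A - P" "s' \<in> carrier A - P"
    using P c by (auto dest: in_basic_open_imp_prime)
  have \<theta>2: "\<theta> (h w \<otimes>\<^bsub>T\<^esub> (h r \<otimes>\<^bsub>T\<^esub> x)) = w \<odot>\<^bsub>B\<^esub> (r \<odot>\<^bsub>B\<^esub> \<theta> x)"
    if "w \<in> carrier A" "r \<in> carrier A" "x \<in> carrier T" for w r x
    using that \<theta>_smult[of w "h r \<otimes>\<^bsub>T\<^esub> x"] \<theta>_smult[of r x] by simp
  have "(s \<otimes>\<^bsub>A\<^esub> s') [^]\<^bsub>A\<^esub> n \<odot>\<^bsub>B\<^esub> (s' \<odot>\<^bsub>B\<^esub> \<theta> t) = (s \<otimes>\<^bsub>A\<^esub> s') [^]\<^bsub>A\<^esub> n \<odot>\<^bsub>B\<^esub> (s \<odot>\<^bsub>B\<^esub> \<theta> t')"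
    using arg_cong[OF n, of \<theta>] c \<theta>2[of "(s \<otimes>\<^bsub>A\<^esub> s') [^]\<^bsub>A\<^esub> n"] by (metis R.m_closed R.nat_pow_closed)
  then show ?thesis
    using R.primeideal_pow_notin[OF pr primeideal_mult_notin[OF pr ss']] c ss' \<theta>_closed
    by (intro B.loc_frac_eqI[OF pr, where u = "(s \<otimes>\<^bsub>A\<^esub> s') [^]\<^bsub>A\<^esub> n"]) auto
qed

text \<open>By uniqueness the defining union is taken over a single class, so any representation
  evaluates it.\<close>

lemma induced_section_eq:
  assumes "local_rep V \<xi> P s t"
  shows "induced_section \<theta> V \<xi> P = loc_frac A B P (\<theta> t) s"
proof -
  have "P \<in> V" using assms unfolding local_rep_def by auto
  moreover have "{loc_frac A B P (\<theta> t') s' | s' t'. local_rep V \<xi> P s' t'} = {loc_frac A B P (\<theta> t) s}"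
    using assms local_rep_unique by blast
  ultimately show ?thesis unfolding induced_section_def by simp
qed

lemma local_rep_exists:
  assumes "openin (zariski A) V" "P \<in> V" "\<xi> \<in> assoc_sections T (self_module T) (Spec_preimage A T h V)"
  obtains s t where "local_rep V \<xi> P s t"
  using direct_image_section_local[OF assms] unfolding local_rep_def by metis

lemma local_rep_other_point:
  "local_rep V \<xi> P s t \<Longrightarrow> P' \<in> basic_open A s \<Longrightarrow> local_rep V \<xi> P' s t"
  unfolding local_rep_def by blast

lemma induced_section_in_sections:
  assumes V: "openin (zariski A) V"
    and \<xi>: "\<xi> \<in> assoc_sections T (self_module T) (Spec_preimage A T h V)"
  shows "induced_section \<theta> V \<xi> \<in> assoc_sections A B V"
proof (rule B.assoc_sectionsI)
  show "induced_section \<theta> V \<xi> \<in> extensional V" unfolding induced_section_def by simp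
  fix P assume P: "P \<in> V"
  obtain s t where st: "local_rep V \<xi> P s t" using local_rep_exists[OF V P \<xi>] .
  show "\<exists>m f. m \<in> carrier B \<and> f \<in> carrier A \<and> P \<in> basic_open A f \<and> basic_open A f \<subseteq> V \<and>
    (\<forall>Q\<in>basic_open A f. induced_section \<theta> V \<xi> Q = loc_frac A B Q m f)"
    using st induced_section_eq[OF local_rep_other_point[OF st]] \<theta>_closed unfolding local_rep_def
    by (intro exI[of _ "\<theta> t"] exI[of _ s]) auto
qed

lemma local_rep_add:
  assumes "local_rep V \<xi> P s t" "local_rep V \<eta> P s' t'"
  shows "local_rep V (\<lambda>Q\<in>Spec_preimage A T h V. \<xi> Q \<oplus>\<^bsub>loc_ring T Q\<^esub> \<eta> Q) P (s \<otimes>\<^bsub>A\<^esub> s')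
    (h s' \<otimes>\<^bsub>T\<^esub> t \<oplus>\<^bsub>T\<^esub> h s \<otimes>\<^bsub>T\<^esub> t')"
proof -
  note st = assms[unfolded local_rep_def]
  have c: "s \<in> carrier A" "s' \<in> carrier A" "t \<in> carrier T" "t' \<in> carrier T" using st by auto
  have D: "basic_open A (s \<otimes>\<^bsub>A\<^esub> s') = basic_open A s \<inter> basic_open A s'"
    "basic_open T (h (s \<otimes>\<^bsub>A\<^esub> s')) = basic_open T (h s) \<inter> basic_open T (h s')"
    using R.basic_open_mult S.basic_open_mult c by auto
  have sub: "basic_open T (h s) \<subseteq> Spec_preimage A T h V"
    using basic_open_subset_Spec_preimage st by blast
  have "(\<lambda>Q\<in>Spec_preimage A T h V. \<xi> Q \<oplus>\<^bsub>loc_ring T Q\<^esub> \<eta> Q) Q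
    = loc_frac T (self_module T) Q (h s' \<otimes>\<^bsub>T\<^esub> t \<oplus>\<^bsub>T\<^esub> h s \<otimes>\<^bsub>T\<^esub> t') (h (s \<otimes>\<^bsub>A\<^esub> s'))"
    if Q: "Q \<in> basic_open T (h (s \<otimes>\<^bsub>A\<^esub> s'))" for Q
  proof -
    have "primeideal Q T" "h s \<in> carrier T - Q" "h s' \<in> carrier T - Q"
      using Q D c by (auto dest: in_basic_open_imp_prime)
    moreover have "Q \<in> Spec_preimage A T h V" using Q D sub by blast
    moreover have "\<xi> Q = loc_frac T (self_module T) Q t (h s)" "\<eta> Q = loc_frac T (self_module T) Q t' (h s')"
      using st Q D by auto
    ultimately show ?thesis using ST.loc_module_add[of Q t t' "h s" "h s'"] c
      by (simp add: loc_ring_add_eq)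
  qed
  then show ?thesis using st c D unfolding local_rep_def by auto
qed

lemma induced_section_add:
  assumes V: "openin (zariski A) V"
    and \<xi>: "\<xi> \<in> assoc_sections T (self_module T) (Spec_preimage A T h V)"
    and \<eta>: "\<eta> \<in> assoc_sections T (self_module T) (Spec_preimage A T h V)"
  shows "induced_section \<theta> V (\<lambda>Q\<in>Spec_preimage A T h V. \<xi> Q \<oplus>\<^bsub>loc_ring T Q\<^esub> \<eta> Q)
    = (\<lambda>P\<in>V. induced_section \<theta> V \<xi> P \<oplus>\<^bsub>loc_module A B P\<^esub> induced_section \<theta> V \<eta> P)" (is "?l = ?r")
proof
  fix P
  show "?l P = ?r P"
  proof (cases "P \<in> V")
    case True
    obtain s t where st: "local_rep V \<xi> P s t" using local_rep_exists[OF V True \<xi>] .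
    obtain s' t' where st': "local_rep V \<eta> P s' t'" using local_rep_exists[OF V True \<eta>] .
    have c: "s \<in> carrier A" "s' \<in> carrier A" "t \<in> carrier T" "t' \<in> carrier T"
      "primeideal P A" "s \<notin> P" "s' \<notin> P"
      using st st' unfolding local_rep_def by (auto dest: in_basic_open_imp_prime)
    show ?thesis
      using induced_section_eq[OF local_rep_add[OF st st']] induced_section_eq[OF st] induced_section_eq[OF st'] True c
        B.loc_module_add[of P "\<theta> t" "\<theta> t'" s s']
      by (simp add: \<theta>_add \<theta>_smult \<theta>_closed)
  qed (simp add: induced_section_def)
qed

lemma local_rep_smult:
  assumes "local_rep V \<xi> P s t" and c: "c \<in> carrier A" "d \<in> carrier A" and Pd: "P \<in> basic_open A d" "basic_open A d \<subseteq> V"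
    and a: "\<forall>P\<in>basic_open A d. a P = loc_frac A (self_module A) P c d"
  shows "local_rep V (\<lambda>Q\<in>Spec_preimage A T h V. Spec_comorphism A T h V a Q \<otimes>\<^bsub>loc_ring T Q\<^esub> \<xi> Q) P
    (d \<otimes>\<^bsub>A\<^esub> s) (h c \<otimes>\<^bsub>T\<^esub> t)"
proof -
  note st = assms(1)[unfolded local_rep_def]
  have cs: "s \<in> carrier A" "t \<in> carrier T" using st by auto
  have D: "basic_open A (d \<otimes>\<^bsub>A\<^esub> s) = basic_open A d \<inter> basic_open A s"
    "basic_open T (h (d \<otimes>\<^bsub>A\<^esub> s)) = basic_open T (h d) \<inter> basic_open T (h s)"
    using R.basic_open_mult S.basic_open_mult c cs by auto
  have sub: "basic_open T (h s) \<subseteq> Spec_preimage A T h V"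
    using basic_open_subset_Spec_preimage st by blast
  have "(\<lambda>Q\<in>Spec_preimage A T h V. Spec_comorphism A T h V a Q \<otimes>\<^bsub>loc_ring T Q\<^esub> \<xi> Q) Q
    = loc_frac T (self_module T) Q (h c \<otimes>\<^bsub>T\<^esub> t) (h (d \<otimes>\<^bsub>A\<^esub> s))"
    if Q: "Q \<in> basic_open T (h (d \<otimes>\<^bsub>A\<^esub> s))" for Q
  proof -
    have pr: "primeideal Q T" "h s \<in> carrier T - Q" "h d \<in> carrier T - Q"
      using Q D c cs by (auto dest: in_basic_open_imp_prime)
    moreover have QV: "Q \<in> Spec_preimage A T h V" using Q D sub by blast
    moreover have "\<xi> Q = loc_frac T (self_module T) Q t (h s)"
      using st Q D by auto
    moreover have "Spec_comorphism A T h V a Q = loc_frac T (self_module T) Q (h c) (h d)"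
    proof (rule Spec_comorphism_frac[OF QV c(1)])
      have "Spec_map A h Q \<in> basic_open A d"
        using Q D Spec_preimage_basic_open[OF c(2)] unfolding Spec_preimage_def by blast
      then show "a (Spec_map A h Q) = loc_frac A (self_module A) (Spec_map A h Q) c d" using a by blast
      show "d \<in> carrier A - Spec_map A h Q" using pr c unfolding Spec_map_def by auto
    qed
    ultimately show ?thesis using ST.loc_module_smult[of Q "h c" "h d" t "h s"] c cs
      by (simp add: loc_ring_mult_eq)
  qed
  then show ?thesis using st c cs D Pd unfolding local_rep_def by auto
qed

lemma induced_section_smult:
  assumes V: "openin (zariski A) V"
    and \<xi>: "\<xi> \<in> assoc_sections T (self_module T) (Spec_preimage A T h V)"
    and a: "a \<in> assoc_sections A (self_module A) V"
  shows "induced_section \<theta> V (\<lambda>Q\<in>Spec_preimage A T h V. Spec_comorphism A T h V a Q \<otimes>\<^bsub>loc_ring T Q\<^esub> \<xi> Q)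
    = (\<lambda>P\<in>V. a P \<odot>\<^bsub>loc_module A B P\<^esub> induced_section \<theta> V \<xi> P)" (is "?l = ?r")
proof
  fix P
  show "?l P = ?r P"
  proof (cases "P \<in> V")
    case True
    obtain s t where st: "local_rep V \<xi> P s t" using local_rep_exists[OF V True \<xi>] .
    obtain c d where "c \<in> carrier (self_module A)" and d: "d \<in> carrier A" "P \<in> basic_open A d"
      "basic_open A d \<subseteq> V" and acd: "\<forall>Q\<in>basic_open A d. a Q = loc_frac A (self_module A) Q c d"
      using SA.assoc_sections_basicE[OF a True] .
    then have c: "c \<in> carrier A" by simp
    have cs: "s \<in> carrier A" "t \<in> carrier T" "primeideal P A" "s \<notin> P" "d \<notin> P"
      using st d unfolding local_rep_def by (auto dest: in_basic_open_imp_prime)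
    have "?l P = loc_frac A B P (c \<odot>\<^bsub>B\<^esub> \<theta> t) (d \<otimes>\<^bsub>A\<^esub> s)"
      using induced_section_eq[OF local_rep_smult[OF st c d acd]] c cs by (simp add: \<theta>_smult)
    moreover have "a P = loc_frac A (self_module A) P c d" using acd d by blast
    ultimately show ?thesis
      using induced_section_eq[OF st] True c cs d(1) B.loc_module_smult[of P c d "\<theta> t" s]
      by (simp add: \<theta>_closed)
  qed (simp add: induced_section_def)
qed

lemma induced_section_restrict:
  assumes V: "openin (zariski A) V" "openin (zariski A) W" "W \<subseteq> V"
    and \<xi>: "\<xi> \<in> assoc_sections T (self_module T) (Spec_preimage A T h V)"
    and rW: "restrict \<xi> (Spec_preimage A T h W) \<in> assoc_sections T (self_module T) (Spec_preimage A T h W)"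
  shows "induced_section \<theta> W (restrict \<xi> (Spec_preimage A T h W)) = restrict (induced_section \<theta> V \<xi>) W"
    (is "?l = ?r")
proof
  fix P
  show "?l P = ?r P"
  proof (cases "P \<in> W")
    case True
    obtain s t where st: "local_rep W (restrict \<xi> (Spec_preimage A T h W)) P s t"
      using local_rep_exists[OF V(2) True rW] .
    have "local_rep V \<xi> P s t"
      using st V(3) basic_open_subset_Spec_preimage unfolding local_rep_def
      by (auto simp: restrict_def subset_iff)
    then show ?thesis using induced_section_eq[OF st] induced_section_eq True by simp
  qed (simp add: induced_section_def)
qed

text \<open>A global section t / 1 is represented with denominator 1 at every point. The induced
  morphism therefore remembers \<theta> on global sections, which later gives injectivity.\<close>

lemma induced_section_global_frac:
  assumes "t \<in> carrier T"
  shows "induced_section \<theta> (Spec A) (global_frac T t) = assoc_global A B (\<theta> t)"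
proof
  fix P
  show "induced_section \<theta> (Spec A) (global_frac T t) P = assoc_global A B (\<theta> t) P"
  proof (cases "P \<in> Spec A")
    case True
    have "local_rep (Spec A) (global_frac T t) P \<one>\<^bsub>A\<^esub> t"
      unfolding local_rep_def using assms True
      by (auto simp: R.basic_open_one S.basic_open_one global_frac_def)
    then show ?thesis using induced_section_eq True by (simp add: assoc_global_def)
  qed (simp add: induced_section_def assoc_global_def)
qed

end

end

section \<open>Morphisms from the direct image of the structure sheaf\<close>

lemma direct_image_simps:
  "carrier (sections (direct_image A T h) V) = assoc_sections T (self_module T) (Spec_preimage A T h V)"
  "\<xi> \<oplus>\<^bsub>sections (direct_image A T h) V\<^esub> \<eta> = (\<lambda>Q\<in>Spec_preimage A T h V. \<xi> Q \<oplus>\<^bsub>loc_ring T Q\<^esub> \<eta> Q)"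
  "a \<odot>\<^bsub>sections (direct_image A T h) V\<^esub> \<xi>
    = (\<lambda>Q\<in>Spec_preimage A T h V. Spec_comorphism A T h V a Q \<otimes>\<^bsub>loc_ring T Q\<^esub> \<xi> Q)"
  "restr (direct_image A T h) V W \<xi> = restrict \<xi> (Spec_preimage A T h W)"
  by (simp_all add: direct_image_def structure_sheaf_def ring_along_def)

lemma assoc_sheaf_simps:
  "carrier (sections (assoc_sheaf A B) V) = assoc_sections A B V"
  "\<xi> \<oplus>\<^bsub>sections (assoc_sheaf A B) V\<^esub> \<eta> = (\<lambda>P\<in>V. \<xi> P \<oplus>\<^bsub>loc_module A B P\<^esub> \<eta> P)"
  "a \<odot>\<^bsub>sections (assoc_sheaf A B) V\<^esub> \<xi> = (\<lambda>P\<in>V. a P \<odot>\<^bsub>loc_module A B P\<^esub> \<xi> P)"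
  "restr (assoc_sheaf A B) V W \<xi> = restrict \<xi> W"
  by (simp_all add: assoc_sheaf_def plain_module_def)

lemma structure_sheaf_simps:
  "carrier (sections (structure_sheaf A) V) = assoc_sections A (self_module A) V"
  "restr (structure_sheaf A) V W \<xi> = restrict \<xi> W"
  by (simp_all add: structure_sheaf_def)

lemma ring_along_simps [simp]:
  "carrier (ring_along h T) = carrier T"
  "x \<oplus>\<^bsub>ring_along h T\<^esub> y = x \<oplus>\<^bsub>T\<^esub> y"
  "a \<odot>\<^bsub>ring_along h T\<^esub> y = h a \<otimes>\<^bsub>T\<^esub> y"
  by (simp_all add: ring_along_def)

section \<open>Global functions as a module over the base ring\<close>

context affine_hom
begin

abbreviation global_module where
  "global_module \<equiv> ring_along (\<lambda>a. Spec_comorphism A T h (Spec A) (global_frac A a))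
    (sections (structure_sheaf T) (Spec T))"

lemma bij_betw_global_frac: "bij_betw (global_frac T) (carrier T) (carrier global_module)"
  using ST.bij_betw_assoc_global by (simp add: structure_sheaf_simps global_frac_eq_assoc_global)

lemma global_module_add:
  assumes "t \<in> carrier T" "t' \<in> carrier T"
  shows "global_frac T t \<oplus>\<^bsub>global_module\<^esub> global_frac T t' = global_frac T (t \<oplus>\<^bsub>T\<^esub> t')"
  using ST.assoc_global_add[of t t'] assms
  by (simp add: structure_sheaf_def loc_ring_add_eq global_frac_eq_assoc_global)

lemma global_module_smult:
  assumes "a \<in> carrier A" "t \<in> carrier T"
  shows "a \<odot>\<^bsub>global_module\<^esub> global_frac T t = global_frac T (h a \<otimes>\<^bsub>T\<^esub> t)"
  using ST.assoc_global_smult[of "h a" t] assms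
  by (simp add: structure_sheaf_def loc_ring_mult_eq Spec_comorphism_global_frac)
     (simp add: global_frac_eq_assoc_global)

lemma global_moduleE:
  assumes "\<xi> \<in> carrier global_module"
  obtains t where "t \<in> carrier T" "\<xi> = global_frac T t"
  using assms bij_betw_global_frac unfolding bij_betw_def by blast

lemma closed_operations_ring_along: "closed_operations A (ring_along h T)"
  unfolding closed_operations_def by simp

lemma global_frac_closed: "t \<in> carrier T \<Longrightarrow> global_frac T t \<in> carrier global_module"
  using bij_betw_global_frac unfolding bij_betw_def by blast

lemma closed_operations_global_module: "closed_operations A global_module"
  unfolding closed_operations_def
proof (intro conjI ballI)
  fix \<xi> \<eta> assume "\<xi> \<in> carrier global_module" "\<eta> \<in> carrier global_module"
  then obtain t t' where "t \<in> carrier T" "t' \<in> carrier T" "\<xi> = global_frac T t" "\<eta> = global_frac T t'"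
    by (metis global_moduleE)
  then show "\<xi> \<oplus>\<^bsub>global_module\<^esub> \<eta> \<in> carrier global_module"
    using global_module_add global_frac_closed by (metis S.a_closed)
next
  fix a \<xi> assume a: "a \<in> carrier A" and "\<xi> \<in> carrier global_module"
  then obtain t where "t \<in> carrier T" "\<xi> = global_frac T t"
    by (metis global_moduleE)
  then show "a \<odot>\<^bsub>global_module\<^esub> \<xi> \<in> carrier global_module"
    using global_module_smult[OF a] global_frac_closed a by (metis S.m_closed hom_closed)
qed

lemma global_frac_iso:
  "restrict (global_frac T) (carrier T) \<in> module_iso A (ring_along h T) global_module"
proof -
  have "restrict (global_frac T) (carrier T) \<in> linear_maps A (ring_along h T) global_module"
    using global_module_add global_module_smult global_frac_closed
    by (intro linear_mapsI) (auto simp del: ring_along_simps(2,3) simp: ring_along_simps(2,3)[of h T])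
  moreover have "bij_betw (restrict (global_frac T) (carrier T)) (carrier T) (carrier global_module)"
    using bij_betw_global_frac by (simp add: bij_betw_def inj_on_def)
  ultimately show ?thesis unfolding module_iso_def by simp
qed

end

text \<open>Preimages are found by precomposing with the inverse of \<open>f\<close>, which is
  linear by \<open>module_iso_inverse\<close>; injectivity uses that \<open>f\<close> is
  onto.\<close>

lemma Hom_module_precompose_iso:
  assumes f: "f \<in> module_iso R M N" and M: "closed_operations R M" and K: "module R K" and N: "closed_operations R N"
  shows "(\<lambda>\<phi>\<in>carrier (Hom_module R N K). compose (carrier M) \<phi> f)
    \<in> module_iso R (Hom_module R N K) (Hom_module R M K)"
proof -
  let ?F = "\<lambda>\<phi>\<in>carrier (Hom_module R N K). compose (carrier M) \<phi> f"
  have lin: "f \<in> linear_maps R M N" and bij: "bij_betw f (carrier M) (carrier N)"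
    using f unfolding module_iso_def by auto
  note D = linear_mapsD[OF lin]
  note cl = closed_operations_Hom_module[OF N K, unfolded closed_operations_def]
  have comp: "compose (carrier M) \<phi> f \<in> linear_maps R M K" if "\<phi> \<in> linear_maps R N K" for \<phi>
    using D linear_mapsD[OF that] M by (intro linear_mapsI) (auto simp: compose_def closed_operations_def)
  have "?F \<in> linear_maps R (Hom_module R N K) (Hom_module R M K)"
  proof (rule linear_mapsI)
    fix \<phi> \<psi> assume \<phi>: "\<phi> \<in> carrier (Hom_module R N K)" "\<psi> \<in> carrier (Hom_module R N K)"
    then have "\<phi> \<oplus>\<^bsub>Hom_module R N K\<^esub> \<psi> \<in> linear_maps R N K" using cl by simp
    then show "?F (\<phi> \<oplus>\<^bsub>Hom_module R N K\<^esub> \<psi>) = ?F \<phi> \<oplus>\<^bsub>Hom_module R M K\<^esub> ?F \<psi>"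
      using \<phi> D(2) by (auto simp: compose_def)
  next
    fix a \<phi> assume \<phi>: "a \<in> carrier R" "\<phi> \<in> carrier (Hom_module R N K)"
    then have "a \<odot>\<^bsub>Hom_module R N K\<^esub> \<phi> \<in> linear_maps R N K" using cl by simp
    then show "?F (a \<odot>\<^bsub>Hom_module R N K\<^esub> \<phi>) = a \<odot>\<^bsub>Hom_module R M K\<^esub> ?F \<phi>"
      using \<phi> D(2) by (auto simp: compose_def)
  qed (use comp in auto)
  moreover have "bij_betw ?F (linear_maps R N K) (linear_maps R M K)"
    unfolding bij_betw_def
  proof
    show "inj_on ?F (linear_maps R N K)"
    proof (rule inj_onI)
      fix \<phi> \<psi> assume \<phi>: "\<phi> \<in> linear_maps R N K" "\<psi> \<in> linear_maps R N K" and eq: "?F \<phi> = ?F \<psi>"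
      have "\<phi> y = \<psi> y" if y: "y \<in> carrier N" for y
      proof -
        obtain x where x: "x \<in> carrier M" "y = f x" using bij y unfolding bij_betw_def by blast
        then show ?thesis using fun_cong[OF eq, of x] \<phi> by (simp add: compose_def)
      qed
      then show "\<phi> = \<psi>" using linear_mapsD(1)[OF \<phi>(1)] linear_mapsD(1)[OF \<phi>(2)]
        by (auto intro: extensionalityI)
    qed
    show "?F ` linear_maps R N K = linear_maps R M K"
    proof
      show "linear_maps R M K \<subseteq> ?F ` linear_maps R N K"
      proof
        fix \<psi> assume \<psi>: "\<psi> \<in> linear_maps R M K"
        let ?g = "\<lambda>y\<in>carrier N. inv_into (carrier M) f y"
        have g: "?g \<in> linear_maps R N M"
          using module_iso_inverse[OF f M] unfolding module_iso_def by simp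
        have "compose (carrier N) \<psi> ?g \<in> linear_maps R N K"
          using linear_mapsD[OF g] linear_mapsD[OF \<psi>] N
          by (intro linear_mapsI) (auto simp: compose_def closed_operations_def)
        moreover have "compose (carrier M) (compose (carrier N) \<psi> ?g) f = \<psi>"
        proof (rule extensionalityI[of _ "carrier M"])
          fix x assume x: "x \<in> carrier M"
          then show "compose (carrier M) (compose (carrier N) \<psi> ?g) f x = \<psi> x"
            using D(2) bij by (simp add: compose_def bij_betw_def)
        qed (use linear_mapsD(1)[OF \<psi>] in auto)
        ultimately show "\<psi> \<in> ?F ` linear_maps R N K" by (intro image_eqI) auto
      qed
    qed (use comp in auto)
  qed
  ultimately show ?thesis unfolding module_iso_def by simp
qed

section \<open>Closure of sections under the operations of the sheaves\<close>

context module
begin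

lemma assoc_sections_add:
  assumes \<xi>: "\<xi> \<in> assoc_sections R M U" and \<eta>: "\<eta> \<in> assoc_sections R M U"
  shows "(\<lambda>P\<in>U. \<xi> P \<oplus>\<^bsub>loc_module R M P\<^esub> \<eta> P) \<in> assoc_sections R M U"
proof (rule assoc_sectionsI)
  fix P assume P: "P \<in> U"
  obtain m f where m: "m \<in> carrier M" and f: "f \<in> carrier R" "P \<in> basic_open R f" "basic_open R f \<subseteq> U"
    "\<forall>Q\<in>basic_open R f. \<xi> Q = loc_frac R M Q m f" using assoc_sections_basicE[OF \<xi> P] .
  obtain n g where n: "n \<in> carrier M" and g: "g \<in> carrier R" "P \<in> basic_open R g" "basic_open R g \<subseteq> U"
    "\<forall>Q\<in>basic_open R g. \<eta> Q = loc_frac R M Q n g" using assoc_sections_basicE[OF \<eta> P] .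
  have D: "basic_open R (f \<otimes> g) = basic_open R f \<inter> basic_open R g" using basic_open_mult f g by simp
  have "\<forall>Q\<in>basic_open R (f \<otimes> g). (\<lambda>P\<in>U. \<xi> P \<oplus>\<^bsub>loc_module R M P\<^esub> \<eta> P) Q
      = loc_frac R M Q (g \<odot>\<^bsub>M\<^esub> m \<oplus>\<^bsub>M\<^esub> f \<odot>\<^bsub>M\<^esub> n) (f \<otimes> g)"
  proof
    fix Q assume "Q \<in> basic_open R (f \<otimes> g)"
    then have Q: "Q \<in> basic_open R f" "Q \<in> basic_open R g" "Q \<in> U" using D f(3) by auto
    moreover have "primeideal Q R" "f \<notin> Q" "g \<notin> Q" using Q by (auto dest: in_basic_open_imp_prime)
    ultimately show "(\<lambda>P\<in>U. \<xi> P \<oplus>\<^bsub>loc_module R M P\<^esub> \<eta> P) Q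
      = loc_frac R M Q (g \<odot>\<^bsub>M\<^esub> m \<oplus>\<^bsub>M\<^esub> f \<odot>\<^bsub>M\<^esub> n) (f \<otimes> g)"
      using f(4) g(4) loc_module_add[of Q m n f g] m n f(1) g(1) by simp
  qed
  then show "\<exists>m' f'. m' \<in> carrier M \<and> f' \<in> carrier R \<and> P \<in> basic_open R f' \<and> basic_open R f' \<subseteq> U \<and>
    (\<forall>Q\<in>basic_open R f'. (\<lambda>P\<in>U. \<xi> P \<oplus>\<^bsub>loc_module R M P\<^esub> \<eta> P) Q = loc_frac R M Q m' f')"
    using m n f g D by (intro exI[of _ "g \<odot>\<^bsub>M\<^esub> m \<oplus>\<^bsub>M\<^esub> f \<odot>\<^bsub>M\<^esub> n"] exI[of _ "f \<otimes> g"]) auto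
qed simp

lemma assoc_sections_smult:
  assumes a: "a \<in> assoc_sections R (self_module R) U" and \<eta>: "\<eta> \<in> assoc_sections R M U"
  shows "(\<lambda>P\<in>U. a P \<odot>\<^bsub>loc_module R M P\<^esub> \<eta> P) \<in> assoc_sections R M U"
proof (rule assoc_sectionsI)
  interpret S: module R "self_module R" by (rule module_self_module[OF is_cring])
  fix P assume P: "P \<in> U"
  obtain c f where "c \<in> carrier (self_module R)" and f: "f \<in> carrier R" "P \<in> basic_open R f" "basic_open R f \<subseteq> U"
    "\<forall>Q\<in>basic_open R f. a Q = loc_frac R (self_module R) Q c f" using S.assoc_sections_basicE[OF a P] .
  then have c: "c \<in> carrier R" by simp
  obtain n g where n: "n \<in> carrier M" and g: "g \<in> carrier R" "P \<in> basic_open R g" "basic_open R g \<subseteq> U"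
    "\<forall>Q\<in>basic_open R g. \<eta> Q = loc_frac R M Q n g" using assoc_sections_basicE[OF \<eta> P] .
  have D: "basic_open R (f \<otimes> g) = basic_open R f \<inter> basic_open R g" using basic_open_mult f g by simp
  have "\<forall>Q\<in>basic_open R (f \<otimes> g). (\<lambda>P\<in>U. a P \<odot>\<^bsub>loc_module R M P\<^esub> \<eta> P) Q
      = loc_frac R M Q (c \<odot>\<^bsub>M\<^esub> n) (f \<otimes> g)"
  proof
    fix Q assume "Q \<in> basic_open R (f \<otimes> g)"
    then have Q: "Q \<in> basic_open R f" "Q \<in> basic_open R g" "Q \<in> U" using D f(3) by auto
    moreover have "primeideal Q R" "f \<notin> Q" "g \<notin> Q" using Q by (auto dest: in_basic_open_imp_prime)
    ultimately show "(\<lambda>P\<in>U. a P \<odot>\<^bsub>loc_module R M P\<^esub> \<eta> P) Q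
      = loc_frac R M Q (c \<odot>\<^bsub>M\<^esub> n) (f \<otimes> g)"
      using f(4) g(4) loc_module_smult[of Q c f n g] c n f(1) g(1) by simp
  qed
  then show "\<exists>m' f'. m' \<in> carrier M \<and> f' \<in> carrier R \<and> P \<in> basic_open R f' \<and> basic_open R f' \<subseteq> U \<and>
    (\<forall>Q\<in>basic_open R f'. (\<lambda>P\<in>U. a P \<odot>\<^bsub>loc_module R M P\<^esub> \<eta> P) Q = loc_frac R M Q m' f')"
    using c n f g D by (intro exI[of _ "c \<odot>\<^bsub>M\<^esub> n"] exI[of _ "f \<otimes> g"]) auto
qed simp

end

context affine_hom
begin

text \<open>Scalars act on the direct image through this image, so closure of the direct image under
  scalar multiples rests on it.\<close>

lemma Spec_comorphism_in_sections:
  assumes a: "a \<in> assoc_sections A (self_module A) V"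
  shows "Spec_comorphism A T h V a \<in> assoc_sections T (self_module T) (Spec_preimage A T h V)"
proof (rule ST.assoc_sectionsI)
  fix Q assume Q: "Q \<in> Spec_preimage A T h V"
  then have "Spec_map A h Q \<in> V" unfolding Spec_preimage_def by simp
  then obtain c d where "c \<in> carrier (self_module A)" and d: "d \<in> carrier A" "Spec_map A h Q \<in> basic_open A d"
    "basic_open A d \<subseteq> V" and acd: "\<forall>P\<in>basic_open A d. a P = loc_frac A (self_module A) P c d"
    using SA.assoc_sections_basicE[OF a] by blast
  then have c: "c \<in> carrier A" by simp
  have "Q \<in> basic_open T (h d)"
    using Q d Spec_preimage_basic_open[OF d(1)] unfolding Spec_preimage_def by blast
  moreover have sub: "basic_open T (h d) \<subseteq> Spec_preimage A T h V"
    using basic_open_subset_Spec_preimage d by blast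
  moreover have "\<forall>Q\<in>basic_open T (h d). Spec_comorphism A T h V a Q = loc_frac T (self_module T) Q (h c) (h d)"
  proof
    fix Q assume Q: "Q \<in> basic_open T (h d)"
    then have "Q \<in> Spec_preimage A T h (basic_open A d)" using Spec_preimage_basic_open[OF d(1)] by simp
    then have P: "Spec_map A h Q \<in> basic_open A d" unfolding Spec_preimage_def by simp
    show "Spec_comorphism A T h V a Q = loc_frac T (self_module T) Q (h c) (h d)"
      by (rule Spec_comorphism_frac)
         (use Q sub c d(1) acd P in \<open>auto dest: in_basic_open_imp_prime\<close>)
  qed
  ultimately show "\<exists>m f. m \<in> carrier (self_module T) \<and> f \<in> carrier T \<and> Q \<in> basic_open T f \<and>
    basic_open T f \<subseteq> Spec_preimage A T h V \<and>
    (\<forall>Q\<in>basic_open T f. Spec_comorphism A T h V a Q = loc_frac T (self_module T) Q m f)"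
    using c d(1) by (intro exI[of _ "h c"] exI[of _ "h d"]) auto
qed (simp add: Spec_comorphism_def)

text \<open>Closure under sums, multiples and restriction lets the restricted functions in
  \<open>induced_morphism\<close> be evaluated at the results; off the carrier they are
  \<open>undefined\<close>.\<close>

lemma direct_image_add_closed:
  assumes "\<xi> \<in> carrier (sections (direct_image A T h) V)" "\<eta> \<in> carrier (sections (direct_image A T h) V)"
  shows "\<xi> \<oplus>\<^bsub>sections (direct_image A T h) V\<^esub> \<eta> \<in> carrier (sections (direct_image A T h) V)"
  using assms ST.assoc_sections_add unfolding direct_image_simps loc_ring_add_eq by blast

lemma direct_image_smult_closed:
  assumes "a \<in> carrier (sections (structure_sheaf A) V)" "\<xi> \<in> carrier (sections (direct_image A T h) V)"
  shows "a \<odot>\<^bsub>sections (direct_image A T h) V\<^esub> \<xi> \<in> carrier (sections (direct_image A T h) V)"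
  using assms ST.assoc_sections_smult[OF Spec_comorphism_in_sections]
  unfolding direct_image_simps structure_sheaf_simps loc_ring_mult_eq by blast

text \<open>Continuity of the map of spectra: a subset of \<open>A\<close> lies in the contraction
  of \<open>Q\<close> exactly when its image lies in \<open>Q\<close>.\<close>

lemma openin_Spec_preimage:
  assumes V: "openin (zariski A) V"
  shows "openin (zariski T) (Spec_preimage A T h V)"
proof -
  obtain S where S: "S \<subseteq> carrier A" "V = Spec A - vanishing_set A S"
    using V unfolding openin_zariski by blast
  have "Spec_preimage A T h V = Spec T - vanishing_set T (h ` S)"
    using S Spec_map_prime unfolding Spec_preimage_def vanishing_set_def Spec_def Spec_map_def by auto
  moreover have "h ` S \<subseteq> carrier T" using S(1) by auto
  ultimately show ?thesis unfolding openin_zariski by blast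
qed

lemma direct_image_restr_closed:
  assumes "openin (zariski A) W" "W \<subseteq> V" "\<xi> \<in> carrier (sections (direct_image A T h) V)"
  shows "restrict \<xi> (Spec_preimage A T h W) \<in> carrier (sections (direct_image A T h) W)"
  using assms ST.assoc_sections_restrict[OF _ openin_Spec_preimage Spec_preimage_mono]
  unfolding direct_image_simps by blast

end

section \<open>Global sections of the Hom sheaf\<close>

context affine_hom_module
begin

abbreviation sheaf_hom_global where
  "sheaf_hom_global \<equiv> restrict_scalars (global_frac A)
    (sections (sheaf_Hom (zariski A) (structure_sheaf A) (direct_image A T h) (assoc_sheaf A B)) (Spec A))"

definition induced_morphism ::
  "('t \<Rightarrow> 'b) \<Rightarrow> 'a set set \<Rightarrow> ('t set \<Rightarrow> ('t \<times> 't) set) \<Rightarrow> ('a set \<Rightarrow> ('b \<times> 'a) set)"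
  where "induced_morphism \<theta> = (\<lambda>V\<in>{V. openin (zariski A) V \<and> V \<subseteq> Spec A}.
    \<lambda>\<xi>\<in>carrier (sections (direct_image A T h) V). induced_section \<theta> V \<xi>)"

lemma sheaf_hom_global_simps:
  "carrier sheaf_hom_global
    = sheaf_morphisms (zariski A) (structure_sheaf A) (direct_image A T h) (assoc_sheaf A B) (Spec A)"
  "\<phi> \<oplus>\<^bsub>sheaf_hom_global\<^esub> \<psi> = (\<lambda>V\<in>{V. openin (zariski A) V \<and> V \<subseteq> Spec A}.
    \<lambda>\<xi>\<in>carrier (sections (direct_image A T h) V). \<phi> V \<xi> \<oplus>\<^bsub>sections (assoc_sheaf A B) V\<^esub> \<psi> V \<xi>)"
  "a \<odot>\<^bsub>sheaf_hom_global\<^esub> \<phi> = (\<lambda>V\<in>{V. openin (zariski A) V \<and> V \<subseteq> Spec A}.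
    \<lambda>\<xi>\<in>carrier (sections (direct_image A T h) V).
      restrict (global_frac A a) V \<odot>\<^bsub>sections (assoc_sheaf A B) V\<^esub> \<phi> V \<xi>)"
  by (simp_all add: restrict_scalars_def sheaf_Hom_def plain_module_def structure_sheaf_simps)

context
  fixes \<theta> assumes \<theta>: "\<theta> \<in> linear_maps A (ring_along h T) B"
begin

lemmas \<theta>D = linear_mapsD[OF \<theta>, simplified]

lemma induced_morphism_in_sheaf_morphisms: "induced_morphism \<theta> \<in> carrier sheaf_hom_global"
proof -
  have lin: "(\<lambda>\<xi>\<in>carrier (sections (direct_image A T h) V). induced_section \<theta> V \<xi>)
      \<in> linear_maps (sections (structure_sheaf A) V) (sections (direct_image A T h) V) (sections (assoc_sheaf A B) V)"
    if V: "openin (zariski A) V" for V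
  proof (rule linear_mapsI)
    fix \<xi> \<eta> assume *: "\<xi> \<in> carrier (sections (direct_image A T h) V)" "\<eta> \<in> carrier (sections (direct_image A T h) V)"
    show "(\<lambda>\<xi>\<in>carrier (sections (direct_image A T h) V). induced_section \<theta> V \<xi>) (\<xi> \<oplus>\<^bsub>sections (direct_image A T h) V\<^esub> \<eta>)
      = (\<lambda>\<xi>\<in>carrier (sections (direct_image A T h) V). induced_section \<theta> V \<xi>) \<xi> \<oplus>\<^bsub>sections (assoc_sheaf A B) V\<^esub>
        (\<lambda>\<xi>\<in>carrier (sections (direct_image A T h) V). induced_section \<theta> V \<xi>) \<eta>"
      using * direct_image_add_closed[OF *] induced_section_add[OF \<theta>D(2-4) V, of \<xi> \<eta>]
      by (simp add: direct_image_simps assoc_sheaf_simps)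
  next
    fix a \<xi> assume *: "a \<in> carrier (sections (structure_sheaf A) V)" "\<xi> \<in> carrier (sections (direct_image A T h) V)"
    show "(\<lambda>\<xi>\<in>carrier (sections (direct_image A T h) V). induced_section \<theta> V \<xi>) (a \<odot>\<^bsub>sections (direct_image A T h) V\<^esub> \<xi>)
      = a \<odot>\<^bsub>sections (assoc_sheaf A B) V\<^esub>
        (\<lambda>\<xi>\<in>carrier (sections (direct_image A T h) V). induced_section \<theta> V \<xi>) \<xi>"
      using * direct_image_smult_closed[OF *] induced_section_smult[OF \<theta>D(2-4) V, of \<xi> a]
      by (simp add: direct_image_simps assoc_sheaf_simps structure_sheaf_simps)
  qed (use induced_section_in_sections[OF \<theta>D(2-4) V] in \<open>auto simp: direct_image_simps assoc_sheaf_simps\<close>)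
  have "induced_morphism \<theta> W (restr (direct_image A T h) V W \<xi>) = restr (assoc_sheaf A B) V W (induced_morphism \<theta> V \<xi>)"
    if V: "openin (zariski A) V" "openin (zariski A) W" "W \<subseteq> V" "V \<subseteq> Spec A"
      and \<xi>: "\<xi> \<in> carrier (sections (direct_image A T h) V)" for V W \<xi>
  proof -
    have r: "restrict \<xi> (Spec_preimage A T h W) \<in> carrier (sections (direct_image A T h) W)"
      using direct_image_restr_closed[OF V(2,3) \<xi>] .
    have "W \<subseteq> Spec A" using V by blast
    then show ?thesis
      using V r \<xi> induced_section_restrict[OF \<theta>D(2-4) V(1-3), of \<xi>]
      unfolding induced_morphism_def by (simp add: direct_image_simps assoc_sheaf_simps)
  qed
  with lin show ?thesis
    unfolding sheaf_hom_global_simps sheaf_morphisms_def by (auto simp: induced_morphism_def)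
qed

end

text \<open>Over D(s) the section \<xi> is t / s, so s times \<xi> is the restriction of the global
  section t / 1. Naturality and linearity then force s times the value of \<phi> to be b / 1 at
  \<open>P\<close>. Since s is outside \<open>P\<close>, it can be divided out.\<close>

lemma sheaf_morphism_local:
  assumes \<phi>: "\<phi> \<in> carrier sheaf_hom_global" and V: "openin (zariski A) V" "V \<subseteq> Spec A"
    and \<xi>: "\<xi> \<in> carrier (sections (direct_image A T h) V)"
    and st: "local_rep V \<xi> P s t" and b: "b \<in> carrier B"
    and glob: "\<phi> (Spec A) (global_frac T t) = assoc_global A B b"
  shows "\<phi> V \<xi> P = loc_frac A B P b s"
proof -
  have lin: "\<And>V. openin (zariski A) V \<Longrightarrow> V \<subseteq> Spec A \<Longrightarrow> \<phi> V \<in>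
      linear_maps (sections (structure_sheaf A) V) (sections (direct_image A T h) V) (sections (assoc_sheaf A B) V)"
    and nat: "\<And>V W \<xi>. \<lbrakk>openin (zariski A) V; openin (zariski A) W; W \<subseteq> V; V \<subseteq> Spec A;
      \<xi> \<in> carrier (sections (direct_image A T h) V)\<rbrakk> \<Longrightarrow>
        \<phi> W (restrict \<xi> (Spec_preimage A T h W)) = restrict (\<phi> V \<xi>) W"
    using \<phi> unfolding sheaf_hom_global_simps sheaf_morphisms_def
    by (auto simp: direct_image_simps assoc_sheaf_simps)
  have c: "s \<in> carrier A" "t \<in> carrier T" and P: "P \<in> basic_open A s" and sV: "basic_open A s \<subseteq> V"
    and rep: "\<forall>Q\<in>basic_open T (h s). \<xi> Q = loc_frac T (self_module T) Q t (h s)"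
    using st unfolding local_rep_def by auto
  define W where "W = basic_open A s"
  have W: "openin (zariski A) W" "W \<subseteq> V" "W \<subseteq> Spec A" "Spec_preimage A T h W = basic_open T (h s)"
    using openin_basic_open[OF c(1)] sV V Spec_preimage_basic_open[OF c(1)] unfolding W_def by auto
  have SpecA: "openin (zariski A) (Spec A)" using openin_Spec[OF A_cring] .
  have gt: "global_frac T t \<in> carrier (sections (direct_image A T h) (Spec A))"
    using ST.assoc_global_in_sections[of t] c unfolding direct_image_simps Spec_preimage_Spec global_frac_eq_assoc_global
    by simp
  \<comment> \<open>The scalar s as a function on \<open>W\<close>: linearity over the sections on
    \<open>W\<close>, beyond linearity over \<open>A\<close>, is what is applied.\<close>
  define a where "a = restrict (global_frac A s) W"
  have a: "a \<in> carrier (sections (structure_sheaf A) W)"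
    unfolding a_def structure_sheaf_simps global_frac_eq_assoc_global
    using SA.assoc_sections_restrict[OF SA.assoc_global_in_sections W(1,3)] c by simp
  define \<xi>' where "\<xi>' = restrict \<xi> (Spec_preimage A T h W)"
  have \<xi>': "\<xi>' \<in> carrier (sections (direct_image A T h) W)"
    unfolding \<xi>'_def using direct_image_restr_closed[OF W(1,2) \<xi>] .
  have "a \<odot>\<^bsub>sections (direct_image A T h) W\<^esub> \<xi>' = restrict (global_frac T t) (Spec_preimage A T h W)"
    unfolding direct_image_simps
  proof (rule restrict_ext)
    fix Q assume QW: "Q \<in> Spec_preimage A T h W"
    then have Q: "Q \<in> basic_open T (h s)" using W by simp
    have pr: "primeideal Q T" "h s \<in> carrier T - Q" using in_basic_open_imp_prime[OF Q] c by auto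
    have P: "Spec_map A h Q \<in> W" using QW unfolding Spec_preimage_def by simp
    have com: "Spec_comorphism A T h W a Q = loc_frac T (self_module T) Q (h s) (h \<one>\<^bsub>A\<^esub>)"
      by (rule Spec_comorphism_frac[OF QW c(1)])
         (use P W(3) primeideal_one_notin[OF Spec_map_prime[OF pr(1)]] in \<open>auto simp: a_def global_frac_def\<close>)
    have one: "\<one>\<^bsub>T\<^esub> \<in> carrier T - Q" using primeideal_one_notin[OF pr(1)] by simp
    have "Spec_comorphism A T h W a Q \<otimes>\<^bsub>loc_ring T Q\<^esub> \<xi>' Q
      = loc_frac T (self_module T) Q (h s \<otimes>\<^bsub>T\<^esub> t) (h s)"
      using ST.loc_module_smult[OF pr(1), of "h s" "\<one>\<^bsub>T\<^esub>" t "h s"] com one pr(2) c rep Q QW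
      by (simp add: loc_ring_mult_eq \<xi>'_def)
    also have "\<dots> = loc_frac T (self_module T) Q t \<one>\<^bsub>T\<^esub>"
      using ST.loc_frac_cancel[OF pr(1), of t "\<one>\<^bsub>T\<^esub>" "h s"] pr(2) one c by simp
    finally show "Spec_comorphism A T h W a Q \<otimes>\<^bsub>loc_ring T Q\<^esub> \<xi>' Q = global_frac T t Q"
      using pr(1) by (simp add: global_frac_def Spec_def)
  qed
  then have "\<phi> W (a \<odot>\<^bsub>sections (direct_image A T h) W\<^esub> \<xi>') = restrict (assoc_global A B b) W"
    using nat[OF SpecA W(1,3) _ gt] glob by simp
  moreover have "\<phi> W (a \<odot>\<^bsub>sections (direct_image A T h) W\<^esub> \<xi>') = (\<lambda>P\<in>W. a P \<odot>\<^bsub>loc_module A B P\<^esub> restrict (\<phi> V \<xi>) W P)"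
    using linear_mapsD(4)[OF lin[OF W(1,3)] a \<xi>'] nat[OF V(1) W(1,2) V(2) \<xi>]
    by (simp add: assoc_sheaf_simps \<xi>'_def)
  ultimately have "(\<lambda>P\<in>W. a P \<odot>\<^bsub>loc_module A B P\<^esub> restrict (\<phi> V \<xi>) W P) P = restrict (assoc_global A B b) W P" by simp
  then have eq: "loc_frac A (self_module A) P s \<one>\<^bsub>A\<^esub> \<odot>\<^bsub>loc_module A B P\<^esub> \<phi> V \<xi> P = loc_frac A B P b \<one>\<^bsub>A\<^esub>"
    using P basic_open_subset_Spec[of A s] unfolding a_def W_def by (auto simp: global_frac_def assoc_global_def)
  have pr: "primeideal P A" "s \<in> carrier A - P" using in_basic_open_imp_prime[OF P] c by auto
  have one: "\<one>\<^bsub>A\<^esub> \<in> carrier A - P" using primeideal_one_notin[OF pr(1)] by simp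
  have "\<phi> V \<xi> \<in> assoc_sections A B V"
    using linear_mapsD(2)[OF lin[OF V] \<xi>] by (simp add: assoc_sheaf_simps)
  then have "\<phi> V \<xi> P \<in> carrier (loc_module A B P)"
    using P sV unfolding assoc_sections_def by auto
  \<comment> \<open>The value at \<open>P\<close> is known only as some fraction m / d. From s m / d
    = b / 1 comes a witness for s m and d b, which is the same cross-multiplication as for m / d = b
    / s.\<close>
  then obtain m d where md: "m \<in> carrier B" "d \<in> carrier A - P" "\<phi> V \<xi> P = loc_frac A B P m d"
    by (rule B.loc_module_carrierE)
  have "loc_frac A B P (s \<odot>\<^bsub>B\<^esub> m) d = loc_frac A B P b \<one>\<^bsub>A\<^esub>"
    using eq B.loc_module_smult[OF pr(1) c(1) one md(1,2)] md by simp
  then obtain u where u: "u \<in> carrier A - P" "u \<odot>\<^bsub>B\<^esub> (\<one>\<^bsub>A\<^esub> \<odot>\<^bsub>B\<^esub> (s \<odot>\<^bsub>B\<^esub> m)) = u \<odot>\<^bsub>B\<^esub> (d \<odot>\<^bsub>B\<^esub> b)"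
    using B.loc_frac_eqD[OF pr(1) b one] by blast
  then show ?thesis unfolding md(3)
    using c md b pr by (intro B.loc_frac_eqI[OF pr(1), where u = u]) auto
qed

text \<open>On global sections \<phi> is a map from \<open>T\<close> to the global sections of the
  sheaf associated to \<open>B\<close>, and these are \<open>B\<close> itself; this yields \<theta>.
  At any point of any open set both morphisms are then computed from one local representation, by
  \<open>induced_section_eq\<close> and \<open>sheaf_morphism_local\<close>.\<close>

lemma induced_morphism_surj:
  assumes \<phi>: "\<phi> \<in> carrier sheaf_hom_global"
  shows "\<exists>\<theta>\<in>linear_maps A (ring_along h T) B. induced_morphism \<theta> = \<phi>"
proof -
  have SpecA: "openin (zariski A) (Spec A)" using openin_Spec[OF A_cring] .
  have lin: "\<And>V. openin (zariski A) V \<Longrightarrow> V \<subseteq> Spec A \<Longrightarrow> \<phi> V \<in>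
      linear_maps (sections (structure_sheaf A) V) (sections (direct_image A T h) V) (sections (assoc_sheaf A B) V)"
    and ext: "\<phi> \<in> extensional {V. openin (zariski A) V \<and> V \<subseteq> Spec A}"
    using \<phi> unfolding sheaf_hom_global_simps sheaf_morphisms_def by (auto simp: PiE_def)
  note L = linear_mapsD[OF lin[OF SpecA subset_refl]]
  have gt: "global_frac T t \<in> carrier (sections (direct_image A T h) (Spec A))" if "t \<in> carrier T" for t
    using ST.assoc_global_in_sections[of t] that
    unfolding direct_image_simps Spec_preimage_Spec global_frac_eq_assoc_global by simp
  define \<theta> where "\<theta> = (\<lambda>t\<in>carrier T. inv_into (carrier B) (assoc_global A B) (\<phi> (Spec A) (global_frac T t)))"
  have \<theta>: "\<theta> t \<in> carrier B" "assoc_global A B (\<theta> t) = \<phi> (Spec A) (global_frac T t)" if t: "t \<in> carrier T" for t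
  proof -
    have "\<phi> (Spec A) (global_frac T t) \<in> assoc_global A B ` carrier B"
      using L(2)[OF gt[OF t]] B.bij_betw_assoc_global unfolding bij_betw_def by (simp add: assoc_sheaf_simps)
    then show "\<theta> t \<in> carrier B" "assoc_global A B (\<theta> t) = \<phi> (Spec A) (global_frac T t)"
      unfolding \<theta>_def using t by (auto simp: inv_into_into f_inv_into_f)
  qed
  have inj: "b = b'" if "b \<in> carrier B" "b' \<in> carrier B" "assoc_global A B b = assoc_global A B b'" for b b'
    using that B.bij_betw_assoc_global unfolding bij_betw_def inj_on_def by blast
  have "\<theta> \<in> linear_maps A (ring_along h T) B"
  proof (rule linear_mapsI)
    fix t t' assume "t \<in> carrier (ring_along h T)" "t' \<in> carrier (ring_along h T)"
    then have t: "t \<in> carrier T" "t' \<in> carrier T" by auto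
    have "global_frac T t \<oplus>\<^bsub>sections (direct_image A T h) (Spec A)\<^esub> global_frac T t' = global_frac T (t \<oplus>\<^bsub>T\<^esub> t')"
      using global_module_add[OF t] by (simp add: direct_image_simps Spec_preimage_Spec structure_sheaf_def)
    then have "assoc_global A B (\<theta> (t \<oplus>\<^bsub>T\<^esub> t')) = assoc_global A B (\<theta> t \<oplus>\<^bsub>B\<^esub> \<theta> t')"
      using L(3)[OF gt[OF t(1)] gt[OF t(2)]] \<theta> t B.assoc_global_add[of "\<theta> t" "\<theta> t'"] by (simp add: assoc_sheaf_simps)
    then show "\<theta> (t \<oplus>\<^bsub>ring_along h T\<^esub> t') = \<theta> t \<oplus>\<^bsub>B\<^esub> \<theta> t'"
      using inj \<theta>(1) t by simp
  next
    fix a t assume "a \<in> carrier A" "t \<in> carrier (ring_along h T)"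
    then have t: "a \<in> carrier A" "t \<in> carrier T" by auto
    have a: "global_frac A a \<in> carrier (sections (structure_sheaf A) (Spec A))"
      using SA.assoc_global_in_sections[of a] t by (simp add: structure_sheaf_simps global_frac_eq_assoc_global)
    have "global_frac A a \<odot>\<^bsub>sections (direct_image A T h) (Spec A)\<^esub> global_frac T t = global_frac T (h a \<otimes>\<^bsub>T\<^esub> t)"
      using global_module_smult[OF t] by (simp add: direct_image_simps Spec_preimage_Spec structure_sheaf_def)
    then have "assoc_global A B (\<theta> (h a \<otimes>\<^bsub>T\<^esub> t)) = assoc_global A B (a \<odot>\<^bsub>B\<^esub> \<theta> t)"
      using L(4)[OF a gt[OF t(2)]] \<theta> t B.assoc_global_smult[of a "\<theta> t"] by (simp add: assoc_sheaf_simps)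
    then show "\<theta> (a \<odot>\<^bsub>ring_along h T\<^esub> t) = a \<odot>\<^bsub>B\<^esub> \<theta> t"
      using inj \<theta>(1) t by simp
  qed (use \<theta> in \<open>auto simp: \<theta>_def\<close>)
  moreover have "induced_morphism \<theta> = \<phi>"
  proof (rule extensionalityI[of _ "{V. openin (zariski A) V \<and> V \<subseteq> Spec A}"])
    fix V assume "V \<in> {V. openin (zariski A) V \<and> V \<subseteq> Spec A}"
    then have V: "openin (zariski A) V" "V \<subseteq> Spec A" by auto
    note LV = linear_mapsD[OF lin[OF V]]
    show "induced_morphism \<theta> V = \<phi> V"
    proof (rule extensionalityI[of _ "carrier (sections (direct_image A T h) V)"])
      fix \<xi> assume \<xi>: "\<xi> \<in> carrier (sections (direct_image A T h) V)"
      note TD = linear_mapsD[OF calculation, simplified]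
      have "induced_section \<theta> V \<xi> = \<phi> V \<xi>"
      proof (rule extensionalityI[of _ V])
        fix P assume P: "P \<in> V"
        obtain s t where st: "local_rep V \<xi> P s t"
          using direct_image_section_local[OF V(1) P, of \<xi>] \<xi> unfolding direct_image_simps local_rep_def by metis
        have t: "t \<in> carrier T" using st unfolding local_rep_def by simp
        show "induced_section \<theta> V \<xi> P = \<phi> V \<xi> P"
          using induced_section_eq[OF TD(2-4) st]
            sheaf_morphism_local[OF \<phi> V \<xi> st \<theta>(1)[OF t] \<theta>(2)[OF t, symmetric]] by simp
      next
        show "induced_section \<theta> V \<xi> \<in> extensional V" by (simp add: induced_section_def)
        show "\<phi> V \<xi> \<in> extensional V"
          using LV(2)[OF \<xi>] by (auto simp: assoc_sheaf_simps assoc_sections_def PiE_def)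
      qed
      then show "induced_morphism \<theta> V \<xi> = \<phi> V \<xi>" using V \<xi> by (simp add: induced_morphism_def)
    qed (use V LV(1) in \<open>auto simp: induced_morphism_def\<close>)
  qed (use ext in \<open>auto simp: induced_morphism_def\<close>)
  ultimately show ?thesis by blast
qed

text \<open>A local representation of \<xi> does not mention the linear map, so one choice of s and
  t evaluates all three induced sections.\<close>

lemma induced_morphism_add:
  assumes \<theta>: "\<theta> \<in> linear_maps A (ring_along h T) B" and \<theta>': "\<theta>' \<in> linear_maps A (ring_along h T) B"
  shows "induced_morphism (\<lambda>t\<in>carrier T. \<theta> t \<oplus>\<^bsub>B\<^esub> \<theta>' t)
    = induced_morphism \<theta> \<oplus>\<^bsub>sheaf_hom_global\<^esub> induced_morphism \<theta>'"
proof -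
  define \<theta>'' where "\<theta>'' = (\<lambda>t\<in>carrier T. \<theta> t \<oplus>\<^bsub>B\<^esub> \<theta>' t)"
  have "\<theta>'' \<in> linear_maps A (ring_along h T) B"
    using closed_operations_Hom_module[OF closed_operations_ring_along B.module_axioms] \<theta> \<theta>'
    unfolding closed_operations_def \<theta>''_def by simp
  note D = linear_mapsD[OF this, unfolded ring_along_simps] and D1 = linear_mapsD[OF \<theta>, simplified]
    and D2 = linear_mapsD[OF \<theta>', simplified]
  have "induced_section \<theta>'' V \<xi> = (\<lambda>P\<in>V. induced_section \<theta> V \<xi> P \<oplus>\<^bsub>loc_module A B P\<^esub> induced_section \<theta>' V \<xi> P)"
    if V: "openin (zariski A) V" and \<xi>: "\<xi> \<in> carrier (sections (direct_image A T h) V)" for V \<xi>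
  proof (rule extensionalityI[of _ V])
    fix P assume P: "P \<in> V"
    obtain s t where st: "local_rep V \<xi> P s t"
      using direct_image_section_local[OF V(1) P, of \<xi>] \<xi> unfolding direct_image_simps local_rep_def by metis
    then have c: "s \<in> carrier A" "t \<in> carrier T" "primeideal P A" "s \<notin> P"
      unfolding local_rep_def by (auto dest: in_basic_open_imp_prime)
    \<comment> \<open>The general sum formula yields the denominator s s, although the summands
      already share s; one factor is cancelled afterwards.\<close>
    have "loc_frac A B P (\<theta> t) s \<oplus>\<^bsub>loc_module A B P\<^esub> loc_frac A B P (\<theta>' t) s
      = loc_frac A B P (s \<odot>\<^bsub>B\<^esub> (\<theta> t \<oplus>\<^bsub>B\<^esub> \<theta>' t)) (s \<otimes>\<^bsub>A\<^esub> s)"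
      using B.loc_module_add[of P "\<theta> t" "\<theta>' t" s s] c D1(2) D2(2) by (simp add: B.smult_r_distr)
    also have "\<dots> = loc_frac A B P (\<theta> t \<oplus>\<^bsub>B\<^esub> \<theta>' t) s"
      using c D1(2) D2(2) by (intro B.loc_frac_cancel) auto
    finally show "induced_section \<theta>'' V \<xi> P = (\<lambda>P\<in>V. induced_section \<theta> V \<xi> P \<oplus>\<^bsub>loc_module A B P\<^esub> induced_section \<theta>' V \<xi> P) P"
      using P c induced_section_eq[OF D(2-4) st] fun_cong[OF \<theta>''_def, of t] induced_section_eq[OF D1(2-4) st] induced_section_eq[OF D2(2-4) st]
      by simp
  qed (simp_all add: induced_section_def)
  then show ?thesis
    unfolding sheaf_hom_global_simps induced_morphism_def \<theta>''_def[symmetric]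
    by (intro restrict_ext) (simp add: assoc_sheaf_simps)
qed

lemma induced_morphism_smult:
  assumes \<theta>: "\<theta> \<in> linear_maps A (ring_along h T) B" and a: "a \<in> carrier A"
  shows "induced_morphism (\<lambda>t\<in>carrier T. a \<odot>\<^bsub>B\<^esub> \<theta> t) = a \<odot>\<^bsub>sheaf_hom_global\<^esub> induced_morphism \<theta>"
proof -
  define \<theta>'' where "\<theta>'' = (\<lambda>t\<in>carrier T. a \<odot>\<^bsub>B\<^esub> \<theta> t)"
  have "\<theta>'' \<in> linear_maps A (ring_along h T) B"
    using closed_operations_Hom_module[OF closed_operations_ring_along B.module_axioms] \<theta> a
    unfolding closed_operations_def \<theta>''_def by simp
  note D = linear_mapsD[OF this, unfolded ring_along_simps] and D1 = linear_mapsD[OF \<theta>, simplified]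
  have "induced_section \<theta>'' V \<xi> = (\<lambda>P\<in>V. restrict (global_frac A a) V P \<odot>\<^bsub>loc_module A B P\<^esub> induced_section \<theta> V \<xi> P)"
    if V: "openin (zariski A) V" and \<xi>: "\<xi> \<in> carrier (sections (direct_image A T h) V)" for V \<xi>
  proof (rule extensionalityI[of _ V])
    fix P assume P: "P \<in> V"
    obtain s t where st: "local_rep V \<xi> P s t"
      using direct_image_section_local[OF V(1) P, of \<xi>] \<xi> unfolding direct_image_simps local_rep_def by metis
    then have c: "s \<in> carrier A" "t \<in> carrier T" "primeideal P A" "s \<notin> P"
      unfolding local_rep_def by (auto dest: in_basic_open_imp_prime)
    have "loc_frac A (self_module A) P a \<one>\<^bsub>A\<^esub> \<odot>\<^bsub>loc_module A B P\<^esub> loc_frac A B P (\<theta> t) s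
      = loc_frac A B P (a \<odot>\<^bsub>B\<^esub> \<theta> t) s"
      using B.loc_module_smult[of P a "\<one>\<^bsub>A\<^esub>" "\<theta> t" s] c D1(2) a primeideal_one_notin[OF c(3)] by simp
    then show "induced_section \<theta>'' V \<xi> P
      = (\<lambda>P\<in>V. restrict (global_frac A a) V P \<odot>\<^bsub>loc_module A B P\<^esub> induced_section \<theta> V \<xi> P) P"
      using P c induced_section_eq[OF D(2-4) st] fun_cong[OF \<theta>''_def, of t] induced_section_eq[OF D1(2-4) st]
      by (simp add: global_frac_def Spec_def)
  qed (simp_all add: induced_section_def)
  then show ?thesis
    unfolding sheaf_hom_global_simps induced_morphism_def \<theta>''_def[symmetric]
    by (intro restrict_ext) (simp add: assoc_sheaf_simps)
qed

theorem induced_morphism_iso: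
  "restrict induced_morphism (linear_maps A (ring_along h T) B)
    \<in> module_iso A (Hom_module A (ring_along h T) B) sheaf_hom_global"
proof -
  let ?H = "linear_maps A (ring_along h T) B"
  have cl: "closed_operations A (Hom_module A (ring_along h T) B)"
    by (rule closed_operations_Hom_module[OF closed_operations_ring_along B.module_axioms])
  have "restrict induced_morphism ?H \<in> linear_maps A (Hom_module A (ring_along h T) B) sheaf_hom_global"
    using cl induced_morphism_add induced_morphism_smult induced_morphism_in_sheaf_morphisms
    by (intro linear_mapsI) (auto simp: closed_operations_def)
  moreover have "inj_on (restrict induced_morphism ?H) ?H"
  proof (rule inj_onI)
    fix \<theta> \<theta>' assume \<theta>: "\<theta> \<in> ?H" "\<theta>' \<in> ?H" and eq: "restrict induced_morphism ?H \<theta> = restrict induced_morphism ?H \<theta>'"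
    have "\<theta> t = \<theta>' t" if t: "t \<in> carrier T" for t
    proof -
      have gt: "global_frac T t \<in> carrier (sections (direct_image A T h) (Spec A))"
        using ST.assoc_global_in_sections[of t] t
        unfolding direct_image_simps Spec_preimage_Spec global_frac_eq_assoc_global by simp
      have "induced_section \<theta> (Spec A) (global_frac T t) = induced_section \<theta>' (Spec A) (global_frac T t)"
        using fun_cong[OF fun_cong[OF eq], of "Spec A" "global_frac T t"] \<theta> gt openin_Spec[OF A_cring]
        by (simp add: induced_morphism_def)
      then have "assoc_global A B (\<theta> t) = assoc_global A B (\<theta>' t)"
        using induced_section_global_frac[OF linear_mapsD(2-4)[OF \<theta>(1), simplified] t]
          induced_section_global_frac[OF linear_mapsD(2-4)[OF \<theta>(2), simplified] t] by simp
      then show ?thesis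
        using B.bij_betw_assoc_global linear_mapsD(2)[OF \<theta>(1), simplified, OF t] linear_mapsD(2)[OF \<theta>(2), simplified, OF t]
        unfolding bij_betw_def inj_on_def by blast
    qed
    then show "\<theta> = \<theta>'" using linear_mapsD(1)[OF \<theta>(1)] linear_mapsD(1)[OF \<theta>(2)]
      by (auto intro: extensionalityI)
  qed
  moreover have "restrict induced_morphism ?H ` ?H = carrier sheaf_hom_global"
    using induced_morphism_in_sheaf_morphisms induced_morphism_surj by fastforce
  ultimately show ?thesis unfolding module_iso_def bij_betw_def by simp
qed

end

section \<open>Polynomial rings\<close>

definition monomial_poly :: "('a, 'c) ring_scheme \<Rightarrow> 'a \<Rightarrow> 'x multiset \<Rightarrow> 'x multiset \<Rightarrow> 'a"
  where "monomial_poly R k u = (\<lambda>m. if m = u then k else \<zero>\<^bsub>R\<^esub>)"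

text \<open>Makes the convolution in the product of polynomials a finite sum. A submultiset is the
  multiset of a list of bounded length over a finite alphabet.\<close>

lemma finite_subset_mset: "finite {u. u \<subseteq># m}"
proof -
  have "{u. u \<subseteq># m} \<subseteq> {u. set_mset u \<subseteq> set_mset m \<and> size u \<le> size m}"
    using set_mset_mono size_mset_mono by blast
  also have "\<dots> \<subseteq> mset ` {xs. set xs \<subseteq> set_mset m \<and> length xs \<le> size m}"
  proof
    fix u assume u: "u \<in> {u. set_mset u \<subseteq> set_mset m \<and> size u \<le> size m}"
    obtain xs where "mset xs = u" using ex_mset by blast
    with u show "u \<in> mset ` {xs. set xs \<subseteq> set_mset m \<and> length xs \<le> size m}"
      by (intro image_eqI[of _ _ xs]) auto
  qed
  finally show ?thesis by (rule finite_subset) (simp add: finite_lists_length_le)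
qed

context cring
begin

abbreviation poly_ring where "poly_ring I \<equiv> poly_ring_on R I"

lemma poly_ring_simps:
  "carrier (poly_ring I) = indexed_pset I (carrier R)"
  "(p \<otimes>\<^bsub>poly_ring I\<^esub> q) m = (\<Oplus>u\<in>{u. u \<subseteq># m}. p u \<otimes> q (m - u))"
  "\<one>\<^bsub>poly_ring I\<^esub> = monomial_poly R \<one> {#}"
  "\<zero>\<^bsub>poly_ring I\<^esub> = (\<lambda>_. \<zero>)"
  "p \<oplus>\<^bsub>poly_ring I\<^esub> q = (\<lambda>m. p m \<oplus> q m)"
  by (auto simp: poly_ring_on_def monomial_poly_def indexed_const_def indexed_padd_def fun_eq_iff)

lemma indexed_const_eq_monomial: "indexed_const k = monomial_poly R k {#}"
  by (simp add: indexed_const_def monomial_poly_def)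

lemma monomial_pmult: "indexed_pmult (monomial_poly R k u) i = monomial_poly R k (add_mset i u)"
proof
  fix m
  have "i \<in># m \<and> m - {#i#} = u \<longleftrightarrow> m = add_mset i u" by (auto dest: insert_DiffM)
  then show "indexed_pmult (monomial_poly R k u) i m = monomial_poly R k (add_mset i u) m"
    unfolding indexed_pmult_def monomial_poly_def by auto
qed

lemma indexed_var_eq_monomial: "indexed_var i = monomial_poly R \<one> {#i#}"
  by (simp add: indexed_var_def indexed_const_eq_monomial monomial_pmult)

lemma monomial_in_poly_ring:
  assumes "k \<in> carrier R" "set_mset u \<subseteq> I"
  shows "monomial_poly R k u \<in> carrier (poly_ring I)"
  using assms(2)
proof (induction u)
  case empty
  show ?case using indexed_pset.indexed_const[OF assms(1)]
    by (simp add: poly_ring_simps indexed_const_eq_monomial)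
next
  case (add i u)
  then show ?case using indexed_pset.indexed_pmult[of "monomial_poly R k u" I "carrier R" i]
    by (simp add: poly_ring_simps monomial_pmult)
qed

lemma poly_coeff_closed:
  assumes "p \<in> carrier (poly_ring I)"
  shows "p m \<in> carrier R"
  using indexed_pset_in_carrier[of "carrier R" p I] assms
  unfolding poly_ring_simps carrier_coeff_def by auto

lemma poly_add_closed:
  assumes "p \<in> carrier (poly_ring I)" "q \<in> carrier (poly_ring I)"
  shows "p \<oplus>\<^bsub>poly_ring I\<^esub> q \<in> carrier (poly_ring I)"
  using indexed_pset.indexed_padd[of p I "carrier R" q] assms
  unfolding poly_ring_simps indexed_padd_def by simp

text \<open>\<open>indexed_pset\<close> is generated by constants, sums and multiplication by a
  single variable. Monomials suffice as the base case because multiplication by a variable maps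
  monomials to monomials and distributes over sums.\<close>

lemma poly_ring_induct [consumes 1, case_names monomial add]:
  assumes "p \<in> carrier (poly_ring I)"
    and "\<And>k u. k \<in> carrier R \<Longrightarrow> set_mset u \<subseteq> I \<Longrightarrow> P (monomial_poly R k u)"
    and "\<And>p q. \<lbrakk>p \<in> carrier (poly_ring I); q \<in> carrier (poly_ring I); P p; P q\<rbrakk> \<Longrightarrow> P (p \<oplus>\<^bsub>poly_ring I\<^esub> q)"
  shows "P p"
proof -
  have "p \<in> indexed_pset I (carrier R)" using assms(1) by (simp add: poly_ring_simps)
  \<comment> \<open>The predicate is quantified inside the statement under induction: the step for a
    variable \<open>i\<close> applies the hypothesis to the predicate
    \<open>\<lambda>p. P (indexed_pmult p i)\<close>.\<close>
  then have "\<forall>P. (\<forall>k u. k \<in> carrier R \<longrightarrow> set_mset u \<subseteq> I \<longrightarrow> P (monomial_poly R k u)) \<longrightarrow>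
    (\<forall>p q. p \<in> carrier (poly_ring I) \<longrightarrow> q \<in> carrier (poly_ring I) \<longrightarrow> P p \<longrightarrow> P q \<longrightarrow> P (p \<oplus>\<^bsub>poly_ring I\<^esub> q)) \<longrightarrow> P p"
  proof induction
    case (indexed_const k)
    then show ?case by (simp add: indexed_const_eq_monomial)
  next
    case (indexed_padd p q)
    have eq: "indexed_padd p q = p \<oplus>\<^bsub>poly_ring I\<^esub> q" by (simp add: poly_ring_simps indexed_padd_def)
    show ?case
    proof (intro allI impI)
      fix P assume mon: "\<forall>k u. k \<in> carrier R \<longrightarrow> set_mset u \<subseteq> I \<longrightarrow> P (monomial_poly R k u)"
        and add: "\<forall>p q. p \<in> carrier (poly_ring I) \<longrightarrow> q \<in> carrier (poly_ring I) \<longrightarrow> P p \<longrightarrow> P q \<longrightarrow> P (p \<oplus>\<^bsub>poly_ring I\<^esub> q)"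
      have "P p" "P q" using indexed_padd.IH mon add by auto
      then show "P (indexed_padd p q)"
        unfolding eq using add indexed_padd.hyps by (simp add: poly_ring_simps(1))
    qed
  next
    case (indexed_pmult p i)
    show ?case
    proof (intro allI impI)
      fix P assume mon: "\<forall>k u. k \<in> carrier R \<longrightarrow> set_mset u \<subseteq> I \<longrightarrow> P (monomial_poly R k u)"
        and add: "\<forall>p q. p \<in> carrier (poly_ring I) \<longrightarrow> q \<in> carrier (poly_ring I) \<longrightarrow> P p \<longrightarrow> P q \<longrightarrow> P (p \<oplus>\<^bsub>poly_ring I\<^esub> q)"
      have cl: "indexed_pmult p i \<in> carrier (poly_ring I)" if "p \<in> carrier (poly_ring I)" for p
        using indexed_pset.indexed_pmult[of p I "carrier R" i] that indexed_pmult(2) by (simp add: poly_ring_simps)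
      have dist: "indexed_pmult (p \<oplus>\<^bsub>poly_ring I\<^esub> q) i = indexed_pmult p i \<oplus>\<^bsub>poly_ring I\<^esub> indexed_pmult q i" for p q
        by (auto simp: poly_ring_simps indexed_pmult_def)
      show "P (indexed_pmult p i)"
        by (rule indexed_pmult.IH[rule_format, of "\<lambda>p. P (indexed_pmult p i)"])
           (use mon add cl indexed_pmult(2) in \<open>auto simp: monomial_pmult dist\<close>)
    qed
  qed
  then show ?thesis using assms(2,3) by blast
qed

text \<open>Holds coefficientwise and is established before the other laws of the product: it lets
  \<open>poly_ring_induct\<close> reduce closure, commutativity, associativity and the unit law to
  monomials.\<close>

lemma poly_distr:
  assumes p: "p \<in> carrier (poly_ring I)" and q: "q \<in> carrier (poly_ring I)" and r: "r \<in> carrier (poly_ring I)"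
  shows "(p \<oplus>\<^bsub>poly_ring I\<^esub> q) \<otimes>\<^bsub>poly_ring I\<^esub> r = p \<otimes>\<^bsub>poly_ring I\<^esub> r \<oplus>\<^bsub>poly_ring I\<^esub> q \<otimes>\<^bsub>poly_ring I\<^esub> r"
    "p \<otimes>\<^bsub>poly_ring I\<^esub> (q \<oplus>\<^bsub>poly_ring I\<^esub> r) = p \<otimes>\<^bsub>poly_ring I\<^esub> q \<oplus>\<^bsub>poly_ring I\<^esub> p \<otimes>\<^bsub>poly_ring I\<^esub> r"
  using poly_coeff_closed[OF p] poly_coeff_closed[OF q] poly_coeff_closed[OF r]
  by (simp_all add: fun_eq_iff poly_ring_simps l_distr r_distr finsum_addf)

lemma monomial_mult:
  assumes "a \<in> carrier R" "b \<in> carrier R"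
  shows "monomial_poly R a u \<otimes>\<^bsub>poly_ring I\<^esub> monomial_poly R b v = monomial_poly R (a \<otimes> b) (u + v)"
proof
  fix m
  \<comment> \<open>Only the submultiset w = u can contribute to the convolution.\<close>
  have cong: "(\<Oplus>w\<in>{w. w \<subseteq># m}. monomial_poly R a u w \<otimes> monomial_poly R b v (m - w))
    = (\<Oplus>w\<in>{w. w \<subseteq># m}. if w = u then a \<otimes> monomial_poly R b v (m - w) else \<zero>)"
    using assms by (intro finsum_cong) (auto simp: monomial_poly_def simp_implies_def)
  show "(monomial_poly R a u \<otimes>\<^bsub>poly_ring I\<^esub> monomial_poly R b v) m = monomial_poly R (a \<otimes> b) (u + v) m"
  proof (cases "u \<subseteq># m")
    case True
    have "(\<Oplus>w\<in>{w. w \<subseteq># m}. if w = u then a \<otimes> monomial_poly R b v (m - w) else \<zero>) = a \<otimes> monomial_poly R b v (m - u)"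
      by (rule add.finprod_singleton_swap)
         (use True assms finite_subset_mset in \<open>auto simp: monomial_poly_def\<close>)
    moreover have "m - u = v \<longleftrightarrow> m = u + v" using True by auto
    ultimately show ?thesis using assms unfolding poly_ring_simps cong by (auto simp: monomial_poly_def)
  next
    case False
    then have "(\<Oplus>w\<in>{w. w \<subseteq># m}. if w = u then a \<otimes> monomial_poly R b v (m - w) else \<zero>) = \<zero>"
      by (intro add.finprod_one_eqI) auto
    moreover have "m \<noteq> u + v" using False by auto
    ultimately show ?thesis unfolding poly_ring_simps cong by (simp add: monomial_poly_def)
  qed
qed

lemma poly_mult_closed:
  assumes "p \<in> carrier (poly_ring I)" "q \<in> carrier (poly_ring I)"
  shows "p \<otimes>\<^bsub>poly_ring I\<^esub> q \<in> carrier (poly_ring I)"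
  using assms
proof (induction p rule: poly_ring_induct)
  case (monomial k u)
  from monomial(3) show ?case
  proof (induction q rule: poly_ring_induct)
    case (monomial l v)
    then show ?case using \<open>k \<in> carrier R\<close> \<open>set_mset u \<subseteq> I\<close> monomial_in_poly_ring[of "k \<otimes> l" "u + v" I]
      by (simp add: monomial_mult)
  next
    case (add p q)
    then show ?case using poly_add_closed monomial_in_poly_ring[OF \<open>k \<in> carrier R\<close> \<open>set_mset u \<subseteq> I\<close>]
      by (simp add: poly_distr)
  qed
next
  case (add p p')
  then show ?case using poly_add_closed by (simp add: poly_distr)
qed

lemma poly_mult_comm:
  assumes "p \<in> carrier (poly_ring I)" "q \<in> carrier (poly_ring I)"
  shows "p \<otimes>\<^bsub>poly_ring I\<^esub> q = q \<otimes>\<^bsub>poly_ring I\<^esub> p"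
  using assms
proof (induction p rule: poly_ring_induct)
  case (monomial k u)
  from monomial(3) show ?case
  proof (induction q rule: poly_ring_induct)
    case (monomial l v)
    then show ?case using \<open>k \<in> carrier R\<close> by (simp add: monomial_mult m_comm add.commute)
  next
    case (add p q)
    then show ?case using monomial_in_poly_ring[OF \<open>k \<in> carrier R\<close> \<open>set_mset u \<subseteq> I\<close>]
      by (simp add: poly_distr)
  qed
next
  case (add p p')
  then show ?case by (simp add: poly_distr)
qed

lemma poly_mult_assoc:
  assumes "p \<in> carrier (poly_ring I)" "q \<in> carrier (poly_ring I)" "r \<in> carrier (poly_ring I)"
  shows "(p \<otimes>\<^bsub>poly_ring I\<^esub> q) \<otimes>\<^bsub>poly_ring I\<^esub> r = p \<otimes>\<^bsub>poly_ring I\<^esub> (q \<otimes>\<^bsub>poly_ring I\<^esub> r)"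
  using assms
proof (induction p rule: poly_ring_induct)
  case (monomial k u)
  note ku = monomial(1,2) and r = monomial(4)
  from monomial(3) show ?case
  proof (induction q rule: poly_ring_induct)
    case (monomial l v)
    note lv = monomial
    from r show ?case
    proof (induction r rule: poly_ring_induct)
      case (monomial n w)
      then show ?case using ku lv by (simp add: monomial_mult m_assoc add.assoc)
    next
      case (add p q)
      have "monomial_poly R k u \<in> carrier (poly_ring I)" "monomial_poly R l v \<in> carrier (poly_ring I)"
        using ku lv by (simp_all add: monomial_in_poly_ring)
      then show ?case using add by (simp add: poly_distr poly_mult_closed)
    qed
  next
    case (add p q)
    have k: "monomial_poly R k u \<in> carrier (poly_ring I)" using ku monomial_in_poly_ring by blast
    show ?case using k r add by (simp add: poly_distr poly_mult_closed)
  qed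
next
  case (add p p')
  then show ?case by (simp add: poly_distr poly_mult_closed)
qed

lemma poly_mult_one:
  assumes "p \<in> carrier (poly_ring I)"
  shows "\<one>\<^bsub>poly_ring I\<^esub> \<otimes>\<^bsub>poly_ring I\<^esub> p = p"
  using assms
proof (induction p rule: poly_ring_induct)
  case (monomial k u)
  then show ?case unfolding poly_ring_simps(3) by (simp add: monomial_mult)
next
  case (add p q)
  have "\<one>\<^bsub>poly_ring I\<^esub> \<in> carrier (poly_ring I)"
    using monomial_in_poly_ring[of \<one> "{#}" I] by (simp add: poly_ring_simps(3))
  then show ?case using add by (simp add: poly_distr)
qed

lemma poly_neg_closed:
  assumes "p \<in> carrier (poly_ring I)"
  shows "(\<lambda>m. \<ominus> p m) \<in> carrier (poly_ring I)"
  using assms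
proof (induction p rule: poly_ring_induct)
  case (monomial k u)
  have "(\<lambda>m. \<ominus> monomial_poly R k u m) = monomial_poly R (\<ominus> k) u" by (auto simp: monomial_poly_def)
  then show ?case using monomial monomial_in_poly_ring[of "\<ominus> k" u I] by simp
next
  case (add p q)
  have "(\<lambda>m. \<ominus> (p \<oplus>\<^bsub>poly_ring I\<^esub> q) m) = (\<lambda>m. \<ominus> p m) \<oplus>\<^bsub>poly_ring I\<^esub> (\<lambda>m. \<ominus> q m)"
    using poly_coeff_closed[OF add(1)] poly_coeff_closed[OF add(2)] by (simp add: poly_ring_simps minus_add)
  then show ?case using add poly_add_closed by simp
qed

theorem poly_ring_cring: "cring (poly_ring I)"
proof (rule cringI)
  have z: "\<zero>\<^bsub>poly_ring I\<^esub> \<in> carrier (poly_ring I)"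
  proof -
    have "\<zero>\<^bsub>poly_ring I\<^esub> = monomial_poly R \<zero> {#}" by (auto simp: poly_ring_simps monomial_poly_def)
    then show ?thesis using monomial_in_poly_ring[of \<zero> "{#}" I] by simp
  qed
  show "abelian_group (poly_ring I)"
  proof (rule abelian_groupI)
    fix p assume p: "p \<in> carrier (poly_ring I)"
    show "\<exists>q\<in>carrier (poly_ring I). q \<oplus>\<^bsub>poly_ring I\<^esub> p = \<zero>\<^bsub>poly_ring I\<^esub>"
      using poly_neg_closed[OF p] poly_coeff_closed[OF p]
      by (intro bexI[of _ "\<lambda>m. \<ominus> p m"]) (auto simp: poly_ring_simps l_neg)
    show "\<zero>\<^bsub>poly_ring I\<^esub> \<oplus>\<^bsub>poly_ring I\<^esub> p = p" using poly_coeff_closed[OF p] by (simp add: poly_ring_simps)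
    fix q assume q: "q \<in> carrier (poly_ring I)"
    show "p \<oplus>\<^bsub>poly_ring I\<^esub> q = q \<oplus>\<^bsub>poly_ring I\<^esub> p"
      using poly_coeff_closed[OF p] poly_coeff_closed[OF q] by (simp add: poly_ring_simps a_comm)
    fix r assume r: "r \<in> carrier (poly_ring I)"
    show "p \<oplus>\<^bsub>poly_ring I\<^esub> q \<oplus>\<^bsub>poly_ring I\<^esub> r = p \<oplus>\<^bsub>poly_ring I\<^esub> (q \<oplus>\<^bsub>poly_ring I\<^esub> r)"
      using poly_coeff_closed[OF p] poly_coeff_closed[OF q] poly_coeff_closed[OF r]
      by (simp add: poly_ring_simps a_assoc)
  qed (use z poly_add_closed in auto)
  show "Group.comm_monoid (poly_ring I)"
    using monomial_in_poly_ring[of \<one> "{#}" I] poly_mult_closed poly_mult_assoc poly_mult_one poly_mult_comm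
    by (intro comm_monoidI) (auto simp: poly_ring_simps(3))
  show "(p \<oplus>\<^bsub>poly_ring I\<^esub> q) \<otimes>\<^bsub>poly_ring I\<^esub> r = p \<otimes>\<^bsub>poly_ring I\<^esub> r \<oplus>\<^bsub>poly_ring I\<^esub> q \<otimes>\<^bsub>poly_ring I\<^esub> r"
    if "p \<in> carrier (poly_ring I)" "q \<in> carrier (poly_ring I)" "r \<in> carrier (poly_ring I)" for p q r
    using that by (simp add: poly_distr)
qed

text \<open>Both sides of F (p q) = F p F q are additive in p and in q, so multiplicativity is
  decided on monomials.\<close>

lemma poly_ring_hom_by_monomials:
  assumes S: "cring S"
    and closed: "\<And>p. p \<in> carrier (poly_ring I) \<Longrightarrow> F p \<in> carrier S"
    and add: "\<And>p q. \<lbrakk>p \<in> carrier (poly_ring I); q \<in> carrier (poly_ring I)\<rbrakk> \<Longrightarrow> F (p \<oplus>\<^bsub>poly_ring I\<^esub> q) = F p \<oplus>\<^bsub>S\<^esub> F q"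
    and mult: "\<And>k l u v. \<lbrakk>k \<in> carrier R; l \<in> carrier R; set_mset u \<subseteq> I; set_mset v \<subseteq> I\<rbrakk>
      \<Longrightarrow> F (monomial_poly R (k \<otimes> l) (u + v)) = F (monomial_poly R k u) \<otimes>\<^bsub>S\<^esub> F (monomial_poly R l v)"
    and one: "F (monomial_poly R \<one> {#}) = \<one>\<^bsub>S\<^esub>"
  shows "ring_hom_cring (poly_ring I) S F"
proof -
  interpret P: cring "poly_ring I" by (rule poly_ring_cring)
  interpret S: cring S by fact
  have "F (p \<otimes>\<^bsub>poly_ring I\<^esub> q) = F p \<otimes>\<^bsub>S\<^esub> F q" if "p \<in> carrier (poly_ring I)" "q \<in> carrier (poly_ring I)" for p q
    using that
  proof (induction p rule: poly_ring_induct)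
    case (monomial k u)
    note ku = monomial
    from monomial(3) show ?case
    proof (induction q rule: poly_ring_induct)
      case (monomial l v)
      then show ?case using ku mult by (simp add: monomial_mult)
    next
      case (add p q)
      then show ?case using ku(1,2) monomial_in_poly_ring[of k u I] closed assms(3)
        by (simp add: P.r_distr S.r_distr)
    qed
  next
    case (add p p')
    then show ?case using closed assms(3) by (simp add: P.l_distr S.l_distr)
  qed
  then show ?thesis
    using closed add one
    by (intro ring_hom_cringI ring_hom_memI P.is_cring S.is_cring) (auto simp: poly_ring_simps(3))
qed

end

section \<open>The lattice ideal\<close>

text \<open>The generators over an arbitrary coefficient ring, so that those over the integers and
  those over \<open>A\<close> can be compared.\<close>

definition lattice_relations :: "('a, 'c) ring_scheme \<Rightarrow> ('x, 'e) gorder_scheme \<Rightarrow> ('x multiset \<Rightarrow> 'a) set"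
  where "lattice_relations A L =
    (let P = poly_ring_on A (carrier L); v = ring.indexed_var A in
     {v \<bottom>\<^bsub>L\<^esub>, v \<top>\<^bsub>L\<^esub> \<ominus>\<^bsub>P\<^esub> \<one>\<^bsub>P\<^esub>} \<union>
       {v (x \<sqinter>\<^bsub>L\<^esub> y) \<ominus>\<^bsub>P\<^esub> (v x \<otimes>\<^bsub>P\<^esub> v y) | x y. x \<in> carrier L \<and> y \<in> carrier L} \<union>
       {((v (x \<squnion>\<^bsub>L\<^esub> y) \<ominus>\<^bsub>P\<^esub> v x) \<ominus>\<^bsub>P\<^esub> v y) \<oplus>\<^bsub>P\<^esub> (v x \<otimes>\<^bsub>P\<^esub> v y) | x y.
          x \<in> carrier L \<and> y \<in> carrier L})"

lemma lattice_ideal_int_eq: "lattice_ideal_int L = Idl\<^bsub>poly_ring_on \<Z> (carrier L)\<^esub> (lattice_relations \<Z> L)"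
  by (simp add: lattice_ideal_int_def lattice_relations_def Let_def)

context cring
begin

lemma int_embed_mult: "[(a * b :: int)] \<cdot> \<one> = ([a] \<cdot> \<one>) \<otimes> ([b] \<cdot> \<one>)"
proof -
  have "([a] \<cdot> \<one>) \<otimes> ([b] \<cdot> \<one>) = [a] \<cdot> ([b] \<cdot> \<one>)"
    using add_pow_ldistr_int[of \<one> "[b] \<cdot> \<one>" a] by simp
  also have "\<dots> = [(b * a)] \<cdot> \<one>" using add.int_pow_pow[of \<one> a b] by simp
  finally show ?thesis by (simp add: mult.commute)
qed

lemma int_poly_image_hom:
  "ring_hom_cring (poly_ring_on \<Z> I) (poly_ring I) (int_poly_image R)"
proof -
  interpret P: cring "poly_ring I" by (rule poly_ring_cring)
  have mono: "int_poly_image R (monomial_poly \<Z> k u) = monomial_poly R ([k] \<cdot> \<one>) u" for k u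
    by (auto simp: int_poly_image_def monomial_poly_def fun_eq_iff add_pow_def)
  have add: "int_poly_image R (p \<oplus>\<^bsub>poly_ring_on \<Z> I\<^esub> q) = int_poly_image R p \<oplus>\<^bsub>poly_ring I\<^esub> int_poly_image R q" for p q
    unfolding int_poly_image_def poly_ring_simps cring.poly_ring_simps[OF int_is_cring] by (simp add: fun_eq_iff add.int_pow_mult)
  have closed: "int_poly_image R p \<in> carrier (poly_ring I)" if "p \<in> carrier (poly_ring_on \<Z> I)" for p
    using that
  proof (induction p rule: cring.poly_ring_induct[OF int_is_cring, consumes 1, case_names monomial add])
    case (monomial k u)
    then show ?case by (simp add: mono monomial_in_poly_ring)
  next
    case (add p q)
    then show ?case using \<open>\<And>q p. int_poly_image R (p \<oplus>\<^bsub>poly_ring_on \<Z> I\<^esub> q) = _\<close> by simp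
  qed
  show ?thesis
    by (rule cring.poly_ring_hom_by_monomials[OF int_is_cring P.is_cring closed add])
       (simp_all add: mono int_embed_mult monomial_mult poly_ring_simps(3))
qed

text \<open>Written as images of the set of pairs, the families can be pushed through a homomorphism
  and reindexed by a permutation of the lattice.\<close>

lemma lattice_relations_alt:
  "lattice_relations R L =
    (let P = poly_ring (carrier L) in
     {indexed_var \<bottom>\<^bsub>L\<^esub>, indexed_var \<top>\<^bsub>L\<^esub> \<ominus>\<^bsub>P\<^esub> \<one>\<^bsub>P\<^esub>} \<union>
       (\<lambda>(x, y). indexed_var (x \<sqinter>\<^bsub>L\<^esub> y) \<ominus>\<^bsub>P\<^esub> (indexed_var x \<otimes>\<^bsub>P\<^esub> indexed_var y)) ` (carrier L \<times> carrier L) \<union>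
       (\<lambda>(x, y). ((indexed_var (x \<squnion>\<^bsub>L\<^esub> y) \<ominus>\<^bsub>P\<^esub> indexed_var x) \<ominus>\<^bsub>P\<^esub> indexed_var y)
          \<oplus>\<^bsub>P\<^esub> (indexed_var x \<otimes>\<^bsub>P\<^esub> indexed_var y)) ` (carrier L \<times> carrier L))"
  unfolding lattice_relations_def Let_def by auto

lemma indexed_var_in_poly_ring: "x \<in> I \<Longrightarrow> indexed_var x \<in> carrier (poly_ring I)"
  by (simp add: indexed_var_eq_monomial monomial_in_poly_ring)

text \<open>Change of coefficients and permutation of the variables are treated together. With g the
  identity this gives the passage from the integers to \<open>A\<close>; with equal coefficient
  rings it gives invariance of the relations under the group.\<close>

lemma lattice_relations_hom_image:
  assumes L: "bounded_lattice L" and R': "cring R'"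
    and F: "ring_hom_cring (poly_ring (carrier L)) (poly_ring_on R' (carrier L)) F"
    and g: "bij_betw g (carrier L) (carrier L)" "g \<bottom>\<^bsub>L\<^esub> = \<bottom>\<^bsub>L\<^esub>" "g \<top>\<^bsub>L\<^esub> = \<top>\<^bsub>L\<^esub>"
      "\<And>x y. \<lbrakk>x \<in> carrier L; y \<in> carrier L\<rbrakk> \<Longrightarrow> g (x \<sqinter>\<^bsub>L\<^esub> y) = g x \<sqinter>\<^bsub>L\<^esub> g y"
      "\<And>x y. \<lbrakk>x \<in> carrier L; y \<in> carrier L\<rbrakk> \<Longrightarrow> g (x \<squnion>\<^bsub>L\<^esub> y) = g x \<squnion>\<^bsub>L\<^esub> g y"
    and var: "\<And>x. x \<in> carrier L \<Longrightarrow> F (indexed_var x) = ring.indexed_var R' (g x)"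
  shows "F ` lattice_relations R L = lattice_relations R' L"
proof -
  interpret L: bounded_lattice L by fact
  interpret R': cring R' by fact
  interpret F: ring_hom_cring "poly_ring (carrier L)" "poly_ring_on R' (carrier L)" F by fact
  let ?P = "poly_ring (carrier L)" and ?P' = "poly_ring_on R' (carrier L)"
  let ?C = "carrier L \<times> carrier L"
  have gC: "g ` carrier L = carrier L" using g(1) unfolding bij_betw_def by simp
  then have C: "(\<lambda>(x, y). (g x, g y)) ` ?C = ?C" by (simp add: image_paired_Times)
  have v: "x \<in> carrier L \<Longrightarrow> indexed_var x \<in> carrier ?P" for x by (rule indexed_var_in_poly_ring)
  have i1: "F ` (\<lambda>(x, y). indexed_var (x \<sqinter>\<^bsub>L\<^esub> y) \<ominus>\<^bsub>?P\<^esub> (indexed_var x \<otimes>\<^bsub>?P\<^esub> indexed_var y)) ` ?C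
    = (\<lambda>(x, y). R'.indexed_var (x \<sqinter>\<^bsub>L\<^esub> y) \<ominus>\<^bsub>?P'\<^esub> (R'.indexed_var x \<otimes>\<^bsub>?P'\<^esub> R'.indexed_var y)) ` ?C" (is "_ = ?f ` ?C")
  proof -
    have "F ` (\<lambda>(x, y). indexed_var (x \<sqinter>\<^bsub>L\<^esub> y) \<ominus>\<^bsub>?P\<^esub> (indexed_var x \<otimes>\<^bsub>?P\<^esub> indexed_var y)) ` ?C
      = ?f ` (\<lambda>(x, y). (g x, g y)) ` ?C"
      unfolding image_image by (rule image_cong) (auto simp: a_minus_def v var g(4))
    then show ?thesis unfolding C .
  qed
  have i2: "F ` (\<lambda>(x, y). ((indexed_var (x \<squnion>\<^bsub>L\<^esub> y) \<ominus>\<^bsub>?P\<^esub> indexed_var x) \<ominus>\<^bsub>?P\<^esub> indexed_var y)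
          \<oplus>\<^bsub>?P\<^esub> (indexed_var x \<otimes>\<^bsub>?P\<^esub> indexed_var y)) ` ?C
    = (\<lambda>(x, y). ((R'.indexed_var (x \<squnion>\<^bsub>L\<^esub> y) \<ominus>\<^bsub>?P'\<^esub> R'.indexed_var x) \<ominus>\<^bsub>?P'\<^esub> R'.indexed_var y)
          \<oplus>\<^bsub>?P'\<^esub> (R'.indexed_var x \<otimes>\<^bsub>?P'\<^esub> R'.indexed_var y)) ` ?C" (is "F ` ?h ` _ = ?f ` ?C")
  proof -
    have "F ` ?h ` ?C = ?f ` (\<lambda>(x, y). (g x, g y)) ` ?C"
      unfolding image_image by (rule image_cong) (auto simp: a_minus_def v var g(5))
    then show ?thesis unfolding C .
  qed
  have i0: "F (indexed_var \<bottom>\<^bsub>L\<^esub>) = R'.indexed_var \<bottom>\<^bsub>L\<^esub>"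
    "F (indexed_var \<top>\<^bsub>L\<^esub> \<ominus>\<^bsub>?P\<^esub> \<one>\<^bsub>?P\<^esub>) = R'.indexed_var \<top>\<^bsub>L\<^esub> \<ominus>\<^bsub>?P'\<^esub> \<one>\<^bsub>?P'\<^esub>"
    by (simp_all add: a_minus_def v var g(2,3))
  show ?thesis
    unfolding lattice_relations_alt R'.lattice_relations_alt Let_def image_Un i1 i2 by (simp add: i0)
qed

lemma lattice_relations_closed:
  assumes "bounded_lattice L"
  shows "lattice_relations R L \<subseteq> carrier (poly_ring (carrier L))"
proof -
  interpret L: bounded_lattice L by fact
  interpret P: cring "poly_ring (carrier L)" by (rule poly_ring_cring)
  show ?thesis unfolding lattice_relations_alt Let_def by (auto simp: indexed_var_in_poly_ring)
qed

text \<open>The preimage of the ideal on the right is an ideal that contains the generators.\<close>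

lemma Idl_hom_image_subset:
  assumes F: "ring_hom_cring R S F" and gens: "gens \<subseteq> carrier R"
  shows "F ` (Idl gens) \<subseteq> Idl\<^bsub>S\<^esub> (F ` gens)"
proof -
  interpret F: ring_hom_cring R S F by fact
  have FX: "F ` gens \<subseteq> carrier S" using gens by auto
  have "ideal {r \<in> carrier R. F r \<in> Idl\<^bsub>S\<^esub> (F ` gens)} R"
    using F.ring.ideal_vimage[OF F.S.genideal_ideal[OF FX]] .
  moreover have "gens \<subseteq> {r \<in> carrier R. F r \<in> Idl\<^bsub>S\<^esub> (F ` gens)}"
    using gens F.S.genideal_self[OF FX] by auto
  ultimately have "Idl gens \<subseteq> {r \<in> carrier R. F r \<in> Idl\<^bsub>S\<^esub> (F ` gens)}" by (rule genideal_minimal)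
  then show ?thesis by auto
qed

text \<open>The image of the whole integral ideal contains the relations over \<open>A\<close> and
  lies in the ideal they generate, so both sets generate the same ideal. From here on only the
  relations over \<open>A\<close> are used.\<close>

lemma lattice_ideal_eq:
  assumes L: "bounded_lattice L"
  shows "lattice_ideal R L = Idl\<^bsub>poly_ring (carrier L)\<^esub> (lattice_relations R L)"
proof -
  interpret PZ: cring "poly_ring_on \<Z> (carrier L)" by (rule cring.poly_ring_cring[OF int_is_cring])
  interpret P: cring "poly_ring (carrier L)" by (rule poly_ring_cring)
  interpret F: ring_hom_cring "poly_ring_on \<Z> (carrier L)" "poly_ring (carrier L)" "int_poly_image R"
    by (rule int_poly_image_hom)
  have var: "int_poly_image R (ring.indexed_var \<Z> x) = indexed_var x" for x :: 'x
  proof -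
    have "[(0::int)] \<cdot> \<one> = \<zero>" "[(1::int)] \<cdot> \<one> = \<one>" by (simp_all add: add_pow_def) (simp add: add.int_pow_1 flip: add_pow_def)
    then show ?thesis
      by (simp add: cring.indexed_var_eq_monomial[OF int_is_cring] indexed_var_eq_monomial
          int_poly_image_def monomial_poly_def fun_eq_iff)
  qed
  have img: "int_poly_image R ` lattice_relations \<Z> L = lattice_relations R L"
    by (rule cring.lattice_relations_hom_image[OF int_is_cring L is_cring int_poly_image_hom, where g = "\<lambda>x. x"]) (simp_all add: var bij_betw_def)
  note relZ = cring.lattice_relations_closed[OF int_is_cring L]
  note rel = lattice_relations_closed[OF L]
  have "int_poly_image R ` lattice_ideal_int L \<subseteq> Idl\<^bsub>poly_ring (carrier L)\<^esub> (lattice_relations R L)"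
    using PZ.Idl_hom_image_subset[OF int_poly_image_hom relZ] unfolding img lattice_ideal_int_eq .
  moreover have "lattice_relations R L \<subseteq> int_poly_image R ` lattice_ideal_int L"
    using PZ.genideal_self[OF relZ] unfolding img[symmetric] lattice_ideal_int_eq by (rule image_mono)
  ultimately show ?thesis unfolding lattice_ideal_def
    using P.genideal_minimal[OF P.genideal_ideal[OF rel]] P.subset_Idl_subset
      ideal.Icarr[OF P.genideal_ideal[OF rel]]
    by (meson subset_antisym subset_iff)
qed

end

section \<open>Finite meets and the lattice ring\<close>

context bounded_lattice
begin

lemma le_meet_iff:
  assumes "x \<in> carrier L" "y \<in> carrier L" "z \<in> carrier L"
  shows "z \<sqsubseteq> x \<sqinter> y \<longleftrightarrow> z \<sqsubseteq> x \<and> z \<sqsubseteq> y"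
  using assms meet_le meet_left meet_right by (meson le_trans meet_closed)

lemma join_le_iff:
  assumes "x \<in> carrier L" "y \<in> carrier L" "z \<in> carrier L"
  shows "x \<squnion> y \<sqsubseteq> z \<longleftrightarrow> x \<sqsubseteq> z \<and> y \<sqsubseteq> z"
  using assms join_le join_left join_right by (meson le_trans join_closed)

text \<open>Identities between finite meets become equivalences about lower bounds, which
  simplification with \<open>le_meet_iff\<close> or \<open>le_meet_all_iff\<close> settles. The dual
  rule does the same for joins.\<close>

lemma eq_by_lower_bounds:
  assumes "x \<in> carrier L" "y \<in> carrier L" "\<And>z. z \<in> carrier L \<Longrightarrow> z \<sqsubseteq> x \<longleftrightarrow> z \<sqsubseteq> y"
  shows "x = y"
  using assms by (meson le_antisym le_refl)

lemma eq_by_upper_bounds: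
  assumes "x \<in> carrier L" "y \<in> carrier L" "\<And>z. z \<in> carrier L \<Longrightarrow> x \<sqsubseteq> z \<longleftrightarrow> y \<sqsubseteq> z"
  shows "x = y"
  using assms by (meson le_antisym le_refl)

lemma meet_ac:
  assumes "x \<in> carrier L" "y \<in> carrier L" "z \<in> carrier L"
  shows "(x \<sqinter> y) \<sqinter> z = x \<sqinter> (y \<sqinter> z)" "x \<sqinter> y = y \<sqinter> x" "x \<sqinter> (y \<sqinter> z) = y \<sqinter> (x \<sqinter> z)"
    "x \<sqinter> x = x"
  using assms by (auto intro!: eq_by_lower_bounds simp: le_meet_iff)

lemma top_meet_eq: "x \<in> carrier L \<Longrightarrow> \<top> \<sqinter> x = x" "x \<in> carrier L \<Longrightarrow> x \<sqinter> \<top> = x"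
  by (auto intro!: eq_by_lower_bounds simp: le_meet_iff)

lemma bottom_meet_eq: "x \<in> carrier L \<Longrightarrow> \<bottom> \<sqinter> x = \<bottom>" "x \<in> carrier L \<Longrightarrow> x \<sqinter> \<bottom> = \<bottom>"
  using bottom_meet[of x] meet_ac(2)[of x \<bottom> x] eq_is_equal by auto

lemma bottom_join_eq: "x \<in> carrier L \<Longrightarrow> \<bottom> \<squnion> x = x"
  using bottom_join[of x] eq_is_equal by auto

text \<open>Inserting \<open>\<top>\<close> gives the empty meet the value \<open>\<top>\<close>. It
  occurs both for the empty index set in alternating sums and for constant monomials. Dually,
  \<open>join_all\<close> sends the empty set to \<open>\<bottom>\<close>.\<close>

definition meet_all :: "'a set \<Rightarrow> 'a"
  where "meet_all D = \<Sqinter>(insert \<top> D)"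

definition join_all :: "'a set \<Rightarrow> 'a"
  where "join_all D = \<Squnion>(insert \<bottom> D)"

lemma meet_all_closed [simp]:
  assumes "finite D" "D \<subseteq> carrier L"
  shows "meet_all D \<in> carrier L"
  unfolding meet_all_def using assms by (intro finite_inf_closed) auto

lemma join_all_closed [simp]:
  assumes "finite D" "D \<subseteq> carrier L"
  shows "join_all D \<in> carrier L"
  unfolding join_all_def using assms by (intro finite_sup_closed) auto

lemma le_finite_inf_iff:
  assumes "finite D" "D \<subseteq> carrier L" "D \<noteq> {}" "z \<in> carrier L"
  shows "z \<sqsubseteq> \<Sqinter>D \<longleftrightarrow> (\<forall>y\<in>D. z \<sqsubseteq> y)"
proof -
  have g: "greatest L (\<Sqinter>D) (Lower L D)" using assms by (intro finite_inf_greatest) auto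
  have c: "\<Sqinter>D \<in> carrier L" using assms by (intro finite_inf_closed) auto
  have "\<Sqinter>D \<sqsubseteq> y" if "y \<in> D" for y using g that assms(2) by (meson greatest_Lower_below)
  then have "\<forall>y\<in>D. z \<sqsubseteq> y" if "z \<sqsubseteq> \<Sqinter>D" using that c assms le_trans by (meson subsetD)
  moreover have "z \<sqsubseteq> \<Sqinter>D" if "\<forall>y\<in>D. z \<sqsubseteq> y"
    using g that assms by (intro greatest_le[OF g]) (auto simp: Lower_def)
  ultimately show ?thesis by blast
qed

lemma finite_sup_le_iff:
  assumes "finite D" "D \<subseteq> carrier L" "D \<noteq> {}" "z \<in> carrier L"
  shows "\<Squnion>D \<sqsubseteq> z \<longleftrightarrow> (\<forall>y\<in>D. y \<sqsubseteq> z)"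
proof -
  have g: "least L (\<Squnion>D) (Upper L D)" using assms by (intro finite_sup_least) auto
  have c: "\<Squnion>D \<in> carrier L" using assms by (intro finite_sup_closed) auto
  have "y \<sqsubseteq> \<Squnion>D" if "y \<in> D" for y using g that assms(2) by (meson least_Upper_above)
  then have "\<forall>y\<in>D. y \<sqsubseteq> z" if "\<Squnion>D \<sqsubseteq> z" using that c assms le_trans by (meson subsetD)
  moreover have "\<Squnion>D \<sqsubseteq> z" if "\<forall>y\<in>D. y \<sqsubseteq> z"
    using g that assms by (intro least_le[OF g]) (auto simp: Upper_def)
  ultimately show ?thesis by blast
qed

lemma le_meet_all_iff:
  assumes "finite D" "D \<subseteq> carrier L" "z \<in> carrier L"
  shows "z \<sqsubseteq> meet_all D \<longleftrightarrow> (\<forall>y\<in>D. z \<sqsubseteq> y)"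
  unfolding meet_all_def using assms le_finite_inf_iff[of "insert \<top> D" z] by auto

lemma join_all_le_iff:
  assumes "finite D" "D \<subseteq> carrier L" "z \<in> carrier L"
  shows "join_all D \<sqsubseteq> z \<longleftrightarrow> (\<forall>y\<in>D. y \<sqsubseteq> z)"
  unfolding join_all_def using assms finite_sup_le_iff[of "insert \<bottom> D" z] by auto

lemma meet_all_empty [simp]: "meet_all {} = \<top>"
  by (intro eq_by_lower_bounds) (auto simp: le_meet_all_iff)

lemma meet_all_singleton: "x \<in> carrier L \<Longrightarrow> meet_all {x} = x"
  by (intro eq_by_lower_bounds) (auto simp: le_meet_all_iff)

lemma meet_all_insert:
  assumes "finite D" "D \<subseteq> carrier L" "x \<in> carrier L"
  shows "meet_all (insert x D) = x \<sqinter> meet_all D"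
  using assms by (intro eq_by_lower_bounds) (auto simp: le_meet_all_iff le_meet_iff)

lemma meet_all_nonempty:
  assumes "finite D" "D \<subseteq> carrier L" "D \<noteq> {}"
  shows "\<Sqinter>D = meet_all D"
  using assms by (intro eq_by_lower_bounds) (auto simp: le_meet_all_iff le_finite_inf_iff)

lemma join_all_empty [simp]: "join_all {} = \<bottom>"
  by (intro eq_by_upper_bounds) (auto simp: join_all_le_iff)

lemma join_all_insert:
  assumes "finite D" "D \<subseteq> carrier L" "x \<in> carrier L"
  shows "join_all (insert x D) = join_all D \<squnion> x"
  using assms by (intro eq_by_upper_bounds) (auto simp: join_all_le_iff join_le_iff)

lemma join_all_nonempty:
  assumes "finite D" "D \<subseteq> carrier L" "D \<noteq> {}"
  shows "\<Squnion>D = join_all D"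
  using assms by (intro eq_by_upper_bounds) (auto simp: join_all_le_iff finite_sup_le_iff)

end

section \<open>Generators of the lattice ring\<close>

locale lattice_coefficients = L: bounded_lattice L + A: cring A
  for L :: "('x, 'e) gorder_scheme" and A :: "('a, 'c) ring_scheme"
begin

abbreviation "P \<equiv> poly_ring_on A (carrier L)"
abbreviation "I \<equiv> lattice_ideal A L"
abbreviation "T \<equiv> lattice_ring A L"
abbreviation "h \<equiv> lattice_ring_map A L"

sublocale P: cring P by (rule A.poly_ring_cring)

lemma ideal_I: "ideal I P"
  unfolding A.lattice_ideal_eq[OF L.bounded_lattice_axioms]
  by (rule P.genideal_ideal[OF A.lattice_relations_closed[OF L.bounded_lattice_axioms]])

sublocale I: ideal I P by (rule ideal_I)

sublocale T: cring T
  unfolding lattice_ring_def by (rule I.quotient_is_cring[OF P.is_cring])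

definition cls :: "('x multiset \<Rightarrow> 'a) \<Rightarrow> ('x multiset \<Rightarrow> 'a) set"
  where "cls p = I +>\<^bsub>P\<^esub> p"

sublocale cls: ring_hom_cring P T cls
  unfolding cls_def lattice_ring_def by (rule I.rcos_ring_hom_cring[OF P.is_cring])

lemma T_carrierE:
  assumes "t \<in> carrier T"
  obtains p where "p \<in> carrier P" "t = cls p"
  using assms unfolding lattice_ring_def FactRing_def A_RCOSETS_def' cls_def by auto

lemma cls_eq_iff:
  assumes "p \<in> carrier P" "q \<in> carrier P"
  shows "cls p = cls q \<longleftrightarrow> p \<ominus>\<^bsub>P\<^esub> q \<in> I"
  unfolding cls_def using P.quotient_eq_iff_same_a_r_cos[OF ideal_I assms] by simp

lemma cls_relation: "p \<in> lattice_relations A L \<Longrightarrow> cls p = \<zero>\<^bsub>T\<^esub>"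
proof -
  assume "p \<in> lattice_relations A L"
  then have "p \<in> I"
    unfolding A.lattice_ideal_eq[OF L.bounded_lattice_axioms]
    using P.genideal_self[OF A.lattice_relations_closed[OF L.bounded_lattice_axioms]] by blast
  then show ?thesis unfolding cls_def lattice_ring_def FactRing_def using P.a_rcos_zero[OF ideal_I] by simp
qed

lemma lattice_ring_map_eq: "h a = cls (monomial_poly A a {#})"
  unfolding lattice_ring_map_def cls_def A.indexed_const_eq_monomial ..

sublocale affine_hom A T h
proof -
  have "h \<in> ring_hom A T"
  proof (rule ring_hom_memI)
    fix a b assume ab: "a \<in> carrier A" "b \<in> carrier A"
    have m: "monomial_poly A a {#} \<in> carrier P" "monomial_poly A b {#} \<in> carrier P"
      using ab by (simp_all add: A.monomial_in_poly_ring)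
    have "monomial_poly A (a \<oplus>\<^bsub>A\<^esub> b) {#} = monomial_poly A a {#} \<oplus>\<^bsub>P\<^esub> monomial_poly A b {#}"
      using ab by (auto simp: A.poly_ring_simps monomial_poly_def)
    then show "h (a \<oplus>\<^bsub>A\<^esub> b) = h a \<oplus>\<^bsub>T\<^esub> h b"
      unfolding lattice_ring_map_eq using cls.hom_add[OF m] by simp
    show "h (a \<otimes>\<^bsub>A\<^esub> b) = h a \<otimes>\<^bsub>T\<^esub> h b"
      unfolding lattice_ring_map_eq using cls.hom_mult[OF m] A.monomial_mult[OF ab, of "carrier L" "{#}" "{#}"] by simp
    show "h a \<in> carrier T" unfolding lattice_ring_map_eq using m by simp
  next
    show "h \<one>\<^bsub>A\<^esub> = \<one>\<^bsub>T\<^esub>" unfolding lattice_ring_map_eq A.poly_ring_simps(3)[symmetric, of "carrier L"] by (rule cls.hom_one)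
  qed
  then show "affine_hom A T h"
    by (intro affine_hom.intro ring_hom_cringI A.is_cring T.is_cring)
qed

definition gen :: "'x \<Rightarrow> ('x multiset \<Rightarrow> 'a) set"
  where "gen x = cls (A.indexed_var x)"

lemma gen_closed [simp]: "x \<in> carrier L \<Longrightarrow> gen x \<in> carrier T"
  unfolding gen_def by (simp add: A.indexed_var_in_poly_ring)

lemma gen_bottom: "gen \<bottom>\<^bsub>L\<^esub> = \<zero>\<^bsub>T\<^esub>"
  unfolding gen_def by (rule cls_relation) (simp add: A.lattice_relations_alt Let_def)

lemma gen_top: "gen \<top>\<^bsub>L\<^esub> = \<one>\<^bsub>T\<^esub>"
proof -
  have "cls (A.indexed_var \<top>\<^bsub>L\<^esub> \<ominus>\<^bsub>P\<^esub> \<one>\<^bsub>P\<^esub>) = \<zero>\<^bsub>T\<^esub>"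
    by (rule cls_relation) (simp add: A.lattice_relations_alt Let_def)
  then have "gen \<top>\<^bsub>L\<^esub> \<ominus>\<^bsub>T\<^esub> \<one>\<^bsub>T\<^esub> = \<zero>\<^bsub>T\<^esub>"
    using A.indexed_var_in_poly_ring[of "\<top>\<^bsub>L\<^esub>" "carrier L"] by (simp add: a_minus_def gen_def)
  then show ?thesis using T.r_right_minus_eq[of "gen \<top>\<^bsub>L\<^esub>" "\<one>\<^bsub>T\<^esub>"] by simp
qed

lemma gen_meet:
  assumes "x \<in> carrier L" "y \<in> carrier L"
  shows "gen (x \<sqinter>\<^bsub>L\<^esub> y) = gen x \<otimes>\<^bsub>T\<^esub> gen y"
proof -
  have "cls (A.indexed_var (x \<sqinter>\<^bsub>L\<^esub> y) \<ominus>\<^bsub>P\<^esub> (A.indexed_var x \<otimes>\<^bsub>P\<^esub> A.indexed_var y)) = \<zero>\<^bsub>T\<^esub>"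
    by (rule cls_relation) (use assms in \<open>force simp: A.lattice_relations_alt Let_def\<close>)
  then have "gen (x \<sqinter>\<^bsub>L\<^esub> y) \<ominus>\<^bsub>T\<^esub> gen x \<otimes>\<^bsub>T\<^esub> gen y = \<zero>\<^bsub>T\<^esub>"
    using assms by (simp add: a_minus_def gen_def A.indexed_var_in_poly_ring)
  then show ?thesis using T.r_right_minus_eq[of "gen (x \<sqinter>\<^bsub>L\<^esub> y)" "gen x \<otimes>\<^bsub>T\<^esub> gen y"] assms by simp
qed

lemma gen_join:
  assumes "x \<in> carrier L" "y \<in> carrier L"
  shows "gen (x \<squnion>\<^bsub>L\<^esub> y) \<oplus>\<^bsub>T\<^esub> gen x \<otimes>\<^bsub>T\<^esub> gen y = gen x \<oplus>\<^bsub>T\<^esub> gen y"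
proof -
  have "cls (((A.indexed_var (x \<squnion>\<^bsub>L\<^esub> y) \<ominus>\<^bsub>P\<^esub> A.indexed_var x) \<ominus>\<^bsub>P\<^esub> A.indexed_var y)
          \<oplus>\<^bsub>P\<^esub> (A.indexed_var x \<otimes>\<^bsub>P\<^esub> A.indexed_var y)) = \<zero>\<^bsub>T\<^esub>"
    by (rule cls_relation) (use assms in \<open>force simp: A.lattice_relations_alt Let_def\<close>)
  then have eq: "gen (x \<squnion>\<^bsub>L\<^esub> y) \<ominus>\<^bsub>T\<^esub> gen x \<ominus>\<^bsub>T\<^esub> gen y \<oplus>\<^bsub>T\<^esub> gen x \<otimes>\<^bsub>T\<^esub> gen y = \<zero>\<^bsub>T\<^esub>"
    using assms by (simp add: a_minus_def gen_def A.indexed_var_in_poly_ring)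
  have c: "gen x \<in> carrier T" "gen y \<in> carrier T" "gen (x \<squnion>\<^bsub>L\<^esub> y) \<in> carrier T" using assms by auto
  have "gen (x \<squnion>\<^bsub>L\<^esub> y) \<oplus>\<^bsub>T\<^esub> gen x \<otimes>\<^bsub>T\<^esub> gen y
    = (gen (x \<squnion>\<^bsub>L\<^esub> y) \<ominus>\<^bsub>T\<^esub> gen x \<ominus>\<^bsub>T\<^esub> gen y \<oplus>\<^bsub>T\<^esub> gen x \<otimes>\<^bsub>T\<^esub> gen y) \<oplus>\<^bsub>T\<^esub> (gen x \<oplus>\<^bsub>T\<^esub> gen y)"
    using c by algebra
  then show ?thesis using eq c by simp
qed

abbreviation mset_meet :: "'x multiset \<Rightarrow> 'x"
  where "mset_meet u \<equiv> L.meet_all (set_mset u)"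

text \<open>A product of generators is the class of a meet. Meets are idempotent, so the
  multiplicities of the variables are lost, and \<open>mset_meet\<close> looks only at the
  underlying set.\<close>

lemma cls_monomial:
  assumes k: "k \<in> carrier A" and u: "set_mset u \<subseteq> carrier L"
  shows "cls (monomial_poly A k u) = h k \<otimes>\<^bsub>T\<^esub> gen (mset_meet u)"
  using u
proof (induction u)
  case empty
  then show ?case using k by (simp add: gen_top lattice_ring_map_eq A.monomial_in_poly_ring)
next
  case (add x u)
  then have x: "x \<in> carrier L" and u: "set_mset u \<subseteq> carrier L" by auto
  have "monomial_poly A k (add_mset x u) = monomial_poly A k u \<otimes>\<^bsub>P\<^esub> A.indexed_var x"
    using A.monomial_mult[OF k A.one_closed, of "carrier L" u "{#x#}"] k by (simp add: A.indexed_var_eq_monomial)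
  then have "cls (monomial_poly A k (add_mset x u)) = cls (monomial_poly A k u) \<otimes>\<^bsub>T\<^esub> gen x"
    unfolding gen_def using cls.hom_mult A.monomial_in_poly_ring[OF k u] A.indexed_var_in_poly_ring[OF x] by simp
  also have "\<dots> = h k \<otimes>\<^bsub>T\<^esub> gen (mset_meet u \<sqinter>\<^bsub>L\<^esub> x)"
    using add.IH[OF u] x u k gen_meet[of "mset_meet u" x] by (simp add: T.m_assoc)
  also have "mset_meet u \<sqinter>\<^bsub>L\<^esub> x = mset_meet (add_mset x u)"
    using x u L.meet_all_insert[of "set_mset u" x] L.meet_ac(2)[of x "mset_meet u" x] by simp
  finally show ?case .
qed

lemma lattice_ring_induct [consumes 1, case_names gen add]:
  assumes t: "t \<in> carrier T"
    and "\<And>k x. \<lbrakk>k \<in> carrier A; x \<in> carrier L\<rbrakk> \<Longrightarrow> Q (h k \<otimes>\<^bsub>T\<^esub> gen x)"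
    and "\<And>t t'. \<lbrakk>t \<in> carrier T; t' \<in> carrier T; Q t; Q t'\<rbrakk> \<Longrightarrow> Q (t \<oplus>\<^bsub>T\<^esub> t')"
  shows "Q t"
proof -
  obtain p where p: "p \<in> carrier P" "t = cls p" using T_carrierE[OF t] .
  have "Q (cls p)" using p(1)
  proof (induction p rule: A.poly_ring_induct)
    case (monomial k u)
    then show ?case using assms(2) by (simp add: cls_monomial)
  next
    case (add p q)
    then show ?case using assms(3) by simp
  qed
  then show ?thesis using p by simp
qed

end

section \<open>Measures and valuations\<close>

locale lattice_module = lattice_coefficients L A + B: module A B
  for L :: "('x, 'e) gorder_scheme" and A :: "('a, 'c) ring_scheme" and B :: "('a, 'b, 'd) module_scheme"
begin

sublocale affine_hom_module A T h B ..

lemma uminus_zero_B: "\<ominus>\<^bsub>B\<^esub> \<zero>\<^bsub>B\<^esub> = \<zero>\<^bsub>B\<^esub>"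
  using B.r_neg[of "\<zero>\<^bsub>B\<^esub>"] by simp

lemma finsum_uminus:
  assumes "f \<in> D \<rightarrow> carrier B"
  shows "(\<Oplus>\<^bsub>B\<^esub>i\<in>D. \<ominus>\<^bsub>B\<^esub> f i) = \<ominus>\<^bsub>B\<^esub> (\<Oplus>\<^bsub>B\<^esub>i\<in>D. f i)"
  using assms
proof (induction D rule: infinite_finite_induct)
  case (insert i D)
  then show ?case by (simp add: B.minus_add Pi_iff)
qed (simp_all add: uminus_zero_B)

lemma finsum_int_scale:
  assumes "f \<in> D \<rightarrow> carrier B"
  shows "[(n::int)] \<cdot>\<^bsub>B\<^esub> (\<Oplus>\<^bsub>B\<^esub>i\<in>D. f i) = (\<Oplus>\<^bsub>B\<^esub>i\<in>D. [n] \<cdot>\<^bsub>B\<^esub> f i)"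
  using assms
proof (induction D rule: infinite_finite_induct)
  case (insert i D)
  then show ?case by (simp add: B.add.int_pow_distrib Pi_iff)
qed simp_all

abbreviation sgn_scale :: "nat \<Rightarrow> 'b \<Rightarrow> 'b"
  where "sgn_scale n b \<equiv> [((-1) ^ n :: int)] \<cdot>\<^bsub>B\<^esub> b"

lemma sgn_scale_Suc: "b \<in> carrier B \<Longrightarrow> sgn_scale (Suc n) b = \<ominus>\<^bsub>B\<^esub> sgn_scale n b"
  using B.add.int_pow_neg[of b "(-1) ^ n"] by simp

lemma sgn_scale_0: "b \<in> carrier B \<Longrightarrow> sgn_scale 0 b = b"
  by (simp add: B.add.int_pow_1)

text \<open>Inclusion-exclusion relative to a base element z, with the empty set included. It is
  meant to measure the part of z outside all the elements x j; \<open>alt_sum_valuation\<close>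
  makes this precise.\<close>

definition alt_sum :: "('x \<Rightarrow> 'b) \<Rightarrow> (nat \<Rightarrow> 'x) \<Rightarrow> nat set \<Rightarrow> 'x \<Rightarrow> 'b"
  where "alt_sum \<nu> x J z = (\<Oplus>\<^bsub>B\<^esub>K\<in>Pow J. sgn_scale (card K) (\<nu> (z \<sqinter>\<^bsub>L\<^esub> L.meet_all (x ` K))))"

context
  fixes \<nu> :: "'x \<Rightarrow> 'b"
  assumes \<nu>_closed: "x \<in> carrier L \<Longrightarrow> \<nu> x \<in> carrier B"
begin

lemma alt_sum_term_closed:
  assumes "finite K" "x ` K \<subseteq> carrier L" "z \<in> carrier L"
  shows "\<nu> (z \<sqinter>\<^bsub>L\<^esub> L.meet_all (x ` K)) \<in> carrier B"
  using assms by (intro \<nu>_closed) simp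

lemma alt_sum_closed:
  assumes "finite J" "x ` J \<subseteq> carrier L" "z \<in> carrier L"
  shows "alt_sum \<nu> x J z \<in> carrier B"
  unfolding alt_sum_def
proof (intro B.finsum_closed funcsetI B.add.int_pow_closed alt_sum_term_closed)
  fix K assume "K \<in> Pow J"
  then show "finite K" "x ` K \<subseteq> carrier L" using assms finite_subset by auto
qed (rule assms(3))

lemma alt_sum_empty:
  assumes "z \<in> carrier L"
  shows "alt_sum \<nu> x {} z = \<nu> z"
  unfolding alt_sum_def using assms \<nu>_closed[OF assms]
  by (simp add: L.top_meet_eq sgn_scale_0[simplified])

text \<open>Subsets are split by whether they contain \<open>a\<close>. Those that do carry one more
  sign, and their extra factor \<open>x a\<close> is absorbed into the base element; keeping a base
  element is what makes this recursion possible.\<close>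

lemma alt_sum_insert:
  assumes J: "finite J" "a \<notin> J" and x: "x ` insert a J \<subseteq> carrier L" and z: "z \<in> carrier L"
  shows "alt_sum \<nu> x (insert a J) z = alt_sum \<nu> x J z \<ominus>\<^bsub>B\<^esub> alt_sum \<nu> x J (z \<sqinter>\<^bsub>L\<^esub> x a)"
proof -
  let ?f = "\<lambda>z K. sgn_scale (card K) (\<nu> (z \<sqinter>\<^bsub>L\<^esub> L.meet_all (x ` K)))"
  have xa: "x a \<in> carrier L" using x by auto
  have fin: "finite K" "x ` K \<subseteq> carrier L" if "K \<subseteq> insert a J" for K
  proof -
    show "finite K" using finite_subset[OF that] J(1) by simp
    show "x ` K \<subseteq> carrier L" using that x by blast
  qed
  have cl: "?f z K \<in> carrier B" if "K \<subseteq> insert a J" "z \<in> carrier L" for K z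
    using alt_sum_term_closed[OF fin[OF that(1)] that(2)] by simp
  have inj: "inj_on (insert a) (Pow J)" using J(2) by (auto simp: inj_on_def)
  have "alt_sum \<nu> x (insert a J) z = (\<Oplus>\<^bsub>B\<^esub>K\<in>Pow J. ?f z K) \<oplus>\<^bsub>B\<^esub> (\<Oplus>\<^bsub>B\<^esub>K\<in>insert a ` Pow J. ?f z K)"
    unfolding alt_sum_def Pow_insert
  proof (rule B.finsum_Un_disjoint)
    show "?f z \<in> Pow J \<rightarrow> carrier B" by (rule funcsetI, rule cl) (use z in auto)
    show "?f z \<in> insert a ` Pow J \<rightarrow> carrier B" by (rule funcsetI, rule cl) (use z in auto)
  qed (use J in auto)
  also have "(\<Oplus>\<^bsub>B\<^esub>K\<in>insert a ` Pow J. ?f z K) = (\<Oplus>\<^bsub>B\<^esub>K\<in>Pow J. ?f z (insert a K))"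
  proof (rule B.finsum_reindex[OF _ inj])
    show "?f z \<in> insert a ` Pow J \<rightarrow> carrier B" by (rule funcsetI, rule cl) (use z in auto)
  qed
  also have "\<dots> = (\<Oplus>\<^bsub>B\<^esub>K\<in>Pow J. \<ominus>\<^bsub>B\<^esub> ?f (z \<sqinter>\<^bsub>L\<^esub> x a) K)"
  proof (rule B.finsum_cong')
    fix K assume "K \<in> Pow J"
    then have K: "K \<subseteq> insert a J" "finite K" "a \<notin> K" "x ` K \<subseteq> carrier L" using J fin(1)[of K] x by auto
    have "z \<sqinter>\<^bsub>L\<^esub> L.meet_all (x ` insert a K) = (z \<sqinter>\<^bsub>L\<^esub> x a) \<sqinter>\<^bsub>L\<^esub> L.meet_all (x ` K)"
      using K xa z by (simp add: L.meet_all_insert L.meet_ac(1))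
    then show "?f z (insert a K) = \<ominus>\<^bsub>B\<^esub> ?f (z \<sqinter>\<^bsub>L\<^esub> x a) K"
      using K sgn_scale_Suc[OF alt_sum_term_closed[of K x "z \<sqinter>\<^bsub>L\<^esub> x a"], of "card K"] z xa by simp
  next
    show "(\<lambda>K. \<ominus>\<^bsub>B\<^esub> ?f (z \<sqinter>\<^bsub>L\<^esub> x a) K) \<in> Pow J \<rightarrow> carrier B"
      using cl[of _ "z \<sqinter>\<^bsub>L\<^esub> x a"] z xa by (auto intro!: B.a_inv_closed)
  qed simp
  also have "\<dots> = \<ominus>\<^bsub>B\<^esub> (\<Oplus>\<^bsub>B\<^esub>K\<in>Pow J. ?f (z \<sqinter>\<^bsub>L\<^esub> x a) K)"
    using cl[of _ "z \<sqinter>\<^bsub>L\<^esub> x a"] z xa by (intro finsum_uminus) auto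
  finally show ?thesis unfolding alt_sum_def a_minus_def .
qed

text \<open>The sets of size s for s from 1 to k are together the nonempty subsets. The sign of the
  measure axiom is opposite to the one in \<open>alt_sum\<close>, and the missing empty set accounts
  for \<open>\<nu> \<top>\<close>.\<close>

lemma inclusion_exclusion_sum:
  assumes x: "x \<in> {1..k} \<rightarrow> carrier L"
  shows "(\<Oplus>\<^bsub>B\<^esub>s\<in>{1..k}. sgn_scale (s + 1)
      (\<Oplus>\<^bsub>B\<^esub>J\<in>{J. J \<subseteq> {1..k} \<and> card J = s}. \<nu> (\<Sqinter>\<^bsub>L\<^esub>(x ` J))))
    = \<nu> \<top>\<^bsub>L\<^esub> \<ominus>\<^bsub>B\<^esub> alt_sum \<nu> x {1..k} \<top>\<^bsub>L\<^esub>"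
proof -
  let ?F = "\<lambda>s. {J. J \<subseteq> {1..k} \<and> card J = s}"
  let ?f = "\<lambda>K. sgn_scale (card K) (\<nu> (\<top>\<^bsub>L\<^esub> \<sqinter>\<^bsub>L\<^esub> L.meet_all (x ` K)))"
  have fin: "finite K" "x ` K \<subseteq> carrier L" if "K \<subseteq> {1..k}" for K
  proof -
    show "finite K" using finite_subset[OF that] by simp
    show "x ` K \<subseteq> carrier L" using that x by blast
  qed
  have cl: "?f K \<in> carrier B" if "K \<subseteq> {1..k}" for K
    using alt_sum_term_closed[OF fin[OF that] L.top_closed] by simp
  have sgn_term: "sgn_scale (s + 1) (\<nu> (\<Sqinter>\<^bsub>L\<^esub>(x ` J))) = \<ominus>\<^bsub>B\<^esub> ?f J" and tcl: "\<nu> (\<Sqinter>\<^bsub>L\<^esub>(x ` J)) \<in> carrier B"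
    if s: "s \<in> {1..k}" and J: "J \<in> ?F s" for s J
  proof -
    have "J \<noteq> {}" using s J by auto
    then have m: "\<Sqinter>\<^bsub>L\<^esub>(x ` J) = L.meet_all (x ` J)" using J fin[of J] by (intro L.meet_all_nonempty) auto
    have mc: "L.meet_all (x ` J) \<in> carrier L" using J fin[of J] by simp
    show "\<nu> (\<Sqinter>\<^bsub>L\<^esub>(x ` J)) \<in> carrier B" using \<nu>_closed[OF mc] m by simp
    then show "sgn_scale (s + 1) (\<nu> (\<Sqinter>\<^bsub>L\<^esub>(x ` J))) = \<ominus>\<^bsub>B\<^esub> ?f J"
      using sgn_scale_Suc[of "\<nu> (\<Sqinter>\<^bsub>L\<^esub>(x ` J))" s] J mc unfolding m by (simp add: L.top_meet_eq)
  qed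
  have "(\<Oplus>\<^bsub>B\<^esub>s\<in>{1..k}. sgn_scale (s + 1) (\<Oplus>\<^bsub>B\<^esub>J\<in>?F s. \<nu> (\<Sqinter>\<^bsub>L\<^esub>(x ` J))))
    = (\<Oplus>\<^bsub>B\<^esub>s\<in>{1..k}. \<Oplus>\<^bsub>B\<^esub>J\<in>?F s. \<ominus>\<^bsub>B\<^esub> ?f J)"
  proof (rule B.finsum_cong')
    fix s assume s: "s \<in> {1..k}"
    have "sgn_scale (s + 1) (\<Oplus>\<^bsub>B\<^esub>J\<in>?F s. \<nu> (\<Sqinter>\<^bsub>L\<^esub>(x ` J))) = (\<Oplus>\<^bsub>B\<^esub>J\<in>?F s. sgn_scale (s + 1) (\<nu> (\<Sqinter>\<^bsub>L\<^esub>(x ` J))))"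
      using tcl[OF s] by (intro finsum_int_scale) auto
    also have "\<dots> = (\<Oplus>\<^bsub>B\<^esub>J\<in>?F s. \<ominus>\<^bsub>B\<^esub> ?f J)"
      using sgn_term[OF s] cl by (intro B.finsum_cong') auto
    finally show "sgn_scale (s + 1) (\<Oplus>\<^bsub>B\<^esub>J\<in>?F s. \<nu> (\<Sqinter>\<^bsub>L\<^esub>(x ` J))) = (\<Oplus>\<^bsub>B\<^esub>J\<in>?F s. \<ominus>\<^bsub>B\<^esub> ?f J)" .
  next
    show "(\<lambda>s. \<Oplus>\<^bsub>B\<^esub>J\<in>?F s. \<ominus>\<^bsub>B\<^esub> ?f J) \<in> {1..k} \<rightarrow> carrier B"
      using cl by (auto intro!: B.finsum_closed B.a_inv_closed)
  qed simp
  also have "\<dots> = (\<Oplus>\<^bsub>B\<^esub>J\<in>(\<Union>s\<in>{1..k}. ?F s). \<ominus>\<^bsub>B\<^esub> ?f J)"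
    by (rule B.add.finprod_UN_disjoint[symmetric])
       (use cl in \<open>auto simp: pairwise_def disjnt_def intro!: B.a_inv_closed\<close>)
  also have "(\<Union>s\<in>{1..k}. ?F s) = Pow {1..k} - {{}}"
  proof -
    have "card J \<in> {1..k}" if "J \<subseteq> {1..k}" "J \<noteq> {}" for J
      using that fin(1)[OF that(1)] card_mono[of "{1..k}" J] by (auto simp: Suc_le_eq card_gt_0_iff)
    then show ?thesis by (auto simp del: atLeastAtMost_iff) (auto)
  qed
  also have "(\<Oplus>\<^bsub>B\<^esub>J\<in>Pow {1..k} - {{}}. \<ominus>\<^bsub>B\<^esub> ?f J) = \<ominus>\<^bsub>B\<^esub> (\<Oplus>\<^bsub>B\<^esub>J\<in>Pow {1..k} - {{}}. ?f J)"
    using cl by (intro finsum_uminus) auto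
  finally have 1: "(\<Oplus>\<^bsub>B\<^esub>s\<in>{1..k}. sgn_scale (s + 1) (\<Oplus>\<^bsub>B\<^esub>J\<in>?F s. \<nu> (\<Sqinter>\<^bsub>L\<^esub>(x ` J))))
    = \<ominus>\<^bsub>B\<^esub> (\<Oplus>\<^bsub>B\<^esub>J\<in>Pow {1..k} - {{}}. ?f J)" .
  have "alt_sum \<nu> x {1..k} \<top>\<^bsub>L\<^esub> = (\<Oplus>\<^bsub>B\<^esub>J\<in>insert {} (Pow {1..k} - {{}}). ?f J)"
    unfolding alt_sum_def by (rule arg_cong[where f = "finsum B _"]) auto
  also have "\<dots> = ?f {} \<oplus>\<^bsub>B\<^esub> (\<Oplus>\<^bsub>B\<^esub>J\<in>Pow {1..k} - {{}}. ?f J)"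
  proof (rule B.finsum_insert)
    show "?f {} \<in> carrier B" by (rule cl) simp
    show "?f \<in> Pow {1..k} - {{}} \<rightarrow> carrier B" by (rule funcsetI, rule cl) auto
  qed auto
  also have "?f {} = \<nu> \<top>\<^bsub>L\<^esub>"
    using \<nu>_closed[OF L.top_closed] by (simp add: L.top_meet_eq sgn_scale_0[simplified])
  finally have 2: "alt_sum \<nu> x {1..k} \<top>\<^bsub>L\<^esub> = \<nu> \<top>\<^bsub>L\<^esub> \<oplus>\<^bsub>B\<^esub> (\<Oplus>\<^bsub>B\<^esub>J\<in>Pow {1..k} - {{}}. ?f J)" .
  have c: "\<nu> \<top>\<^bsub>L\<^esub> \<in> carrier B" "(\<Oplus>\<^bsub>B\<^esub>J\<in>Pow {1..k} - {{}}. ?f J) \<in> carrier B"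
    using \<nu>_closed cl by (auto intro!: B.finsum_closed)
  show ?thesis unfolding 1 2 using c by (simp add: a_minus_def B.minus_add B.r_neg1 B.a_assoc[symmetric] B.r_neg)
qed

end

text \<open>At z = \<open>\<top>\<close> the last clause is the usual modular identity. Requiring it
  for every z replaces distributivity, which would rewrite
  \<open>z \<sqinter> (x \<squnion> y)\<close> as a join.\<close>

definition valuation :: "('x \<Rightarrow> 'b) \<Rightarrow> bool"
  where "valuation \<nu> \<longleftrightarrow> (\<forall>x\<in>carrier L. \<nu> x \<in> carrier B) \<and> \<nu> \<bottom>\<^bsub>L\<^esub> = \<zero>\<^bsub>B\<^esub> \<and>
    (\<forall>x\<in>carrier L. \<forall>y\<in>carrier L. \<forall>z\<in>carrier L.
      \<nu> (z \<sqinter>\<^bsub>L\<^esub> (x \<squnion>\<^bsub>L\<^esub> y)) \<oplus>\<^bsub>B\<^esub> \<nu> (z \<sqinter>\<^bsub>L\<^esub> (x \<sqinter>\<^bsub>L\<^esub> y)) = \<nu> (z \<sqinter>\<^bsub>L\<^esub> x) \<oplus>\<^bsub>B\<^esub> \<nu> (z \<sqinter>\<^bsub>L\<^esub> y))"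

text \<open>Induction with z arbitrary, because inserting \<open>a\<close> also calls for the
  hypothesis at the base element z met with \<open>x a\<close>. The resulting four terms are joined
  by the valuation identity for the join so far and \<open>x a\<close>.\<close>

lemma alt_sum_valuation:
  assumes \<nu>: "valuation \<nu>" and J: "finite J" "x ` J \<subseteq> carrier L" and z: "z \<in> carrier L"
  shows "alt_sum \<nu> x J z = \<nu> z \<ominus>\<^bsub>B\<^esub> \<nu> (z \<sqinter>\<^bsub>L\<^esub> L.join_all (x ` J))"
  using J z
proof (induction J arbitrary: z rule: finite_induct)
  case empty
  have "\<nu> z \<in> carrier B" "\<nu> \<bottom>\<^bsub>L\<^esub> = \<zero>\<^bsub>B\<^esub>" using \<nu> empty unfolding valuation_def by auto
  then show ?case using alt_sum_empty[of \<nu> z x] \<nu> empty unfolding valuation_def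
    by (simp add: L.bottom_meet_eq a_minus_def)
next
  case (insert a J)
  have cl: "\<And>x. x \<in> carrier L \<Longrightarrow> \<nu> x \<in> carrier B" using \<nu> unfolding valuation_def by auto
  define j where "j = L.join_all (x ` J)"
  have c: "j \<in> carrier L" "x a \<in> carrier L" "x ` J \<subseteq> carrier L" "z \<in> carrier L"
    using insert unfolding j_def by auto
  have J: "L.join_all (x ` insert a J) = j \<squnion>\<^bsub>L\<^esub> x a"
    unfolding j_def using insert c by (simp add: L.join_all_insert)
  have "alt_sum \<nu> x (insert a J) z = (\<nu> z \<ominus>\<^bsub>B\<^esub> \<nu> (z \<sqinter>\<^bsub>L\<^esub> j)) \<ominus>\<^bsub>B\<^esub> (\<nu> (z \<sqinter>\<^bsub>L\<^esub> x a) \<ominus>\<^bsub>B\<^esub> \<nu> (z \<sqinter>\<^bsub>L\<^esub> x a \<sqinter>\<^bsub>L\<^esub> j))"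
    using alt_sum_insert[where \<nu> = \<nu>, OF cl insert.hyps(1,2) insert.prems(1,2)] insert.IH[OF c(3)] c unfolding j_def by simp
  moreover have "z \<sqinter>\<^bsub>L\<^esub> x a \<sqinter>\<^bsub>L\<^esub> j = z \<sqinter>\<^bsub>L\<^esub> (j \<sqinter>\<^bsub>L\<^esub> x a)"
    using c L.meet_ac(1)[of z "x a" j] L.meet_ac(2)[of j "x a" z] by simp
  moreover have V: "\<nu> (z \<sqinter>\<^bsub>L\<^esub> (j \<squnion>\<^bsub>L\<^esub> x a)) \<oplus>\<^bsub>B\<^esub> \<nu> (z \<sqinter>\<^bsub>L\<^esub> (j \<sqinter>\<^bsub>L\<^esub> x a)) = \<nu> (z \<sqinter>\<^bsub>L\<^esub> j) \<oplus>\<^bsub>B\<^esub> \<nu> (z \<sqinter>\<^bsub>L\<^esub> x a)"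
    using \<nu> c unfolding valuation_def by blast
  \<comment> \<open>The bookkeeping isolated as an identity in an abelian group, with w and s
    standing for the values at the join and at the meet.\<close>
  moreover have "(p \<ominus>\<^bsub>B\<^esub> q) \<ominus>\<^bsub>B\<^esub> (r \<ominus>\<^bsub>B\<^esub> s) = p \<ominus>\<^bsub>B\<^esub> w"
    if "w \<oplus>\<^bsub>B\<^esub> s = q \<oplus>\<^bsub>B\<^esub> r" "p \<in> carrier B" "q \<in> carrier B" "r \<in> carrier B" "s \<in> carrier B" "w \<in> carrier B" for p q r s w
  proof -
    have "(p \<ominus>\<^bsub>B\<^esub> q) \<ominus>\<^bsub>B\<^esub> (r \<ominus>\<^bsub>B\<^esub> s) = p \<ominus>\<^bsub>B\<^esub> (q \<oplus>\<^bsub>B\<^esub> r) \<oplus>\<^bsub>B\<^esub> s" using that(2-6)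
      by (simp add: a_minus_def B.minus_add B.a_ac)
    also have "\<dots> = p \<ominus>\<^bsub>B\<^esub> w"
      unfolding that(1)[symmetric] using that(2-6) by (simp add: a_minus_def B.minus_add B.a_assoc B.l_neg)
    finally show ?thesis .
  qed
  ultimately show ?case unfolding J using c cl by simp
qed

lemma measure_imp_valuation:
  assumes \<nu>: "\<nu> \<in> lattice_measures L B"
  shows "valuation \<nu>"
proof -
  have cl: "\<And>x. x \<in> carrier L \<Longrightarrow> \<nu> x \<in> carrier B" and bot: "\<nu> \<bottom>\<^bsub>L\<^esub> = \<zero>\<^bsub>B\<^esub>"
    using \<nu> unfolding lattice_measures_def by auto
  have IE: "\<nu> (L.join_all (x ` {1..k})) = \<nu> \<top>\<^bsub>L\<^esub> \<ominus>\<^bsub>B\<^esub> alt_sum \<nu> x {1..k} \<top>\<^bsub>L\<^esub>"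
    if k: "k \<ge> 2" and x: "x \<in> {1..k} \<rightarrow> carrier L" for k :: nat and x
  proof -
    have "\<Squnion>\<^bsub>L\<^esub>(x ` {1..k}) = L.join_all (x ` {1..k})" using k x by (intro L.join_all_nonempty) auto
    moreover have "\<nu> (\<Squnion>\<^bsub>L\<^esub>(x ` {1..k})) = (\<Oplus>\<^bsub>B\<^esub>s\<in>{1..k}. sgn_scale (s + 1)
      (\<Oplus>\<^bsub>B\<^esub>J\<in>{J. J \<subseteq> {1..k} \<and> card J = s}. \<nu> (\<Sqinter>\<^bsub>L\<^esub>(x ` J))))"
      using \<nu> k x unfolding lattice_measures_def by blast
    moreover note inclusion_exclusion_sum[where \<nu> = \<nu>, OF cl x]
    ultimately show ?thesis by metis
  qed
  have two: "\<nu> (a \<squnion>\<^bsub>L\<^esub> b) = \<nu> a \<oplus>\<^bsub>B\<^esub> \<nu> b \<ominus>\<^bsub>B\<^esub> \<nu> (b \<sqinter>\<^bsub>L\<^esub> a)"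
    if ab: "a \<in> carrier L" "b \<in> carrier L" for a b
  proof -
    define x where "x = (\<lambda>i::nat. if i = 1 then a else b)"
    have s: "{1..2::nat} = insert 2 (insert 1 {})" by auto
    have "L.join_all (x ` {1..2}) = a \<squnion>\<^bsub>L\<^esub> b"
      unfolding s x_def using ab by (simp add: L.join_all_insert L.bottom_join_eq)
    moreover have "alt_sum \<nu> x {1..2} \<top>\<^bsub>L\<^esub> = (\<nu> \<top>\<^bsub>L\<^esub> \<ominus>\<^bsub>B\<^esub> \<nu> a) \<ominus>\<^bsub>B\<^esub> (\<nu> b \<ominus>\<^bsub>B\<^esub> \<nu> (b \<sqinter>\<^bsub>L\<^esub> a))"
      unfolding s using ab by (simp add: alt_sum_insert[where \<nu> = \<nu>, OF cl] alt_sum_empty[where \<nu> = \<nu>, OF cl] x_def L.top_meet_eq)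
    ultimately have "\<nu> (a \<squnion>\<^bsub>L\<^esub> b) = \<nu> \<top>\<^bsub>L\<^esub> \<ominus>\<^bsub>B\<^esub> ((\<nu> \<top>\<^bsub>L\<^esub> \<ominus>\<^bsub>B\<^esub> \<nu> a) \<ominus>\<^bsub>B\<^esub> (\<nu> b \<ominus>\<^bsub>B\<^esub> \<nu> (b \<sqinter>\<^bsub>L\<^esub> a)))"
      using IE[of 2 x] ab by (simp add: x_def)
    then show ?thesis using cl ab by (simp add: a_minus_def B.minus_add B.a_ac B.r_neg1 B.r_neg2)
  qed
  \<comment> \<open>The summands that do not involve c are those for the pair a, b and give \<nu> (a
    \<squnion> b). The others form \<open>alt_sum\<close> with base element c, which expands to the
    remaining terms.\<close>
  have three: "\<nu> (a \<squnion>\<^bsub>L\<^esub> b \<squnion>\<^bsub>L\<^esub> c) = \<nu> (a \<squnion>\<^bsub>L\<^esub> b) \<oplus>\<^bsub>B\<^esub> (\<nu> c \<ominus>\<^bsub>B\<^esub> \<nu> (c \<sqinter>\<^bsub>L\<^esub> a) \<ominus>\<^bsub>B\<^esub> (\<nu> (c \<sqinter>\<^bsub>L\<^esub> b) \<ominus>\<^bsub>B\<^esub> \<nu> (c \<sqinter>\<^bsub>L\<^esub> b \<sqinter>\<^bsub>L\<^esub> a)))"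
    if abc: "a \<in> carrier L" "b \<in> carrier L" "c \<in> carrier L" for a b c
  proof -
    define x where "x = (\<lambda>i::nat. if i = 1 then a else if i = 2 then b else c)"
    have s: "{1..2::nat} = insert 2 (insert 1 {})" "{1..3::nat} = insert 3 {1..2}" by auto
    have "L.join_all (x ` {1..2}) = a \<squnion>\<^bsub>L\<^esub> b"
      unfolding s x_def using abc by (simp add: L.join_all_insert L.bottom_join_eq)
    then have 2: "\<nu> (a \<squnion>\<^bsub>L\<^esub> b) = \<nu> \<top>\<^bsub>L\<^esub> \<ominus>\<^bsub>B\<^esub> alt_sum \<nu> x {1..2} \<top>\<^bsub>L\<^esub>"
      using IE[of 2 x] abc by (simp add: x_def)
    have "L.join_all (x ` {1..3}) = a \<squnion>\<^bsub>L\<^esub> b \<squnion>\<^bsub>L\<^esub> c"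
      unfolding s x_def using abc by (simp add: L.join_all_insert L.bottom_join_eq)
    then have 3: "\<nu> (a \<squnion>\<^bsub>L\<^esub> b \<squnion>\<^bsub>L\<^esub> c) = \<nu> \<top>\<^bsub>L\<^esub> \<ominus>\<^bsub>B\<^esub> alt_sum \<nu> x {1..3} \<top>\<^bsub>L\<^esub>"
      using IE[of 3 x] abc by (simp add: x_def)
    have x: "x ` {1..3} \<subseteq> carrier L" "x 3 = c" using abc unfolding x_def by auto
    have 4: "alt_sum \<nu> x {1..3} \<top>\<^bsub>L\<^esub> = alt_sum \<nu> x {1..2} \<top>\<^bsub>L\<^esub> \<ominus>\<^bsub>B\<^esub> alt_sum \<nu> x {1..2} c"
      unfolding s(2) using x abc(3) unfolding s(2)
      by (subst alt_sum_insert[where \<nu> = \<nu>, OF cl]) (auto simp: L.top_meet_eq)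
    have 5: "alt_sum \<nu> x {1..2} c = \<nu> c \<ominus>\<^bsub>B\<^esub> \<nu> (c \<sqinter>\<^bsub>L\<^esub> a) \<ominus>\<^bsub>B\<^esub> (\<nu> (c \<sqinter>\<^bsub>L\<^esub> b) \<ominus>\<^bsub>B\<^esub> \<nu> (c \<sqinter>\<^bsub>L\<^esub> b \<sqinter>\<^bsub>L\<^esub> a))"
      unfolding s using abc by (simp add: alt_sum_insert[where \<nu> = \<nu>, OF cl] alt_sum_empty[where \<nu> = \<nu>, OF cl] x_def)
    have "alt_sum \<nu> x {1..2} \<top>\<^bsub>L\<^esub> \<in> carrier B" "alt_sum \<nu> x {1..2} c \<in> carrier B"
      using abc by (auto intro!: alt_sum_closed[where \<nu> = \<nu>, OF cl] simp: x_def)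
    then show ?thesis unfolding 5[symmetric] 3 4 2 using cl[OF L.top_closed]
      by (simp add: a_minus_def B.minus_add B.a_ac)
  qed
  have "\<nu> (z \<sqinter>\<^bsub>L\<^esub> (x \<squnion>\<^bsub>L\<^esub> y)) \<oplus>\<^bsub>B\<^esub> \<nu> (z \<sqinter>\<^bsub>L\<^esub> (x \<sqinter>\<^bsub>L\<^esub> y)) = \<nu> (z \<sqinter>\<^bsub>L\<^esub> x) \<oplus>\<^bsub>B\<^esub> \<nu> (z \<sqinter>\<^bsub>L\<^esub> y)"
    if xyz: "x \<in> carrier L" "y \<in> carrier L" "z \<in> carrier L" for x y z
  proof -
    define p where "p = \<nu> (x \<squnion>\<^bsub>L\<^esub> y)"
    define q where "q = \<nu> (z \<sqinter>\<^bsub>L\<^esub> (x \<squnion>\<^bsub>L\<^esub> y))"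
    have c: "p \<in> carrier B" "q \<in> carrier B" "\<nu> z \<in> carrier B" "\<nu> (z \<sqinter>\<^bsub>L\<^esub> x) \<in> carrier B" "\<nu> (z \<sqinter>\<^bsub>L\<^esub> y) \<in> carrier B"
      "\<nu> (z \<sqinter>\<^bsub>L\<^esub> (x \<sqinter>\<^bsub>L\<^esub> y)) \<in> carrier B"
      using cl xyz unfolding p_def q_def by auto
    have "z \<sqinter>\<^bsub>L\<^esub> y \<sqinter>\<^bsub>L\<^esub> x = z \<sqinter>\<^bsub>L\<^esub> (x \<sqinter>\<^bsub>L\<^esub> y)"
      using xyz L.meet_ac(1)[of z y x] L.meet_ac(2)[of y x z] by simp
    \<comment> \<open>The value at x \<squnion> y \<squnion> z is computed on the left from the pair
      x \<squnion> y, z and on the right from the triple. Cancelling p and \<nu> z isolates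
      q.\<close>
    then have "p \<oplus>\<^bsub>B\<^esub> \<nu> z \<ominus>\<^bsub>B\<^esub> q = p \<oplus>\<^bsub>B\<^esub> (\<nu> z \<ominus>\<^bsub>B\<^esub> \<nu> (z \<sqinter>\<^bsub>L\<^esub> x) \<ominus>\<^bsub>B\<^esub> (\<nu> (z \<sqinter>\<^bsub>L\<^esub> y) \<ominus>\<^bsub>B\<^esub> \<nu> (z \<sqinter>\<^bsub>L\<^esub> (x \<sqinter>\<^bsub>L\<^esub> y))))"
      using two[of "x \<squnion>\<^bsub>L\<^esub> y" z] three[OF xyz] xyz unfolding p_def q_def by simp
    then have "\<nu> z \<ominus>\<^bsub>B\<^esub> q = \<nu> z \<ominus>\<^bsub>B\<^esub> \<nu> (z \<sqinter>\<^bsub>L\<^esub> x) \<ominus>\<^bsub>B\<^esub> (\<nu> (z \<sqinter>\<^bsub>L\<^esub> y) \<ominus>\<^bsub>B\<^esub> \<nu> (z \<sqinter>\<^bsub>L\<^esub> (x \<sqinter>\<^bsub>L\<^esub> y)))"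
      using c by (simp add: a_minus_def B.a_assoc)
    then have "\<ominus>\<^bsub>B\<^esub> q = \<ominus>\<^bsub>B\<^esub> (\<nu> (z \<sqinter>\<^bsub>L\<^esub> x) \<oplus>\<^bsub>B\<^esub> \<nu> (z \<sqinter>\<^bsub>L\<^esub> y) \<ominus>\<^bsub>B\<^esub> \<nu> (z \<sqinter>\<^bsub>L\<^esub> (x \<sqinter>\<^bsub>L\<^esub> y)))"
      using c by (simp add: a_minus_def B.minus_add B.a_assoc)
    then have "q = \<nu> (z \<sqinter>\<^bsub>L\<^esub> x) \<oplus>\<^bsub>B\<^esub> \<nu> (z \<sqinter>\<^bsub>L\<^esub> y) \<ominus>\<^bsub>B\<^esub> \<nu> (z \<sqinter>\<^bsub>L\<^esub> (x \<sqinter>\<^bsub>L\<^esub> y))"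
      using c by (metis B.minus_minus B.a_closed B.minus_closed)
    then show ?thesis unfolding q_def[symmetric] using c by (simp add: a_minus_def B.a_assoc B.l_neg)
  qed
  then show ?thesis using cl bot unfolding valuation_def by blast
qed

lemma valuation_imp_measure:
  assumes \<nu>: "valuation \<nu>" and ext: "\<nu> \<in> extensional (carrier L)"
  shows "\<nu> \<in> lattice_measures L B"
proof -
  have cl: "\<And>x. x \<in> carrier L \<Longrightarrow> \<nu> x \<in> carrier B" and bot: "\<nu> \<bottom>\<^bsub>L\<^esub> = \<zero>\<^bsub>B\<^esub>"
    using \<nu> unfolding valuation_def by auto
  have "\<nu> (\<Squnion>\<^bsub>L\<^esub>(x ` {1..k})) = (\<Oplus>\<^bsub>B\<^esub>s\<in>{1..k}. sgn_scale (s + 1)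
      (\<Oplus>\<^bsub>B\<^esub>J\<in>{J. J \<subseteq> {1..k} \<and> card J = s}. \<nu> (\<Sqinter>\<^bsub>L\<^esub>(x ` J))))"
    if k: "k \<ge> 2" and x: "x \<in> {1..k} \<rightarrow> carrier L" for k :: nat and x
  proof -
    have xs: "finite {1..k}" "x ` {1..k} \<subseteq> carrier L" using x by auto
    have j: "\<Squnion>\<^bsub>L\<^esub>(x ` {1..k}) = L.join_all (x ` {1..k})" using k x by (intro L.join_all_nonempty) auto
    have jc: "L.join_all (x ` {1..k}) \<in> carrier L" using xs by simp
    have "\<nu> (L.join_all (x ` {1..k})) = \<nu> \<top>\<^bsub>L\<^esub> \<ominus>\<^bsub>B\<^esub> alt_sum \<nu> x {1..k} \<top>\<^bsub>L\<^esub>"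
      unfolding alt_sum_valuation[OF \<nu> xs L.top_closed]
      using jc cl[OF jc] cl[OF L.top_closed] by (simp add: L.top_meet_eq a_minus_def B.minus_add B.r_neg2)
    then show ?thesis using inclusion_exclusion_sum[where \<nu> = \<nu>, OF cl x] j by metis
  qed
  then show ?thesis using cl bot ext unfolding lattice_measures_def by (auto simp: PiE_def)
qed

end

section \<open>Linear extension of valuations\<close>

lemma (in cring) poly_support:
  assumes "p \<in> carrier (poly_ring_on R I)"
  shows "finite {m. p m \<noteq> \<zero>}" "p m \<noteq> \<zero> \<Longrightarrow> set_mset m \<subseteq> I"
proof -
  have "finite {m. p m \<noteq> \<zero>} \<and> (\<forall>m. p m \<noteq> \<zero> \<longrightarrow> set_mset m \<subseteq> I)"
    using assms
  proof (induction p rule: poly_ring_induct)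
    case (monomial k u)
    have "{m. monomial_poly R k u m \<noteq> \<zero>} \<subseteq> {u}" by (auto simp: monomial_poly_def)
    then show ?case using monomial by (auto simp: monomial_poly_def dest: finite_subset)
  next
    case (add p q)
    have sub: "{m. (p \<oplus>\<^bsub>poly_ring I\<^esub> q) m \<noteq> \<zero>} \<subseteq> {m. p m \<noteq> \<zero>} \<union> {m. q m \<noteq> \<zero>}"
      by (auto simp: poly_ring_simps)
    moreover have "finite ({m. p m \<noteq> \<zero>} \<union> {m. q m \<noteq> \<zero>})" using add by simp
    ultimately have "finite {m. (p \<oplus>\<^bsub>poly_ring I\<^esub> q) m \<noteq> \<zero>}" by (rule finite_subset)
    then show ?case using sub add by blast
  qed
  then show "finite {m. p m \<noteq> \<zero>}" "p m \<noteq> \<zero> \<Longrightarrow> set_mset m \<subseteq> I" by auto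
qed

context lattice_module
begin

definition functional :: "('x \<Rightarrow> 'b) \<Rightarrow> ('x multiset \<Rightarrow> 'a) \<Rightarrow> 'b"
  where "functional \<nu> p = (\<Oplus>\<^bsub>B\<^esub>m\<in>{m. p m \<noteq> \<zero>\<^bsub>A\<^esub>}. p m \<odot>\<^bsub>B\<^esub> \<nu> (mset_meet m))"

context
  fixes \<nu> assumes val: "valuation \<nu>"
begin

lemma val_closed: "x \<in> carrier L \<Longrightarrow> \<nu> x \<in> carrier B"
  using val unfolding valuation_def by blast

text \<open>Cancellation can shrink the support of a sum of polynomials, so sums over supports are
  compared over a common finite index set.\<close>

lemma functional_superset:
  assumes p: "p \<in> carrier P" and D: "finite D" "{m. p m \<noteq> \<zero>\<^bsub>A\<^esub>} \<subseteq> D" "\<And>m. m \<in> D \<Longrightarrow> set_mset m \<subseteq> carrier L"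
  shows "functional \<nu> p = (\<Oplus>\<^bsub>B\<^esub>m\<in>D. p m \<odot>\<^bsub>B\<^esub> \<nu> (mset_meet m))"
  unfolding functional_def
proof (rule B.add.finprod_mono_neutral_cong_left[OF D(1,2)])
  have c: "\<nu> (mset_meet m) \<in> carrier B" if "m \<in> D" for m using D(3)[OF that] by (intro val_closed) simp
  show "p m \<odot>\<^bsub>B\<^esub> \<nu> (mset_meet m) = \<zero>\<^bsub>B\<^esub>" if "m \<in> D - {m. p m \<noteq> \<zero>\<^bsub>A\<^esub>}" for m
    using that c by auto
  show "(\<lambda>m. p m \<odot>\<^bsub>B\<^esub> \<nu> (mset_meet m)) \<in> D \<rightarrow> carrier B"
    using c A.poly_coeff_closed[OF p] by auto
qed simp

lemma functional_closed:
  assumes p: "p \<in> carrier P"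
  shows "functional \<nu> p \<in> carrier B"
  unfolding functional_def
proof (rule B.finsum_closed, rule funcsetI)
  fix m assume "m \<in> {m. p m \<noteq> \<zero>\<^bsub>A\<^esub>}"
  then have "set_mset m \<subseteq> carrier L" using A.poly_support(2)[OF p] by blast
  then show "p m \<odot>\<^bsub>B\<^esub> \<nu> (mset_meet m) \<in> carrier B"
    using A.poly_coeff_closed[OF p] val_closed by simp
qed

lemma functional_add:
  assumes p: "p \<in> carrier P" and q: "q \<in> carrier P"
  shows "functional \<nu> (p \<oplus>\<^bsub>P\<^esub> q) = functional \<nu> p \<oplus>\<^bsub>B\<^esub> functional \<nu> q"
proof -
  define D where "D = {m. p m \<noteq> \<zero>\<^bsub>A\<^esub>} \<union> {m. q m \<noteq> \<zero>\<^bsub>A\<^esub>}"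
  have D: "finite D" "\<And>m. m \<in> D \<Longrightarrow> set_mset m \<subseteq> carrier L"
    using A.poly_support[OF p] A.poly_support[OF q] unfolding D_def by auto
  have c: "\<nu> (mset_meet m) \<in> carrier B" if "m \<in> D" for m using D(2)[OF that] by (intro val_closed) simp
  have pq: "\<And>m. p m \<in> carrier A" "\<And>m. q m \<in> carrier A"
    using A.poly_coeff_closed p q by auto
  have "functional \<nu> (p \<oplus>\<^bsub>P\<^esub> q) = (\<Oplus>\<^bsub>B\<^esub>m\<in>D. (p m \<oplus>\<^bsub>A\<^esub> q m) \<odot>\<^bsub>B\<^esub> \<nu> (mset_meet m))"
  proof -
    have "{m. (p \<oplus>\<^bsub>P\<^esub> q) m \<noteq> \<zero>\<^bsub>A\<^esub>} \<subseteq> D" unfolding D_def by (auto simp: A.poly_ring_simps(5))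
    then show ?thesis
      using functional_superset[OF P.a_closed[OF p q] D(1) _ D(2)] by (simp add: A.poly_ring_simps(5))
  qed
  also have "\<dots> = (\<Oplus>\<^bsub>B\<^esub>m\<in>D. p m \<odot>\<^bsub>B\<^esub> \<nu> (mset_meet m) \<oplus>\<^bsub>B\<^esub> q m \<odot>\<^bsub>B\<^esub> \<nu> (mset_meet m))"
    using c pq by (intro B.finsum_cong') (auto simp: B.smult_l_distr)
  also have "\<dots> = (\<Oplus>\<^bsub>B\<^esub>m\<in>D. p m \<odot>\<^bsub>B\<^esub> \<nu> (mset_meet m)) \<oplus>\<^bsub>B\<^esub> (\<Oplus>\<^bsub>B\<^esub>m\<in>D. q m \<odot>\<^bsub>B\<^esub> \<nu> (mset_meet m))"
    using c pq by (intro B.finsum_addf) auto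
  also have "\<dots> = functional \<nu> p \<oplus>\<^bsub>B\<^esub> functional \<nu> q"
    using functional_superset[OF p D(1) _ D(2)] functional_superset[OF q D(1) _ D(2)] by (simp add: D_def)
  finally show ?thesis .
qed

lemma functional_monomial:
  assumes "k \<in> carrier A" "set_mset u \<subseteq> carrier L"
  shows "functional \<nu> (monomial_poly A k u) = k \<odot>\<^bsub>B\<^esub> \<nu> (mset_meet u)"
proof -
  have "\<nu> (mset_meet u) \<in> carrier B" using assms by (intro val_closed) simp
  moreover have "functional \<nu> (monomial_poly A k u) = (\<Oplus>\<^bsub>B\<^esub>m\<in>{u}. monomial_poly A k u m \<odot>\<^bsub>B\<^esub> \<nu> (mset_meet m))"
    by (rule functional_superset[OF A.monomial_in_poly_ring[OF assms]])
       (use assms in \<open>auto simp: monomial_poly_def\<close>)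
  ultimately show ?thesis using assms by (simp add: monomial_poly_def)
qed

lemma functional_diff:
  assumes p: "p \<in> carrier P" and q: "q \<in> carrier P"
  shows "functional \<nu> (p \<ominus>\<^bsub>P\<^esub> q) = functional \<nu> p \<ominus>\<^bsub>B\<^esub> functional \<nu> q"
proof -
  have "(p \<ominus>\<^bsub>P\<^esub> q) \<oplus>\<^bsub>P\<^esub> q = p" using p q by algebra
  then have "functional \<nu> p = functional \<nu> (p \<ominus>\<^bsub>P\<^esub> q) \<oplus>\<^bsub>B\<^esub> functional \<nu> q"
    using functional_add[of "p \<ominus>\<^bsub>P\<^esub> q" q] p q by simp
  then show ?thesis
    using functional_closed[of "p \<ominus>\<^bsub>P\<^esub> q"] functional_closed[OF q] p q
    by (simp add: a_minus_def B.a_assoc B.r_neg)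
qed

lemma functional_var_monomial:
  assumes "x \<in> carrier L" "k \<in> carrier A" "set_mset u \<subseteq> carrier L"
  shows "functional \<nu> (A.indexed_var x \<otimes>\<^bsub>P\<^esub> monomial_poly A k u) = k \<odot>\<^bsub>B\<^esub> \<nu> (mset_meet u \<sqinter>\<^bsub>L\<^esub> x)"
proof -
  have "mset_meet ({#x#} + u) = mset_meet u \<sqinter>\<^bsub>L\<^esub> x"
    using assms L.meet_all_insert[of "set_mset u" x] L.meet_ac(2)[of x "mset_meet u" x] by simp
  then show ?thesis
    using functional_monomial[of k "{#x#} + u"] assms by (simp add: A.indexed_var_eq_monomial A.monomial_mult)
qed

lemma functional_two_vars_monomial:
  assumes "x \<in> carrier L" "y \<in> carrier L" "k \<in> carrier A" "set_mset u \<subseteq> carrier L"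
  shows "functional \<nu> (A.indexed_var x \<otimes>\<^bsub>P\<^esub> A.indexed_var y \<otimes>\<^bsub>P\<^esub> monomial_poly A k u)
    = k \<odot>\<^bsub>B\<^esub> \<nu> (mset_meet u \<sqinter>\<^bsub>L\<^esub> (x \<sqinter>\<^bsub>L\<^esub> y))"
proof -
  have "mset_meet ({#x#} + {#y#} + u) = mset_meet u \<sqinter>\<^bsub>L\<^esub> (x \<sqinter>\<^bsub>L\<^esub> y)"
    using assms L.meet_ac(2)[of "x \<sqinter>\<^bsub>L\<^esub> y" "mset_meet u" x] L.meet_ac(1,3)[of x y "mset_meet u"]
    by (simp add: L.meet_all_insert)
  then show ?thesis
    using functional_monomial[of k "{#x#} + {#y#} + u"] assms
    by (simp add: A.indexed_var_eq_monomial A.monomial_mult)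
qed

text \<open>The kernel of the functional need not be an ideal; the relations lie in its largest
  subideal because a valuation is compatible with meets.\<close>

lemma functional_relation:
  assumes r: "r \<in> lattice_relations A L" and q: "q \<in> carrier P"
  shows "functional \<nu> (r \<otimes>\<^bsub>P\<^esub> q) = \<zero>\<^bsub>B\<^esub>"
  using q
proof (induction q rule: A.poly_ring_induct)
  case (add p q)
  have rP: "r \<in> carrier P" using r A.lattice_relations_closed[OF L.bounded_lattice_axioms] by blast
  then show ?case using add by (simp add: P.r_distr functional_add)
next
  case (monomial k u)
  \<comment> \<open>Multiplying a relation by this monomial meets every lattice element in it with
    z. This is the origin of the base element in \<open>valuation\<close>.\<close>
  define z where "z = mset_meet u"
  have z: "z \<in> carrier L" unfolding z_def using monomial by simp
  define m where "m = monomial_poly A k u"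
  have m: "m \<in> carrier P" unfolding m_def using monomial by (simp add: A.monomial_in_poly_ring)
  have v: "\<And>x. x \<in> carrier L \<Longrightarrow> A.indexed_var x \<in> carrier P" by (rule A.indexed_var_in_poly_ring)
  have f1: "functional \<nu> (A.indexed_var x \<otimes>\<^bsub>P\<^esub> m) = k \<odot>\<^bsub>B\<^esub> \<nu> (z \<sqinter>\<^bsub>L\<^esub> x)" if "x \<in> carrier L" for x
    unfolding m_def z_def using functional_var_monomial[OF that monomial] .
  have f2: "functional \<nu> (A.indexed_var x \<otimes>\<^bsub>P\<^esub> A.indexed_var y \<otimes>\<^bsub>P\<^esub> m) = k \<odot>\<^bsub>B\<^esub> \<nu> (z \<sqinter>\<^bsub>L\<^esub> (x \<sqinter>\<^bsub>L\<^esub> y))"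
    if "x \<in> carrier L" "y \<in> carrier L" for x y
    unfolding m_def z_def using functional_two_vars_monomial[OF that monomial] .
  have f0: "functional \<nu> m = k \<odot>\<^bsub>B\<^esub> \<nu> z" unfolding m_def z_def using functional_monomial[OF monomial] .
  have nc: "\<And>x. x \<in> carrier L \<Longrightarrow> \<nu> x \<in> carrier B" by (rule val_closed)
  have k: "k \<in> carrier A" by fact
  consider "r = A.indexed_var \<bottom>\<^bsub>L\<^esub>" | "r = A.indexed_var \<top>\<^bsub>L\<^esub> \<ominus>\<^bsub>P\<^esub> \<one>\<^bsub>P\<^esub>"
    | x y where "x \<in> carrier L" "y \<in> carrier L" "r = A.indexed_var (x \<sqinter>\<^bsub>L\<^esub> y) \<ominus>\<^bsub>P\<^esub> (A.indexed_var x \<otimes>\<^bsub>P\<^esub> A.indexed_var y)"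
    | x y where "x \<in> carrier L" "y \<in> carrier L"
      "r = ((A.indexed_var (x \<squnion>\<^bsub>L\<^esub> y) \<ominus>\<^bsub>P\<^esub> A.indexed_var x) \<ominus>\<^bsub>P\<^esub> A.indexed_var y) \<oplus>\<^bsub>P\<^esub> (A.indexed_var x \<otimes>\<^bsub>P\<^esub> A.indexed_var y)"
    using r unfolding A.lattice_relations_alt Let_def by auto
  then have "functional \<nu> (r \<otimes>\<^bsub>P\<^esub> m) = \<zero>\<^bsub>B\<^esub>"
  proof cases
    case 1
    have "\<nu> \<bottom>\<^bsub>L\<^esub> = \<zero>\<^bsub>B\<^esub>" using val unfolding valuation_def by simp
    then show ?thesis unfolding 1 using f1[of "\<bottom>\<^bsub>L\<^esub>"] k z by (simp add: L.bottom_meet_eq)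
  next
    case 2
    have "r \<otimes>\<^bsub>P\<^esub> m = A.indexed_var \<top>\<^bsub>L\<^esub> \<otimes>\<^bsub>P\<^esub> m \<ominus>\<^bsub>P\<^esub> m"
      unfolding 2 using m v[of "\<top>\<^bsub>L\<^esub>"] by (simp add: a_minus_def P.l_distr P.l_minus)
    then have "functional \<nu> (r \<otimes>\<^bsub>P\<^esub> m) = k \<odot>\<^bsub>B\<^esub> \<nu> z \<ominus>\<^bsub>B\<^esub> k \<odot>\<^bsub>B\<^esub> \<nu> z"
      using f1[of "\<top>\<^bsub>L\<^esub>"] f0 m v[of "\<top>\<^bsub>L\<^esub>"] z by (simp add: functional_diff L.top_meet_eq)
    then show ?thesis using z nc k by (simp add: a_minus_def B.r_neg)
  next
    case (3 x y)
    have "r \<otimes>\<^bsub>P\<^esub> m = A.indexed_var (x \<sqinter>\<^bsub>L\<^esub> y) \<otimes>\<^bsub>P\<^esub> m \<ominus>\<^bsub>P\<^esub> (A.indexed_var x \<otimes>\<^bsub>P\<^esub> A.indexed_var y \<otimes>\<^bsub>P\<^esub> m)"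
      unfolding 3 using m v[of "x \<sqinter>\<^bsub>L\<^esub> y"] v[of x] v[of y] 3 by (simp add: a_minus_def P.l_distr P.l_minus)
    then have "functional \<nu> (r \<otimes>\<^bsub>P\<^esub> m) = k \<odot>\<^bsub>B\<^esub> \<nu> (z \<sqinter>\<^bsub>L\<^esub> (x \<sqinter>\<^bsub>L\<^esub> y)) \<ominus>\<^bsub>B\<^esub> k \<odot>\<^bsub>B\<^esub> \<nu> (z \<sqinter>\<^bsub>L\<^esub> (x \<sqinter>\<^bsub>L\<^esub> y))"
      using f1[of "x \<sqinter>\<^bsub>L\<^esub> y"] f2[of x y] m v 3(1,2) by (simp add: functional_diff)
    then show ?thesis using z nc k 3(1,2) by (simp add: a_minus_def B.r_neg)
  next
    \<comment> \<open>The terms are sorted by sign, so that the two sides of the valuation identity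
      at z appear as the two arguments of the difference.\<close>
    case (4 x y)
    have vv: "A.indexed_var (x \<squnion>\<^bsub>L\<^esub> y) \<in> carrier P" "A.indexed_var x \<in> carrier P" "A.indexed_var y \<in> carrier P"
      using v 4 by auto
    have "r \<otimes>\<^bsub>P\<^esub> m = (A.indexed_var (x \<squnion>\<^bsub>L\<^esub> y) \<otimes>\<^bsub>P\<^esub> m \<oplus>\<^bsub>P\<^esub> A.indexed_var x \<otimes>\<^bsub>P\<^esub> A.indexed_var y \<otimes>\<^bsub>P\<^esub> m)
      \<ominus>\<^bsub>P\<^esub> (A.indexed_var x \<otimes>\<^bsub>P\<^esub> m \<oplus>\<^bsub>P\<^esub> A.indexed_var y \<otimes>\<^bsub>P\<^esub> m)"
      unfolding 4(3) using m vv by algebra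
    then have "functional \<nu> (r \<otimes>\<^bsub>P\<^esub> m) = (k \<odot>\<^bsub>B\<^esub> \<nu> (z \<sqinter>\<^bsub>L\<^esub> (x \<squnion>\<^bsub>L\<^esub> y)) \<oplus>\<^bsub>B\<^esub> k \<odot>\<^bsub>B\<^esub> \<nu> (z \<sqinter>\<^bsub>L\<^esub> (x \<sqinter>\<^bsub>L\<^esub> y)))
      \<ominus>\<^bsub>B\<^esub> (k \<odot>\<^bsub>B\<^esub> \<nu> (z \<sqinter>\<^bsub>L\<^esub> x) \<oplus>\<^bsub>B\<^esub> k \<odot>\<^bsub>B\<^esub> \<nu> (z \<sqinter>\<^bsub>L\<^esub> y))"
      using f1 f2 m vv 4(1,2) by (simp add: functional_diff functional_add)
    also have "\<dots> = k \<odot>\<^bsub>B\<^esub> (\<nu> (z \<sqinter>\<^bsub>L\<^esub> (x \<squnion>\<^bsub>L\<^esub> y)) \<oplus>\<^bsub>B\<^esub> \<nu> (z \<sqinter>\<^bsub>L\<^esub> (x \<sqinter>\<^bsub>L\<^esub> y)))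
      \<ominus>\<^bsub>B\<^esub> k \<odot>\<^bsub>B\<^esub> (\<nu> (z \<sqinter>\<^bsub>L\<^esub> x) \<oplus>\<^bsub>B\<^esub> \<nu> (z \<sqinter>\<^bsub>L\<^esub> y))"
      using k nc z 4(1,2) by (simp add: B.smult_r_distr)
    also have "\<nu> (z \<sqinter>\<^bsub>L\<^esub> (x \<squnion>\<^bsub>L\<^esub> y)) \<oplus>\<^bsub>B\<^esub> \<nu> (z \<sqinter>\<^bsub>L\<^esub> (x \<sqinter>\<^bsub>L\<^esub> y)) = \<nu> (z \<sqinter>\<^bsub>L\<^esub> x) \<oplus>\<^bsub>B\<^esub> \<nu> (z \<sqinter>\<^bsub>L\<^esub> y)"
      using val z 4(1,2) unfolding valuation_def by blast
    finally show ?thesis using k nc z 4(1,2) by (simp add: a_minus_def B.r_neg)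
  qed
  then show ?case unfolding m_def .
qed

lemma functional_ideal:
  assumes "p \<in> I"
  shows "functional \<nu> p = \<zero>\<^bsub>B\<^esub>"
proof -
  note rel = A.lattice_relations_closed[OF L.bounded_lattice_axioms]
  \<comment> \<open>The largest ideal inside the kernel. It contains the generators by
    \<open>functional_relation\<close>, hence all of \<open>I\<close>, and q = 1 leads back to the
    functional itself.\<close>
  define K where "K = {p \<in> carrier P. \<forall>q\<in>carrier P. functional \<nu> (p \<otimes>\<^bsub>P\<^esub> q) = \<zero>\<^bsub>B\<^esub>}"
  have "ideal K P"
  proof (rule P.idealI_cring)
    have "functional \<nu> \<zero>\<^bsub>P\<^esub> = \<zero>\<^bsub>B\<^esub>" unfolding functional_def by (simp add: A.poly_ring_simps)
    then show "\<zero>\<^bsub>P\<^esub> \<in> K" unfolding K_def by simp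
    show "r \<otimes>\<^bsub>P\<^esub> a \<in> K" if "a \<in> K" "r \<in> carrier P" for a r
    proof -
      have "functional \<nu> (r \<otimes>\<^bsub>P\<^esub> a \<otimes>\<^bsub>P\<^esub> q) = \<zero>\<^bsub>B\<^esub>" if q: "q \<in> carrier P" for q
      proof -
        have "r \<otimes>\<^bsub>P\<^esub> a \<otimes>\<^bsub>P\<^esub> q = a \<otimes>\<^bsub>P\<^esub> (r \<otimes>\<^bsub>P\<^esub> q)"
          using \<open>a \<in> K\<close> \<open>r \<in> carrier P\<close> q unfolding K_def by (simp add: P.m_ac)
        then show ?thesis using \<open>a \<in> K\<close> \<open>r \<in> carrier P\<close> q unfolding K_def by simp
      qed
      then show ?thesis using that unfolding K_def by simp
    qed
  qed (auto simp: K_def P.l_distr functional_add)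
  moreover have "lattice_relations A L \<subseteq> K" using rel functional_relation unfolding K_def by auto
  ultimately have "I \<subseteq> K"
    unfolding A.lattice_ideal_eq[OF L.bounded_lattice_axioms] by (rule P.genideal_minimal)
  then have "p \<in> K" using assms by blast
  then have "functional \<nu> (p \<otimes>\<^bsub>P\<^esub> \<one>\<^bsub>P\<^esub>) = \<zero>\<^bsub>B\<^esub>" "p \<in> carrier P"
    using P.one_closed unfolding K_def by blast+
  then show ?thesis by simp
qed

lemma functional_cls_cong:
  assumes "p \<in> carrier P" "q \<in> carrier P" "cls p = cls q"
  shows "functional \<nu> p = functional \<nu> q"
proof -
  have "functional \<nu> p \<ominus>\<^bsub>B\<^esub> functional \<nu> q = \<zero>\<^bsub>B\<^esub>"
    using functional_ideal[of "p \<ominus>\<^bsub>P\<^esub> q"] functional_diff assms cls_eq_iff by simp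
  moreover have "functional \<nu> p = (functional \<nu> p \<ominus>\<^bsub>B\<^esub> functional \<nu> q) \<oplus>\<^bsub>B\<^esub> functional \<nu> q"
    using functional_closed[OF assms(1)] functional_closed[OF assms(2)] by (simp add: a_minus_def B.a_assoc B.l_neg)
  ultimately show ?thesis using functional_closed[OF assms(2)] by simp
qed

text \<open>The functional is constant on cosets, so any representative may be selected. Scalars
  enter the lattice ring as constant polynomials, and compatibility with them is checked on
  monomials.\<close>

lemma valuation_extends:
  "\<exists>\<phi>\<in>linear_maps A (ring_along h T) B. \<forall>x\<in>carrier L. \<phi> (gen x) = \<nu> x"
proof -
  define \<phi> where "\<phi> = (\<lambda>t\<in>carrier T. functional \<nu> (SOME p. p \<in> carrier P \<and> cls p = t))"
  have \<phi>: "\<phi> (cls p) = functional \<nu> p" if p: "p \<in> carrier P" for p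
  proof -
    define q where "q = (SOME q. q \<in> carrier P \<and> cls q = cls p)"
    have "q \<in> carrier P \<and> cls q = cls p"
      unfolding q_def by (rule someI[of _ p]) (use p in simp)
    then have "functional \<nu> q = functional \<nu> p" using functional_cls_cong[of q p] p by blast
    moreover have "\<phi> (cls p) = functional \<nu> q" using p unfolding \<phi>_def q_def by simp
    ultimately show ?thesis by simp
  qed
  have "\<phi> \<in> linear_maps A (ring_along h T) B"
  proof (rule linear_mapsI)
    fix t assume "t \<in> carrier (ring_along h T)"
    then have "t \<in> carrier T" by simp
    then obtain p where p: "p \<in> carrier P" "t = cls p" by (rule T_carrierE)
    then show "\<phi> t \<in> carrier B" using \<phi> functional_closed by simp
    fix t' assume "t' \<in> carrier (ring_along h T)"
    then have "t' \<in> carrier T" by simp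
    then obtain q where q: "q \<in> carrier P" "t' = cls q" by (rule T_carrierE)
    have "t \<oplus>\<^bsub>T\<^esub> t' = cls (p \<oplus>\<^bsub>P\<^esub> q)" using p q by simp
    then show "\<phi> (t \<oplus>\<^bsub>ring_along h T\<^esub> t') = \<phi> t \<oplus>\<^bsub>B\<^esub> \<phi> t'"
      using p q \<phi>[OF P.a_closed[OF p(1) q(1)]] \<phi>[OF p(1)] \<phi>[OF q(1)] functional_add[OF p(1) q(1)] by simp
  next
    fix a t assume a: "a \<in> carrier A" and "t \<in> carrier (ring_along h T)"
    then have "t \<in> carrier T" by simp
    then obtain p where p: "p \<in> carrier P" "t = cls p" by (rule T_carrierE)
    have ma: "monomial_poly A a {#} \<in> carrier P" using a by (simp add: A.monomial_in_poly_ring)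
    have "functional \<nu> (monomial_poly A a {#} \<otimes>\<^bsub>P\<^esub> p) = a \<odot>\<^bsub>B\<^esub> functional \<nu> p"
      using p(1)
    proof (induction p rule: A.poly_ring_induct)
      case (monomial k u)
      then have "\<nu> (mset_meet u) \<in> carrier B" by (intro val_closed) simp
      then show ?case using monomial a by (simp add: A.monomial_mult functional_monomial B.smult_assoc1)
    next
      case (add p q)
      then show ?case using ma a by (simp add: P.r_distr functional_add functional_closed B.smult_r_distr)
    qed
    moreover have "h a \<otimes>\<^bsub>T\<^esub> t = cls (monomial_poly A a {#} \<otimes>\<^bsub>P\<^esub> p)" using p ma by (simp add: lattice_ring_map_eq)
    ultimately show "\<phi> (a \<odot>\<^bsub>ring_along h T\<^esub> t) = a \<odot>\<^bsub>B\<^esub> \<phi> t"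
      using p \<phi>[OF P.m_closed[OF ma p(1)]] \<phi>[OF p(1)] by simp
  qed (simp add: \<phi>_def)
  moreover have "\<phi> (gen x) = \<nu> x" if x: "x \<in> carrier L" for x
  proof -
    have "functional \<nu> (A.indexed_var x) = \<nu> x"
      using functional_monomial[of "\<one>\<^bsub>A\<^esub>" "{#x#}"] x val_closed[OF x]
      by (simp add: A.indexed_var_eq_monomial L.meet_all_singleton)
    then show ?thesis unfolding gen_def using \<phi> A.indexed_var_in_poly_ring[OF x] by simp
  qed
  ultimately show ?thesis by blast
qed

end

definition gen_restriction :: "(('x multiset \<Rightarrow> 'a) set \<Rightarrow> 'b) \<Rightarrow> 'x \<Rightarrow> 'b"
  where "gen_restriction \<phi> = (\<lambda>x\<in>carrier L. \<phi> (gen x))"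

text \<open>Multiplying the join relation by \<open>gen z\<close> yields the valuation identity
  inside the lattice ring, where multiplication distributes even if the lattice is not distributive;
  \<phi> only has to be additive to transport it.\<close>

lemma valuation_gen_restriction:
  assumes \<phi>: "\<phi> \<in> linear_maps A (ring_along h T) B"
  shows "gen_restriction \<phi> \<in> lattice_measures L B"
proof (rule valuation_imp_measure)
  note D = linear_mapsD[OF \<phi>, simplified]
  have zero: "\<phi> \<zero>\<^bsub>T\<^esub> = \<zero>\<^bsub>B\<^esub>"
    using D(3)[of "\<zero>\<^bsub>T\<^esub>" "\<zero>\<^bsub>T\<^esub>"] D(2)[of "\<zero>\<^bsub>T\<^esub>"] by simp
  have "\<phi> (gen (z \<sqinter>\<^bsub>L\<^esub> (x \<squnion>\<^bsub>L\<^esub> y))) \<oplus>\<^bsub>B\<^esub> \<phi> (gen (z \<sqinter>\<^bsub>L\<^esub> (x \<sqinter>\<^bsub>L\<^esub> y))) = \<phi> (gen (z \<sqinter>\<^bsub>L\<^esub> x)) \<oplus>\<^bsub>B\<^esub> \<phi> (gen (z \<sqinter>\<^bsub>L\<^esub> y))"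
    if xyz: "x \<in> carrier L" "y \<in> carrier L" "z \<in> carrier L" for x y z
  proof -
    have "gen (z \<sqinter>\<^bsub>L\<^esub> (x \<squnion>\<^bsub>L\<^esub> y)) \<oplus>\<^bsub>T\<^esub> gen (z \<sqinter>\<^bsub>L\<^esub> (x \<sqinter>\<^bsub>L\<^esub> y)) = gen z \<otimes>\<^bsub>T\<^esub> (gen (x \<squnion>\<^bsub>L\<^esub> y) \<oplus>\<^bsub>T\<^esub> gen x \<otimes>\<^bsub>T\<^esub> gen y)"
      using xyz by (simp add: gen_meet T.r_distr)
    also have "\<dots> = gen (z \<sqinter>\<^bsub>L\<^esub> x) \<oplus>\<^bsub>T\<^esub> gen (z \<sqinter>\<^bsub>L\<^esub> y)"
      using xyz gen_join[OF xyz(1,2)] by (simp add: gen_meet T.r_distr)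
    finally show ?thesis using xyz by (simp flip: D(3))
  qed
  then show "valuation (gen_restriction \<phi>)"
    using D(2) zero gen_bottom unfolding valuation_def gen_restriction_def by simp
qed (simp add: gen_restriction_def)

lemma measure_module_simps:
  "carrier (measure_module L B) = lattice_measures L B"
  "\<nu> \<oplus>\<^bsub>measure_module L B\<^esub> \<mu> = (\<lambda>x\<in>carrier L. \<nu> x \<oplus>\<^bsub>B\<^esub> \<mu> x)"
  "a \<odot>\<^bsub>measure_module L B\<^esub> \<nu> = (\<lambda>x\<in>carrier L. a \<odot>\<^bsub>B\<^esub> \<nu> x)"
  by (simp_all add: measure_module_def plain_module_def)

theorem gen_restriction_iso:
  "restrict gen_restriction (linear_maps A (ring_along h T) B)
    \<in> module_iso A (Hom_module A (ring_along h T) B) (measure_module L B)"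
proof -
  let ?H = "linear_maps A (ring_along h T) B"
  have cl: "closed_operations A (Hom_module A (ring_along h T) B)"
    by (rule closed_operations_Hom_module[OF closed_operations_ring_along B.module_axioms])
  have "restrict gen_restriction ?H \<in> linear_maps A (Hom_module A (ring_along h T) B) (measure_module L B)"
  proof (rule linear_mapsI)
    fix \<phi> \<psi> assume *: "\<phi> \<in> carrier (Hom_module A (ring_along h T) B)" "\<psi> \<in> carrier (Hom_module A (ring_along h T) B)"
    then have "\<phi> \<oplus>\<^bsub>Hom_module A (ring_along h T) B\<^esub> \<psi> \<in> ?H" using cl unfolding closed_operations_def by simp
    then show "restrict gen_restriction ?H (\<phi> \<oplus>\<^bsub>Hom_module A (ring_along h T) B\<^esub> \<psi>)
      = restrict gen_restriction ?H \<phi> \<oplus>\<^bsub>measure_module L B\<^esub> restrict gen_restriction ?H \<psi>"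
      using * by (auto simp: gen_restriction_def measure_module_simps)
  next
    fix a \<phi> assume *: "a \<in> carrier A" "\<phi> \<in> carrier (Hom_module A (ring_along h T) B)"
    then have "a \<odot>\<^bsub>Hom_module A (ring_along h T) B\<^esub> \<phi> \<in> ?H" using cl unfolding closed_operations_def by simp
    then show "restrict gen_restriction ?H (a \<odot>\<^bsub>Hom_module A (ring_along h T) B\<^esub> \<phi>)
      = a \<odot>\<^bsub>measure_module L B\<^esub> restrict gen_restriction ?H \<phi>"
      using * by (auto simp: gen_restriction_def measure_module_simps)
  qed (use valuation_gen_restriction in \<open>auto simp: measure_module_simps\<close>)
  moreover have "inj_on (restrict gen_restriction ?H) ?H"
  proof (rule inj_onI)
    fix \<phi> \<psi> assume *: "\<phi> \<in> ?H" "\<psi> \<in> ?H" and eq: "restrict gen_restriction ?H \<phi> = restrict gen_restriction ?H \<psi>"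
    note D = linear_mapsD[OF *(1), simplified] and E = linear_mapsD[OF *(2), simplified]
    have g: "\<phi> (gen x) = \<psi> (gen x)" if "x \<in> carrier L" for x
      using fun_cong[OF eq, of x] * that by (simp add: gen_restriction_def)
    have "\<phi> t = \<psi> t" if "t \<in> carrier T" for t
      using that
    proof (induction t rule: lattice_ring_induct)
      case (gen k x)
      then show ?case using D(4) E(4) g by simp
    next
      case (add t t')
      then show ?case using D(3) E(3) by simp
    qed
    then show "\<phi> = \<psi>" using D(1) E(1) by (auto intro: extensionalityI)
  qed
  moreover have "restrict gen_restriction ?H ` ?H = lattice_measures L B"
  proof
    show "lattice_measures L B \<subseteq> restrict gen_restriction ?H ` ?H"
    proof
      fix \<nu> assume \<nu>: "\<nu> \<in> lattice_measures L B"
      obtain \<phi> where \<phi>: "\<phi> \<in> ?H" "\<forall>x\<in>carrier L. \<phi> (gen x) = \<nu> x"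
        using valuation_extends[OF measure_imp_valuation[OF \<nu>]] by blast
      have "\<nu> \<in> extensional (carrier L)" using \<nu> unfolding lattice_measures_def by (auto simp: PiE_def)
      then have "\<nu> = gen_restriction \<phi>"
        unfolding gen_restriction_def using \<phi>(2) by (intro extensionalityI[of _ "carrier L"]) auto
      then show "\<nu> \<in> restrict gen_restriction ?H ` ?H" using \<phi>(1) by (intro image_eqI[of _ _ \<phi>]) auto
    qed
  qed (use valuation_gen_restriction in auto)
  ultimately show ?thesis unfolding module_iso_def bij_betw_def by (simp add: measure_module_simps)
qed

end

section \<open>Group actions\<close>

lemma closed_operations_Hom_invariants:
  fixes R :: "('r, 'c) ring_scheme" and M :: "('r, 'm, 'd) module_scheme" and N :: "('r, 'n, 'e) module_scheme"
    and G :: "('g, 'h) monoid_scheme"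
  assumes M: "closed_operations R M" and N: "module R N" and G: "group G"
    and \<rho>: "\<And>g m. \<lbrakk>g \<in> carrier G; m \<in> carrier M\<rbrakk> \<Longrightarrow> \<rho> g m \<in> carrier M"
  shows "closed_operations R (Hom_invariants G \<rho> R M N)"
proof -
  interpret G: group G by fact
  note cl = closed_operations_Hom_module[OF M N, unfolded closed_operations_def]
  have inv: "\<phi> (\<rho> (inv\<^bsub>G\<^esub> g) m) = \<phi> m"
    if "hom_action G \<rho> M g \<phi> = \<phi>" "m \<in> carrier M" for \<phi> :: "'m \<Rightarrow> 'n" and g m
    using fun_cong[OF that(1), of m] that(2) by (simp add: hom_action_def)
  have restr: "hom_action G \<rho> M g (\<lambda>x\<in>carrier M. F x) = (\<lambda>x\<in>carrier M. F x)"
    if "g \<in> carrier G" "\<And>m. m \<in> carrier M \<Longrightarrow> F (\<rho> (inv\<^bsub>G\<^esub> g) m) = F m" for F :: "'m \<Rightarrow> 'n" and g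
    using that \<rho>[OF G.inv_closed[OF that(1)]] by (auto simp: hom_action_def restrict_def fun_eq_iff)
  let ?C = "{\<phi> \<in> linear_maps R M N. \<forall>g\<in>carrier G. hom_action G \<rho> M g \<phi> = \<phi>}"
  have add: "(\<lambda>x\<in>carrier M. \<phi> x \<oplus>\<^bsub>N\<^esub> \<psi> x) \<in> ?C" if "\<phi> \<in> ?C" "\<psi> \<in> ?C" for \<phi> \<psi>
  proof -
    have "hom_action G \<rho> M g (\<lambda>x\<in>carrier M. \<phi> x \<oplus>\<^bsub>N\<^esub> \<psi> x) = (\<lambda>x\<in>carrier M. \<phi> x \<oplus>\<^bsub>N\<^esub> \<psi> x)"
      if g: "g \<in> carrier G" for g
      by (rule restr[OF g]) (use inv[of g \<phi>] inv[of g \<psi>] \<open>\<phi> \<in> ?C\<close> \<open>\<psi> \<in> ?C\<close> g in simp)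
    then show ?thesis using cl that by simp
  qed
  have smult: "(\<lambda>x\<in>carrier M. a \<odot>\<^bsub>N\<^esub> \<phi> x) \<in> ?C" if "\<phi> \<in> ?C" "a \<in> carrier R" for \<phi> a
  proof -
    have "hom_action G \<rho> M g (\<lambda>x\<in>carrier M. a \<odot>\<^bsub>N\<^esub> \<phi> x) = (\<lambda>x\<in>carrier M. a \<odot>\<^bsub>N\<^esub> \<phi> x)"
      if g: "g \<in> carrier G" for g
      by (rule restr[OF g]) (use inv[of g \<phi>] \<open>\<phi> \<in> ?C\<close> g in simp)
    then show ?thesis using cl that by simp
  qed
  have simps: "carrier (Hom_invariants G \<rho> R M N) = ?C"
    "\<And>\<phi> \<psi>. \<phi> \<oplus>\<^bsub>Hom_invariants G \<rho> R M N\<^esub> \<psi> = (\<lambda>x\<in>carrier M. \<phi> x \<oplus>\<^bsub>N\<^esub> \<psi> x)"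
    "\<And>a \<phi>. a \<odot>\<^bsub>Hom_invariants G \<rho> R M N\<^esub> \<phi> = (\<lambda>x\<in>carrier M. a \<odot>\<^bsub>N\<^esub> \<phi> x)"
    by (simp_all add: Hom_invariants_def Hom_module_def plain_module_def)
  show ?thesis unfolding closed_operations_def simps using add smult by (intro conjI ballI)
qed

locale lattice_action = lattice_module L A B + G: group_action G "carrier L" act
  for L :: "('x, 'e) gorder_scheme" and A :: "('a, 'c) ring_scheme" and B :: "('a, 'b, 'd) module_scheme"
    and G :: "('g, 'h) monoid_scheme" and act +
  assumes preserves: "g \<in> carrier G \<Longrightarrow> join_pres L L (act g) \<and> meet_pres L L (act g)"
begin

lemma group_G: "group G"
  using G.group_hom unfolding group_hom_def by simp

sublocale grp: group G by (rule group_G)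

lemma act_closed [simp]: "g \<in> carrier G \<Longrightarrow> x \<in> carrier L \<Longrightarrow> act g x \<in> carrier L"
  using G.element_image by blast

lemma act_inv: "g \<in> carrier G \<Longrightarrow> x \<in> carrier L \<Longrightarrow> act (inv\<^bsub>G\<^esub> g) (act g x) = x"
  using G.orbit_sym_aux by blast

lemma act_inv': "g \<in> carrier G \<Longrightarrow> x \<in> carrier L \<Longrightarrow> act g (act (inv\<^bsub>G\<^esub> g) x) = x"
  using act_inv[of "inv\<^bsub>G\<^esub> g" x] by simp

lemma act_bij: "g \<in> carrier G \<Longrightarrow> bij_betw (act g) (carrier L) (carrier L)"
  by (rule bij_betw_byWitness[where f' = "act (inv\<^bsub>G\<^esub> g)"]) (auto simp: act_inv act_inv')

lemma act_meet: "\<lbrakk>g \<in> carrier G; x \<in> carrier L; y \<in> carrier L\<rbrakk> \<Longrightarrow> act g (x \<sqinter>\<^bsub>L\<^esub> y) = act g x \<sqinter>\<^bsub>L\<^esub> act g y"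
  using preserves unfolding meet_pres_def by blast

lemma act_join: "\<lbrakk>g \<in> carrier G; x \<in> carrier L; y \<in> carrier L\<rbrakk> \<Longrightarrow> act g (x \<squnion>\<^bsub>L\<^esub> y) = act g x \<squnion>\<^bsub>L\<^esub> act g y"
  using preserves unfolding join_pres_def by blast

text \<open>Preserving binary meets does not by itself fix the bounds, but surjectivity does:
  \<open>\<bottom>\<close> is the image of some element, and the image of \<open>\<bottom>\<close>
  is the meet of itself with this image. The argument for \<open>\<top>\<close> is
  analogous.\<close>

lemma act_bottom: assumes g: "g \<in> carrier G" shows "act g \<bottom>\<^bsub>L\<^esub> = \<bottom>\<^bsub>L\<^esub>"
proof -
  have "act g \<bottom>\<^bsub>L\<^esub> = act g \<bottom>\<^bsub>L\<^esub> \<sqinter>\<^bsub>L\<^esub> act g (act (inv\<^bsub>G\<^esub> g) \<bottom>\<^bsub>L\<^esub>)"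
    using act_meet[OF g, of "\<bottom>\<^bsub>L\<^esub>" "act (inv\<^bsub>G\<^esub> g) \<bottom>\<^bsub>L\<^esub>"] g by (simp add: L.bottom_meet_eq)
  then show ?thesis using g by (simp add: act_inv' L.bottom_meet_eq)
qed

lemma act_top: assumes g: "g \<in> carrier G" shows "act g \<top>\<^bsub>L\<^esub> = \<top>\<^bsub>L\<^esub>"
proof -
  have "act g (act (inv\<^bsub>G\<^esub> g) \<top>\<^bsub>L\<^esub>) = act g \<top>\<^bsub>L\<^esub> \<sqinter>\<^bsub>L\<^esub> act g (act (inv\<^bsub>G\<^esub> g) \<top>\<^bsub>L\<^esub>)"
    using act_meet[OF g, of "\<top>\<^bsub>L\<^esub>" "act (inv\<^bsub>G\<^esub> g) \<top>\<^bsub>L\<^esub>"] g by (simp add: L.top_meet_eq)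
  then show ?thesis using g by (simp add: act_inv' L.top_meet_eq)
qed

abbreviation "pact \<equiv> poly_action G act A L"
abbreviation "tact \<equiv> lattice_ring_action G act A L"

text \<open>Reading the coefficients at the inverse translate moves the monomial forward. The guard
  in \<open>poly_action\<close> matters for m with variables outside the carrier, where the
  behaviour of \<open>act\<close> is not controlled and both sides must be zero.\<close>

lemma pact_monomial:
  assumes g: "g \<in> carrier G" and u: "set_mset u \<subseteq> carrier L"
  shows "pact g (monomial_poly A k u) = monomial_poly A k (image_mset (act g) u)"
proof
  fix m
  have 1: "image_mset (act g) (image_mset (act (inv\<^bsub>G\<^esub> g)) m) = m" if "set_mset m \<subseteq> carrier L"
    using that g act_inv' multiset.map_cong[OF refl, of m "act g \<circ> act (inv\<^bsub>G\<^esub> g)" "\<lambda>x. x"]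
    by (auto simp: subset_iff multiset.map_comp)
  have 2: "image_mset (act (inv\<^bsub>G\<^esub> g)) (image_mset (act g) u) = u"
    using u g act_inv multiset.map_cong[OF refl, of u "act (inv\<^bsub>G\<^esub> g) \<circ> act g" "\<lambda>x. x"]
    by (auto simp: subset_iff multiset.map_comp)
  have 3: "set_mset (image_mset (act g) u) \<subseteq> carrier L" using g u by auto
  show "pact g (monomial_poly A k u) m = monomial_poly A k (image_mset (act g) u) m"
    unfolding poly_action_def monomial_poly_def using 1 2 3 by auto
qed

lemma pact_add:
  "pact g (p \<oplus>\<^bsub>P\<^esub> q) = pact g p \<oplus>\<^bsub>P\<^esub> pact g q"
  by (simp add: poly_action_def A.poly_ring_simps fun_eq_iff)

lemma pact_closed:
  assumes g: "g \<in> carrier G" and p: "p \<in> carrier P"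
  shows "pact g p \<in> carrier P"
  using p
proof (induction p rule: A.poly_ring_induct)
  case (monomial k u)
  then have "set_mset (image_mset (act g) u) \<subseteq> carrier L" using g by auto
  then show ?case using pact_monomial[OF g] monomial by (simp add: A.monomial_in_poly_ring)
next
  case (add p q)
  then show ?case by (simp add: pact_add)
qed

lemma pact_hom:
  assumes g: "g \<in> carrier G"
  shows "ring_hom_cring P P (pact g)"
proof (rule A.poly_ring_hom_by_monomials[OF P.is_cring pact_closed[OF g] pact_add])
  fix k l u v assume *: "k \<in> carrier A" "l \<in> carrier A" "set_mset u \<subseteq> carrier L" "set_mset v \<subseteq> carrier L"
  then show "pact g (monomial_poly A (k \<otimes>\<^bsub>A\<^esub> l) (u + v)) = pact g (monomial_poly A k u) \<otimes>\<^bsub>P\<^esub> pact g (monomial_poly A l v)"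
    by (simp add: pact_monomial[OF g] A.monomial_mult)
next
  show "pact g (monomial_poly A \<one>\<^bsub>A\<^esub> {#}) = \<one>\<^bsub>P\<^esub>"
    using pact_monomial[OF g, of "{#}"] by (simp add: A.poly_ring_simps(3))
qed

lemma pact_inv:
  assumes g: "g \<in> carrier G" and p: "p \<in> carrier P"
  shows "pact g (pact (inv\<^bsub>G\<^esub> g) p) = p"
  using p
proof (induction p rule: A.poly_ring_induct)
  case (monomial k u)
  have "image_mset (act g) (image_mset (act (inv\<^bsub>G\<^esub> g)) u) = u"
    using monomial(2) g act_inv' multiset.map_cong[OF refl, of u "act g \<circ> act (inv\<^bsub>G\<^esub> g)" "\<lambda>x. x"]
    by (auto simp: subset_iff multiset.map_comp)
  moreover have "set_mset (image_mset (act (inv\<^bsub>G\<^esub> g)) u) \<subseteq> carrier L" using g monomial(2) by auto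
  ultimately show ?case using g monomial(2) by (simp add: pact_monomial)
next
  case (add p q)
  then show ?case by (simp add: pact_add)
qed

lemma pact_var:
  "g \<in> carrier G \<Longrightarrow> x \<in> carrier L \<Longrightarrow> pact g (A.indexed_var x) = A.indexed_var (act g x)"
  by (simp add: A.indexed_var_eq_monomial pact_monomial)

text \<open>A lattice automorphism permutes the generating relations.\<close>

lemma pact_ideal:
  assumes g: "g \<in> carrier G" and p: "p \<in> I"
  shows "pact g p \<in> I"
proof -
  have "pact g ` lattice_relations A L = lattice_relations A L"
    by (rule A.lattice_relations_hom_image[OF L.bounded_lattice_axioms A.is_cring pact_hom[OF g] act_bij[OF g]])
       (use g in \<open>simp_all add: act_bottom act_top act_meet act_join pact_var\<close>)
  then have "pact g ` I \<subseteq> I"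
    using P.Idl_hom_image_subset[OF pact_hom[OF g] A.lattice_relations_closed[OF L.bounded_lattice_axioms]]
    unfolding A.lattice_ideal_eq[OF L.bounded_lattice_axioms] by simp
  then show ?thesis using p by blast
qed

lemma cls_mem: "cls p = {i \<oplus>\<^bsub>P\<^esub> p | i. i \<in> I}"
  unfolding cls_def a_r_coset_def' by auto

text \<open>The action on cosets is a set-theoretic image. That this image fills a whole coset needs
  the ideal to be mapped onto itself, which follows from \<open>pact_ideal\<close> for the inverse
  of \<open>g\<close>.\<close>

lemma tact_cls:
  assumes g: "g \<in> carrier G" and p: "p \<in> carrier P"
  shows "tact g (cls p) = cls (pact g p)"
proof
  show "tact g (cls p) \<subseteq> cls (pact g p)"
  proof
    fix q assume "q \<in> tact g (cls p)"
    then obtain i where i: "i \<in> I" "q = pact g (i \<oplus>\<^bsub>P\<^esub> p)"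
      unfolding lattice_ring_action_def cls_mem by blast
    then have "q = pact g i \<oplus>\<^bsub>P\<^esub> pact g p" by (simp add: pact_add)
    then show "q \<in> cls (pact g p)" unfolding cls_mem using pact_ideal[OF g i(1)] by blast
  qed
  show "cls (pact g p) \<subseteq> tact g (cls p)"
  proof
    fix q assume "q \<in> cls (pact g p)"
    then obtain i where i: "i \<in> I" "q = i \<oplus>\<^bsub>P\<^esub> pact g p" unfolding cls_mem by blast
    have "q = pact g (pact (inv\<^bsub>G\<^esub> g) i \<oplus>\<^bsub>P\<^esub> p)"
      using i pact_inv[OF g, of i] I.Icarr by (simp add: pact_add)
    moreover have "pact (inv\<^bsub>G\<^esub> g) i \<in> I" using pact_ideal[of "inv\<^bsub>G\<^esub> g"] g i by simp
    ultimately show "q \<in> tact g (cls p)" unfolding lattice_ring_action_def cls_mem by blast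
  qed
qed

lemma tact_hom:
  assumes g: "g \<in> carrier G"
  shows "ring_hom_cring T T (tact g)"
proof -
  interpret F: ring_hom_cring P P "pact g" by (rule pact_hom[OF g])
  have "tact g \<in> ring_hom T T"
  proof (rule ring_hom_memI)
    fix t assume t: "t \<in> carrier T"
    obtain p where p: "p \<in> carrier P" "t = cls p" using t by (rule T_carrierE)
    then show "tact g t \<in> carrier T" using tact_cls[OF g] by simp
    fix t' assume t': "t' \<in> carrier T"
    obtain q where q: "q \<in> carrier P" "t' = cls q" using t' by (rule T_carrierE)
    show "tact g (t \<otimes>\<^bsub>T\<^esub> t') = tact g t \<otimes>\<^bsub>T\<^esub> tact g t'"
      using p q tact_cls[OF g P.m_closed[OF p(1) q(1)]] tact_cls[OF g p(1)] tact_cls[OF g q(1)] by simp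
    show "tact g (t \<oplus>\<^bsub>T\<^esub> t') = tact g t \<oplus>\<^bsub>T\<^esub> tact g t'"
      using p q tact_cls[OF g P.a_closed[OF p(1) q(1)]] tact_cls[OF g p(1)] tact_cls[OF g q(1)] by simp
  next
    show "tact g \<one>\<^bsub>T\<^esub> = \<one>\<^bsub>T\<^esub>" using tact_cls[OF g P.one_closed] by simp
  qed
  then show ?thesis by (intro ring_hom_cringI T.is_cring)
qed

lemma tact_gen:
  assumes g: "g \<in> carrier G" and k: "k \<in> carrier A" and x: "x \<in> carrier L"
  shows "tact g (h k \<otimes>\<^bsub>T\<^esub> gen x) = h k \<otimes>\<^bsub>T\<^esub> gen (act g x)"
proof -
  interpret F: ring_hom_cring T T "tact g" by (rule tact_hom[OF g])
  have "tact g (h k) = h k"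
    unfolding lattice_ring_map_eq using tact_cls[OF g A.monomial_in_poly_ring[OF k, of "{#}"]] pact_monomial[OF g, of "{#}" k]
    by simp
  moreover have "tact g (gen x) = gen (act g x)"
    unfolding gen_def using tact_cls[OF g A.indexed_var_in_poly_ring[OF x]] pact_var[OF g x] by simp
  ultimately show ?thesis using k x by simp
qed

text \<open>The action permutes the generators and fixes the scalars, so invariance on generators
  spreads to the lattice ring by linearity.\<close>

lemma gen_restriction_invariant_iff:
  assumes \<phi>: "\<phi> \<in> linear_maps A (ring_along h T) B"
  shows "(\<forall>g\<in>carrier G. hom_action G tact (ring_along h T) g \<phi> = \<phi>) \<longleftrightarrow>
    (\<forall>g\<in>carrier G. \<forall>x\<in>carrier L. gen_restriction \<phi> (act g x) = gen_restriction \<phi> x)"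
proof
  assume inv: "\<forall>g\<in>carrier G. hom_action G tact (ring_along h T) g \<phi> = \<phi>"
  show "\<forall>g\<in>carrier G. \<forall>x\<in>carrier L. gen_restriction \<phi> (act g x) = gen_restriction \<phi> x"
  proof (intro ballI)
    fix g x assume g: "g \<in> carrier G" and x: "x \<in> carrier L"
    \<comment> \<open>The action on linear maps uses inverses, so the inverse of \<open>g\<close> is
      inserted to obtain \<open>g\<close> itself on the generators.\<close>
    have "hom_action G tact (ring_along h T) (inv\<^bsub>G\<^esub> g) \<phi> (gen x) = \<phi> (gen x)" using inv g by simp
    then have "\<phi> (tact g (gen x)) = \<phi> (gen x)" using g x by (simp add: hom_action_def)
    moreover have "tact g (gen x) = gen (act g x)" using tact_gen[OF g A.one_closed x] g x by simp
    ultimately show "gen_restriction \<phi> (act g x) = gen_restriction \<phi> x" using g x by (simp add: gen_restriction_def)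
  qed
next
  note D = linear_mapsD[OF \<phi>, simplified]
  assume inv: "\<forall>g\<in>carrier G. \<forall>x\<in>carrier L. gen_restriction \<phi> (act g x) = gen_restriction \<phi> x"
  show "\<forall>g\<in>carrier G. hom_action G tact (ring_along h T) g \<phi> = \<phi>"
  proof
    fix g assume g: "g \<in> carrier G"
    then have ig: "inv\<^bsub>G\<^esub> g \<in> carrier G" by simp
    interpret F: ring_hom_cring T T "tact (inv\<^bsub>G\<^esub> g)" by (rule tact_hom[OF ig])
    have "\<phi> (tact (inv\<^bsub>G\<^esub> g) t) = \<phi> t" if "t \<in> carrier T" for t
      using that
    proof (induction t rule: lattice_ring_induct)
      case (gen k x)
      have "\<phi> (gen (act (inv\<^bsub>G\<^esub> g) x)) = \<phi> (gen x)"
        using inv ig gen(2) by (simp add: gen_restriction_def)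
      then show ?case using D(4) tact_gen[OF ig gen] gen ig by simp
    next
      case (add t t')
      then show ?case using D(3) by simp
    qed
    then show "hom_action G tact (ring_along h T) g \<phi> = \<phi>"
      using D(1) by (intro extensionalityI[of _ "carrier T"]) (auto simp: hom_action_def)
  qed
qed

theorem gen_restriction_invariants_iso:
  "restrict gen_restriction (carrier (Hom_invariants G tact A (ring_along h T) B))
    \<in> module_iso A (Hom_invariants G tact A (ring_along h T) B) (invariant_measure_module G act L B)"
proof -
  let ?H = "linear_maps A (ring_along h T) B"
  let ?C = "{\<phi> \<in> ?H. \<forall>g\<in>carrier G. hom_action G tact (ring_along h T) g \<phi> = \<phi>}"
  let ?D = "{\<nu> \<in> lattice_measures L B. \<forall>g\<in>carrier G. \<forall>x\<in>carrier L. \<nu> (act g x) = \<nu> x}"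
  have img: "restrict gen_restriction ?H ` ?H = lattice_measures L B"
    using gen_restriction_iso unfolding module_iso_def bij_betw_def by (simp add: measure_module_simps)
  have "tact g t \<in> carrier T" if "g \<in> carrier G" "t \<in> carrier T" for g t
  proof -
    interpret F: ring_hom_cring T T "tact g" by (rule tact_hom[OF that(1)])
    show ?thesis using that by simp
  qed
  then have cl: "closed_operations A (Hom_invariants G tact A (ring_along h T) B)"
    by (intro closed_operations_Hom_invariants closed_operations_ring_along B.module_axioms group_G) auto
  have iso: "restrict (restrict gen_restriction ?H) ?C
    \<in> module_iso A ((Hom_module A (ring_along h T) B)\<lparr>carrier := ?C\<rparr>) ((measure_module L B)\<lparr>carrier := ?D\<rparr>)"
  proof (rule module_iso_restrict_carrier[OF gen_restriction_iso])
    show "restrict gen_restriction ?H ` ?C = ?D"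
    proof
      show "restrict gen_restriction ?H ` ?C \<subseteq> ?D"
        using gen_restriction_invariant_iff valuation_gen_restriction by auto
      show "?D \<subseteq> restrict gen_restriction ?H ` ?C"
      proof
        fix \<nu> assume \<nu>: "\<nu> \<in> ?D"
        then obtain \<phi> where \<phi>: "\<phi> \<in> ?H" "\<nu> = gen_restriction \<phi>" using img by force
        then have "\<phi> \<in> ?C" using gen_restriction_invariant_iff[OF \<phi>(1)] \<nu> by simp
        then show "\<nu> \<in> restrict gen_restriction ?H ` ?C" using \<phi> by (intro image_eqI[of _ _ \<phi>]) auto
      qed
    qed
  qed (use cl in \<open>auto simp: Hom_invariants_def\<close>)
  have eq: "restrict (restrict gen_restriction ?H) ?C = restrict gen_restriction ?C"
    by (auto simp: restrict_def fun_eq_iff)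
  have C: "carrier (Hom_invariants G tact A (ring_along h T) B) = ?C" by (simp add: Hom_invariants_def)
  show ?thesis using iso unfolding eq C unfolding invariant_measure_module_def Hom_invariants_def .
qed

section \<open>The group action on global functions\<close>

abbreviation "gact \<equiv> global_functions_action G act A L"

text \<open>Equivariance of \<open>global_frac\<close>: the comorphism formula for the ring
  endomorphism of \<open>T\<close> given by \<open>g\<close>.\<close>

lemma gact_global_frac:
  assumes g: "g \<in> carrier G" and t: "t \<in> carrier T"
  shows "gact g (global_frac T t) = global_frac T (tact g t)"
proof -
  interpret F: affine_hom T T "tact g" by (rule affine_hom.intro[OF tact_hom[OF g]])
  show ?thesis unfolding global_functions_action_def by (rule F.Spec_comorphism_global_frac[OF t])
qed

abbreviation pullback where
  "pullback \<equiv> (\<lambda>\<phi>\<in>linear_maps A global_module B. compose (carrier T) \<phi> (global_frac T))"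

lemma pullback_iso:
  "pullback \<in> module_iso A (Hom_module A global_module B) (Hom_module A (ring_along h T) B)"
proof -
  have "(\<lambda>\<phi>\<in>carrier (Hom_module A global_module B). compose (carrier (ring_along h T)) \<phi> (restrict (global_frac T) (carrier T)))
    \<in> module_iso A (Hom_module A global_module B) (Hom_module A (ring_along h T) B)"
    by (rule Hom_module_precompose_iso[OF global_frac_iso closed_operations_ring_along B.module_axioms closed_operations_global_module])
  moreover have "compose (carrier (ring_along h T)) \<phi> (restrict (global_frac T) (carrier T)) = compose (carrier T) \<phi> (global_frac T)"
    for \<phi> :: "_ \<Rightarrow> 'b" by (auto simp: compose_def)
  ultimately show ?thesis by simp
qed

text \<open>Precomposition with the equivariant map \<open>global_frac\<close> compares the two
  actions on the elements t / 1, and these are all the global functions.\<close>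

lemma pullback_invariant_iff:
  assumes \<phi>: "\<phi> \<in> linear_maps A global_module B" and g: "g \<in> carrier G"
  shows "hom_action G tact (ring_along h T) g (pullback \<phi>) = pullback \<phi> \<longleftrightarrow> hom_action G gact global_module g \<phi> = \<phi>"
proof -
  have ig: "inv\<^bsub>G\<^esub> g \<in> carrier G" using g by simp
  interpret F: ring_hom_cring T T "tact (inv\<^bsub>G\<^esub> g)" by (rule tact_hom[OF ig])
  have 1: "hom_action G tact (ring_along h T) g (pullback \<phi>) t = \<phi> (gact (inv\<^bsub>G\<^esub> g) (global_frac T t))" if "t \<in> carrier T" for t
    using that \<phi> gact_global_frac[OF ig that] by (simp add: hom_action_def compose_def)
  have 2: "pullback \<phi> t = \<phi> (global_frac T t)" if "t \<in> carrier T" for t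
    using that \<phi> by (simp add: compose_def)
  have 3: "hom_action G gact global_module g \<phi> \<xi> = \<phi> (gact (inv\<^bsub>G\<^esub> g) \<xi>)" if "\<xi> \<in> carrier global_module" for \<xi>
    using that by (simp add: hom_action_def)
  have ext: "pullback \<phi> \<in> extensional (carrier T)" "hom_action G tact (ring_along h T) g (pullback \<phi>) \<in> extensional (carrier T)"
    "\<phi> \<in> extensional (carrier global_module)" "hom_action G gact global_module g \<phi> \<in> extensional (carrier global_module)"
    using linear_mapsD(1)[OF \<phi>] \<phi> by (auto simp: hom_action_def)
  show ?thesis
  proof
    assume eq: "hom_action G tact (ring_along h T) g (pullback \<phi>) = pullback \<phi>"
    show "hom_action G gact global_module g \<phi> = \<phi>"
    proof (rule extensionalityI[OF ext(4,3)])
      fix \<xi> assume \<xi>: "\<xi> \<in> carrier global_module"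
      obtain t where t: "t \<in> carrier T" "\<xi> = global_frac T t" using \<xi> by (rule global_moduleE)
      show "hom_action G gact global_module g \<phi> \<xi> = \<phi> \<xi>"
        using 3[OF \<xi>] 1[OF t(1)] 2[OF t(1)] fun_cong[OF eq, of t] t(2) by simp
    qed
  next
    assume eq: "hom_action G gact global_module g \<phi> = \<phi>"
    show "hom_action G tact (ring_along h T) g (pullback \<phi>) = pullback \<phi>"
    proof (rule extensionalityI[OF ext(2,1)])
      fix t assume t: "t \<in> carrier T"
      show "hom_action G tact (ring_along h T) g (pullback \<phi>) t = pullback \<phi> t"
        using 1[OF t] 2[OF t] 3[OF global_frac_closed[OF t]] fun_cong[OF eq, of "global_frac T t"] by simp
    qed
  qed
qed

lemma gact_closed:
  assumes g: "g \<in> carrier G" and \<xi>: "\<xi> \<in> carrier global_module"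
  shows "gact g \<xi> \<in> carrier global_module"
proof -
  interpret F: ring_hom_cring T T "tact g" by (rule tact_hom[OF g])
  obtain t where t: "t \<in> carrier T" "\<xi> = global_frac T t" using \<xi> by (rule global_moduleE)
  then show ?thesis using gact_global_frac[OF g t(1)] global_frac_closed[of "tact g t"] by simp
qed

lemma closed_operations_global_invariants:
  "closed_operations A (Hom_invariants G gact A global_module B)"
  by (rule closed_operations_Hom_invariants[OF closed_operations_global_module B.module_axioms group_G gact_closed])

theorem pullback_invariants_iso:
  "restrict pullback (carrier (Hom_invariants G gact A global_module B))
    \<in> module_iso A (Hom_invariants G gact A global_module B) (Hom_invariants G tact A (ring_along h T) B)"
proof -
  let ?C = "{\<phi> \<in> linear_maps A global_module B. \<forall>g\<in>carrier G. hom_action G gact global_module g \<phi> = \<phi>}"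
  let ?D = "{\<phi> \<in> linear_maps A (ring_along h T) B. \<forall>g\<in>carrier G. hom_action G tact (ring_along h T) g \<phi> = \<phi>}"
  have img: "pullback ` linear_maps A global_module B = linear_maps A (ring_along h T) B"
    using pullback_iso unfolding module_iso_def bij_betw_def by simp
  have iso: "restrict pullback ?C
    \<in> module_iso A ((Hom_module A global_module B)\<lparr>carrier := ?C\<rparr>) ((Hom_module A (ring_along h T) B)\<lparr>carrier := ?D\<rparr>)"
  proof (rule module_iso_restrict_carrier[OF pullback_iso])
    show "pullback ` ?C = ?D"
    proof
      show "pullback ` ?C \<subseteq> ?D"
      proof
        fix \<psi> assume "\<psi> \<in> pullback ` ?C"
        then obtain \<phi> where \<phi>: "\<phi> \<in> ?C" "\<psi> = pullback \<phi>" by blast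
        then have "\<psi> \<in> linear_maps A (ring_along h T) B" using img by blast
        then show "\<psi> \<in> ?D" using \<phi> pullback_invariant_iff by blast
      qed
      show "?D \<subseteq> pullback ` ?C"
      proof
        fix \<psi> assume \<psi>: "\<psi> \<in> ?D"
        then obtain \<phi> where \<phi>: "\<phi> \<in> linear_maps A global_module B" "\<psi> = pullback \<phi>" using img by blast
        then have "\<phi> \<in> ?C" using \<psi> pullback_invariant_iff by blast
        then show "\<psi> \<in> pullback ` ?C" using \<phi>(2) by blast
      qed
    qed
    show "closed_operations A ((Hom_module A global_module B)\<lparr>carrier := ?C\<rparr>)"
      using closed_operations_global_invariants unfolding Hom_invariants_def .
  qed auto
  have C: "carrier (Hom_invariants G gact A global_module B) = ?C" by (simp add: Hom_invariants_def)
  show ?thesis using iso unfolding C unfolding Hom_invariants_def .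
qed

end

theorem mainTheorem7:
  fixes L :: "('x, 'e) gorder_scheme"
    and G :: "('g, 'h) monoid_scheme"
    and act :: "'g \<Rightarrow> 'x \<Rightarrow> 'x"
    and A :: "('a, 'c) ring_scheme"
    and B :: "('a, 'b, 'd) module_scheme"
  assumes "bounded_lattice L"
    and "group_action G (carrier L) act"
    and "\<And>g. g \<in> carrier G \<Longrightarrow> join_pres L L (act g) \<and> meet_pres L L (act g)"
    and "cring A"
    and "module A B"
  shows "module_isomorphic A
          (measure_sheaf_global A L B)
          (Hom_module A (global_functions A L) B)
    \<and> (\<lambda>\<phi>\<in>carrier (Hom_module A (global_functions A L) B).
            compose (carrier (lattice_ring A L)) \<phi> (global_frac (lattice_ring A L)))
          \<in> module_iso A
              (Hom_module A (global_functions A L) B)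
              (Hom_module A (lattice_ring_module A L) B)
    \<and> module_isomorphic A
          (measure_module L B)
          (Hom_module A (global_functions A L) B)
    \<and> module_isomorphic A
          (invariant_measure_module G act L B)
          (Hom_invariants G (global_functions_action G act A L) A (global_functions A L) B)
    \<and> module_isomorphic A
          (invariant_measure_module G act L B)
          (Hom_invariants G (lattice_ring_action G act A L) A (lattice_ring_module A L) B)
    \<and> (\<exists>\<Phi>. bij_betw \<Phi> (carrier (measure_module L B)) (carrier (measure_sheaf_global A L B)))"
proof -
  interpret lattice_action L A B G act
    by (intro lattice_action.intro lattice_module.intro lattice_coefficients.intro lattice_action_axioms.intro assms)
  have gf: "global_functions A L = global_module" by (simp add: global_functions_def)
  have lrm: "lattice_ring_module A L = ring_along h T" by (simp add: lattice_ring_module_def)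
  have msg: "measure_sheaf_global A L B = sheaf_hom_global"
    by (simp add: measure_sheaf_global_def measure_sheaf_def)
  have clG: "closed_operations A (Hom_module A global_module B)"
    by (rule closed_operations_Hom_module[OF closed_operations_global_module B.module_axioms])
  have clT: "closed_operations A (Hom_module A (ring_along h T) B)"
    by (rule closed_operations_Hom_module[OF closed_operations_ring_along B.module_axioms])
  \<comment> \<open>Linear maps on global functions are first pulled back to linear maps on the
    lattice ring; the composite with the explicit isomorphism leaving that Hom module is then
    inverted.\<close>
  note sheaf = module_iso_inverse[OF module_iso_compose[OF pullback_iso induced_morphism_iso clG] clG]
  note meas = module_iso_inverse[OF module_iso_compose[OF pullback_iso gen_restriction_iso clG] clG]
  have clTG: "closed_operations A (Hom_invariants G tact A (ring_along h T) B)"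
  proof (rule closed_operations_Hom_invariants[OF closed_operations_ring_along B.module_axioms group_G])
    fix g t assume g: "g \<in> carrier G" and t: "t \<in> carrier (ring_along h T)"
    interpret F: ring_hom_cring T T "tact g" by (rule tact_hom[OF g])
    show "tact g t \<in> carrier (ring_along h T)" using t by simp
  qed
  note clGG = closed_operations_global_invariants
  note inv4 = module_iso_inverse[OF module_iso_compose[OF pullback_invariants_iso gen_restriction_invariants_iso clGG] clGG]
  note inv5 = module_iso_inverse[OF gen_restriction_invariants_iso clTG]
  have bij: "\<exists>\<Phi>. bij_betw \<Phi> (carrier (measure_module L B)) (carrier sheaf_hom_global)"
  proof -
    have "bij_betw (restrict gen_restriction (linear_maps A (ring_along h T) B)) (linear_maps A (ring_along h T) B) (carrier (measure_module L B))"
      "bij_betw (restrict induced_morphism (linear_maps A (ring_along h T) B)) (linear_maps A (ring_along h T) B) (carrier sheaf_hom_global)"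
      using gen_restriction_iso induced_morphism_iso unfolding module_iso_def by simp_all
    then show ?thesis using bij_betw_inv_into bij_betw_trans by blast
  qed
  show ?thesis
    unfolding gf lrm msg
  proof (intro conjI)
    show "module_isomorphic A sheaf_hom_global (Hom_module A global_module B)"
      using sheaf unfolding module_isomorphic_def by blast
    show "(\<lambda>\<phi>\<in>carrier (Hom_module A global_module B). compose (carrier T) \<phi> (global_frac T))
      \<in> module_iso A (Hom_module A global_module B) (Hom_module A (ring_along h T) B)"
      using pullback_iso by simp
    show "module_isomorphic A (measure_module L B) (Hom_module A global_module B)"
      using meas unfolding module_isomorphic_def by blast
    show "module_isomorphic A (invariant_measure_module G act L B) (Hom_invariants G gact A global_module B)"
      using inv4 unfolding module_isomorphic_def by blast
    show "module_isomorphic A (invariant_measure_module G act L B) (Hom_invariants G tact A (ring_along h T) B)"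
      using inv5 unfolding module_isomorphic_def by blast
  qed (rule bij)
qed

end
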